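(* Let $\alpha\in\mathbb C^2$ and assume $p\not\equiv0\bmod3$. (Case I) If $-q,p,0$ are not mutually different in $\mathbb Z_3$, i.e. $\{-q,p,0\}=\{p,0\}$ as subsets of $\mathbb Z_3$, then there exist $m\in\{p,0\}$ and $n\in\{p,0\}$ with $n\ne m$ such that $$\dim\ker_{L^2_{m,0}}D(\alpha)\ge2,\qquad \ker_{L^2_{n,0}}D(\alpha)\ne\{0\}.$$ (Case II) If $-q,p,0$ are mutually different in $\mathbb Z_3$, then $$\ker_{L^2_{p,0}}D(\alpha)\ne\{0\},\qquad\ker_{L^2_{0,0}}D(\alpha)\ne\{0\},\qquad\ker_{L^2_{-q,0}}D(\alpha)\neq\{0\}.$$
   Context: Notation: $\omega=e^{2\pi i/3}$, $D_{\bar z}=\frac1i\partial_{\bar z}$; $\Gamma_3=\frac{4\pi i}3(\omega\mathbb Z\oplus\omega^2\mathbb Z)$ with elements $a=\frac{4\pi i}3(\omega a_1+\omega^2a_2)$. Twisting angles: $\zeta_1,\zeta_2$ are nonzero real numbers with $\zeta_2/\zeta_1=3^j r_1/r_2$, $r_1,j\in\mathbb Z$, $r_2\in\mathbb N$, $r_1,r_2\not\equiv0\bmod3$. Set $p=r_2$, $q=0$ if $j>0$, and $p=3^{-j}r_2$, $q=r_1$ if $j\le0$; $\tilde p:=p\zeta_2/\zeta_1\in\mathbb Z$, $\tilde p\equiv q\bmod3$. Potential: $U\in C^\infty(\mathbb C;\mathbb C)$ with $U(z+a)=\bar\omega^{a_1+a_2}U(z)$ for $a\in\Gamma_3$, $U(\omega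 z)=\omega U(z)$, $\overline{U(\bar z)}=U(z)$. For $\alpha=(\alpha_{12},\alpha_{23})\in\mathbb C^2$, $$D(\alpha)=\begin{pmatrix}2D_{\bar z}&\alpha_{12}U(pz)&0\\ \alpha_{12}U(-pz)&2D_{\bar z}&\alpha_{23}U(\tilde pz)\\0&\alpha_{23}U(-\tilde pz)&2D_{\bar z}\end{pmatrix}.$$ For $r,\ell\in\mathbb Z_3$, $L^2_{r,\ell}$ is the space of $u\in L^2_{\rm loc}(\mathbb C;\mathbb C^3)$ with $\operatorname{diag}(\omega^{p(a_1+a_2)},1,\bar\omega^{q(a_1+a_2)})u(z+a)=\omega^{r(a_1+a_2)}u(z)$ for all $a\in\Gamma_3$ and $u(\omega z)=\bar\omega^\ell u(z)$. *)

theory Defs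
  imports "HOL-Analysis.Analysis" "HOL-Library.Extended_Nat" "HOL-Number_Theory.Cong"
begin

definition om :: complex where
  "om = exp (2 * of_real pi * \<i> / 3)"

text \<open>The lattice \<open>\<Gamma>\<^sub>3\<close> is the range of \<open>lattice_pt\<close>.\<close>

definition lattice_pt :: "int \<Rightarrow> int \<Rightarrow> complex" where
  "lattice_pt a1 a2 = 4 * of_real pi * \<i> / 3 * (om * of_int a1 + om ^ 2 * of_int a2)"

fun times_diff :: "nat \<Rightarrow> ('a::real_normed_vector \<Rightarrow> 'b::real_normed_vector) \<Rightarrow> bool" where
  "times_diff 0 f \<longleftrightarrow> continuous_on UNIV f"
| "times_diff (Suc k) f \<longleftrightarrow>
     (\<forall>x. f differentiable (at x)) \<and> (\<forall>v. times_diff k (\<lambda>x. frechet_derivative f (at x) v))"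

text \<open>Smoothness is \<open>C\<^sup>\<infinity>\<close> in the real sense; on \<open>complex\<close> it does not imply holomorphy.\<close>

definition smooth :: "('a::real_normed_vector \<Rightarrow> 'b::real_normed_vector) \<Rightarrow> bool" where
  "smooth f \<longleftrightarrow> (\<forall>k. times_diff k f)"

definition is_potential :: "(complex \<Rightarrow> complex) \<Rightarrow> bool" where
  "is_potential U \<longleftrightarrow> smooth U \<and>
     (\<forall>a1 a2 z. U (z + lattice_pt a1 a2) = cnj om powi (a1 + a2) * U z) \<and>
     (\<forall>z. U (om * z) = om * U z) \<and>
     (\<forall>z. cnj (U (cnj z)) = U z)"

text \<open>\<open>(\<partial>\<^sub>x + i \<partial>\<^sub>y)/2\<close> is the derivative in the conjugate variable.\<close>

definition Dzbar :: "(complex \<Rightarrow> complex) \<Rightarrow> complex \<Rightarrow> complex" where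
  "Dzbar f z = (1 / \<i>) *
     ((frechet_derivative f (at z) 1 + \<i> * frechet_derivative f (at z) \<i>) / 2)"

definition test_function :: "(complex \<Rightarrow> complex) \<Rightarrow> bool" where
  "test_function \<phi> \<longleftrightarrow> smooth \<phi> \<and> (\<exists>K. compact K \<and> (\<forall>z. z \<notin> K \<longrightarrow> \<phi> z = 0))"

text \<open>\<open>w\<close> is \<open>Dzbar u\<close> in the sense of distributions.\<close>

definition weak_Dzbar :: "(complex \<Rightarrow> complex) \<Rightarrow> (complex \<Rightarrow> complex) \<Rightarrow> bool" where
  "weak_Dzbar u w \<longleftrightarrow>
     (\<forall>\<phi>. test_function \<phi> \<longrightarrow>
        (LINT z|lebesgue. w z * \<phi> z) = - (LINT z|lebesgue. u z * Dzbar \<phi> z))"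

text \<open>
  Elements of \<open>L\<^sup>2\<close>-spaces are represented by functions; all identities between them,
  including linear independence, are understood almost everywhere.
\<close>

definition L2loc :: "(complex \<Rightarrow> complex ^ 3) set" where
  "L2loc = {u \<in> borel_measurable lebesgue.
     \<forall>K. compact K \<longrightarrow> set_integrable lebesgue K (\<lambda>z. (norm (u z))\<^sup>2)}"

definition ae_independent :: "nat \<Rightarrow> (nat \<Rightarrow> complex \<Rightarrow> complex ^ 3) \<Rightarrow> bool" where
  "ae_independent n b \<longleftrightarrow>
     (\<forall>c :: nat \<Rightarrow> complex. (AE z in lebesgue. (\<Sum>i<n. c i *s b i z) = 0) \<longrightarrow> (\<forall>i<n. c i = 0))"

definition ae_dim :: "(complex \<Rightarrow> complex ^ 3) set \<Rightarrow> enat" where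
  "ae_dim V = Sup {enat n | n. \<exists>b. (\<forall>i<n. b i \<in> V) \<and> ae_independent n b}"

definition ae_trivial :: "(complex \<Rightarrow> complex ^ 3) set \<Rightarrow> bool" where
  "ae_trivial V \<longleftrightarrow> (\<forall>u\<in>V. AE z in lebesgue. u z = 0)"

definition diag3 :: "complex \<Rightarrow> complex \<Rightarrow> complex \<Rightarrow> complex ^ 3 ^ 3" where
  "diag3 x y z = vector [vector [x, 0, 0], vector [0, y, 0], vector [0, 0, z]]"

text \<open>
  The spaces \<open>L\<^sup>2\<^bsub>r,l\<^esub>\<close>; the integers \<open>r\<close>, \<open>l\<close> stand for their residue classes modulo 3,
  on which alone the conditions depend because \<open>om ^ 3 = 1\<close>.
\<close>

definition L2_sector :: "int \<Rightarrow> int \<Rightarrow> int \<Rightarrow> int \<Rightarrow> (complex \<Rightarrow> complex ^ 3) set" where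
  "L2_sector p q r l = {u \<in> L2loc.
     (\<forall>a1 a2. AE z in lebesgue.
        diag3 (om powi (p * (a1 + a2))) 1 (cnj om powi (q * (a1 + a2))) *v u (z + lattice_pt a1 a2)
          = om powi (r * (a1 + a2)) *s u z) \<and>
     (AE z in lebesgue. u (om * z) = cnj om powi l *s u z)}"

definition potential_matrix ::
  "(complex \<Rightarrow> complex) \<Rightarrow> int \<Rightarrow> real \<Rightarrow> complex \<times> complex \<Rightarrow> complex \<Rightarrow> complex ^ 3 ^ 3" where
  "potential_matrix U p pt \<alpha> z = (let \<alpha>12 = fst \<alpha>; \<alpha>23 = snd \<alpha> in vector
     [vector [0, \<alpha>12 * U (of_int p * z), 0],
      vector [\<alpha>12 * U (- (of_int p * z)), 0, \<alpha>23 * U (of_real pt * z)],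
      vector [0, \<alpha>23 * U (- (of_real pt * z)), 0]])"

text \<open>
  The graph of \<open>D(\<alpha>)\<close>, with its maximal domain: those \<open>u\<close> in \<open>L\<^sup>2\<^sub>l\<^sub>o\<^sub>c\<close> whose distributional
  derivative \<open>w\<close> is in \<open>L\<^sup>2\<^sub>l\<^sub>o\<^sub>c\<close>.
\<close>

definition D_graph ::
  "(complex \<Rightarrow> complex) \<Rightarrow> int \<Rightarrow> real \<Rightarrow> complex \<times> complex \<Rightarrow>
   (complex \<Rightarrow> complex ^ 3) \<Rightarrow> (complex \<Rightarrow> complex ^ 3) \<Rightarrow> bool" where
  "D_graph U p pt \<alpha> u f \<longleftrightarrow> u \<in> L2loc \<and>
     (\<exists>w\<in>L2loc. (\<forall>i. weak_Dzbar (\<lambda>z. u z $ i) (\<lambda>z. w z $ i)) \<and>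
        (AE z in lebesgue. f z = 2 *s w z + potential_matrix U p pt \<alpha> z *v u z))"

definition ker_D ::
  "(complex \<Rightarrow> complex) \<Rightarrow> int \<Rightarrow> int \<Rightarrow> real \<Rightarrow> complex \<times> complex \<Rightarrow> int \<Rightarrow> int \<Rightarrow>
   (complex \<Rightarrow> complex ^ 3) set" where
  "ker_D U p q pt \<alpha> r l = {u \<in> L2_sector p q r l. D_graph U p pt \<alpha> u (\<lambda>_. 0)}"

end

theory Submission
  imports Defs "HOL-Library.Function_Algebras" "HOL-Probability.Discrete_Topology"
begin

text \<open>
  In Fourier series \<open>u\<^sub>i(z) = \<Sum>\<^sub>k u(i, k) exp(\<i> (\<kappa>\<^sub>k \<bullet> z))\<close> the equation \<open>D(\<alpha>) u = 0\<close> reads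
  \<open>\<kappa>\<^sub>k u(i, k) + (V u)(i, k) = 0\<close>, where \<open>V\<close> is convolution with the rapidly decreasing coefficients of the
  potentials. On rotation invariant \<open>u\<close> both terms are multiplied by \<open>cnj om\<close> when \<open>k\<close> is rotated, so
  the equations at \<open>k = 0\<close> hold automatically, whereas the unknowns \<open>u(i, 0)\<close> are free for each constant
  vector \<open>e\<^sub>i\<close> in the sector. For large \<open>k\<close> the equations determine \<open>u(i, k)\<close> by a contraction; what remains is
  a finite linear system whose unknowns outnumber its equations by the number of these \<open>e\<^sub>i\<close>. Since
  \<open>e\<^sub>1\<close>, \<open>e\<^sub>2\<close>, \<open>e\<^sub>3\<close> lie in the sectors \<open>p\<close>, \<open>0\<close>, \<open>-q\<close>, this number is at least the claimed dimension.
\<close>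

section \<open>Invariant solutions of infinite linear systems\<close>

text \<open>The obstacle is to count dimensions in an infinite system and still end with functions
  for which every condition can be checked. Sequences that stay bounded after multiplication by
  \<open>weight\<close> serve both purposes. \<open>weight\<close> is submultiplicative, so
  convolution with the potentials, whose coefficients decay faster than any power, is a bounded
  operator. Boundedness against \<open>weight\<close> also makes both \<open>u\<close> and
  \<open>freq k * u\<close> absolutely summable, so the solutions and their \<open>Dzbar\<close> are
  continuous and the almost everywhere conditions hold at every point. The multipliers of a sector
  are cube roots of unity, so its elements are periodic under three times the lattice. This is the
  origin of the triple cell, and membership in a sector becomes a congruence mod 3 on the frequency
  index of each component. The count is an index: where the frequency is nonzero there are as many
  equations as unknowns, so the surplus comes from frequency 0 alone. It is made at each fixed
  \<alpha>. Which constant vectors share a sector depends on the coincidences among p, 0, -q mod 3;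
  this is the division into two cases.\<close>

lemma (in vector_space) nontrivial_combination:
  assumes "finite A" "finite B" "card B < card A" "f ` A \<subseteq> span B"
  shows "\<exists>c. (\<exists>a\<in>A. c a \<noteq> 0) \<and> (\<Sum>a\<in>A. scale (c a) (f a)) = 0"
proof (cases "inj_on f A")
  case True
  have "dependent (f ` A)"
    using independent_span_bound[of B "f ` A"] assms card_image[OF True] by auto
  then obtain u where u: "\<exists>v\<in>f ` A. u v \<noteq> 0" "(\<Sum>v\<in>f ` A. scale (u v) v) = 0"
    using dependent_finite[of "f ` A"] assms(1) by auto
  show ?thesis
    using u by (intro exI[of _ "u \<circ> f"]) (auto simp: sum.reindex[OF True])
next
  case False
  then obtain a b where ab: "a \<in> A" "b \<in> A" "a \<noteq> b" "f a = f b"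
    by (auto simp: inj_on_def)
  \<comment> \<open>Linear dependence concerns the image as a set and misses repetitions; equal
    vectors at two indices give the relation with coefficients 1 and -1.\<close>
  define c :: "_ \<Rightarrow> 'a" where "c = (\<lambda>x. if x = a then 1 else if x = b then - 1 else 0)"
  have "(\<Sum>x\<in>A. scale (c x) (f x)) = (\<Sum>x\<in>{a, b}. scale (c x) (f x))"
    by (rule sum.mono_neutral_right) (use ab assms(1) in \<open>auto simp: c_def\<close>)
  also have "\<dots> = 0"
    using ab by (simp add: c_def)
  finally show ?thesis
    using ab by (intro exI[of _ c]) (auto simp: c_def)
qed

text \<open>Rank-nullity in the form of explicit relations. Each step takes one nontrivial relation
  \<open>d\<close> and removes an index \<open>a0\<close> with \<open>d a0 \<noteq> 0\<close>; the
  relations found later do not involve \<open>a0\<close>, which keeps \<open>d\<close> independent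
  of them.\<close>

lemma (in vector_space) independent_combinations:
  assumes "finite A" "finite B" "card B + n \<le> card A" "f ` A \<subseteq> span B"
  shows "\<exists>x. (\<forall>i<n. (\<Sum>a\<in>A. scale (x i a) (f a)) = 0) \<and>
           (\<forall>c. (\<forall>a\<in>A. (\<Sum>i<n. c i * x i a) = 0) \<longrightarrow> (\<forall>i<n. c i = 0))"
  using assms(1,3,4)
proof (induction n arbitrary: A)
  case 0
  show ?case by simp
next
  case (Suc n)
  have "card B < card A" using Suc.prems by simp
  from nontrivial_combination[OF Suc.prems(1) assms(2) this Suc.prems(3)]
  obtain d a0 where d: "a0 \<in> A" "d a0 \<noteq> 0" "(\<Sum>a\<in>A. scale (d a) (f a)) = 0" by auto
  have "\<exists>x. (\<forall>i<n. (\<Sum>a\<in>A - {a0}. scale (x i a) (f a)) = 0) \<and>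
           (\<forall>c. (\<forall>a\<in>A - {a0}. (\<Sum>i<n. c i * x i a) = 0) \<longrightarrow> (\<forall>i<n. c i = 0))"
    using Suc.prems d(1) by (intro Suc.IH) (auto simp: card_Diff_singleton)
  then obtain x where x: "\<And>i. i < n \<Longrightarrow> (\<Sum>a\<in>A - {a0}. scale (x i a) (f a)) = 0"
    and xi: "\<And>c. (\<forall>a\<in>A - {a0}. (\<Sum>i<n. c i * x i a) = 0) \<Longrightarrow> (\<forall>i<n. c i = 0)"
    by blast
  define y where "y = (\<lambda>i a. if i = n then d a else if a = a0 then 0 else x i a)"
  have 1: "(\<Sum>a\<in>A. scale (y i a) (f a)) = 0" if "i < Suc n" for i
  proof (cases "i = n")
    case True
    then show ?thesis using d by (simp add: y_def)
  next
    case False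
    have "(\<Sum>a\<in>A. scale (y i a) (f a)) = scale (y i a0) (f a0) + (\<Sum>a\<in>A - {a0}. scale (y i a) (f a))"
      using Suc.prems(1) d(1) by (rule sum.remove)
    also have "(\<Sum>a\<in>A - {a0}. scale (y i a) (f a)) = (\<Sum>a\<in>A - {a0}. scale (x i a) (f a))"
      using False by (intro sum.cong) (auto simp: y_def)
    finally show ?thesis using x that False by (simp add: y_def)
  qed
  have 2: "\<forall>i<Suc n. c i = 0" if c: "\<forall>a\<in>A. (\<Sum>i<Suc n. c i * y i a) = 0" for c
  proof -
    \<comment> \<open>At \<open>a0\<close> only relation \<open>n\<close> has a nonzero entry, which
      isolates \<open>c n\<close>.\<close>
    have "(\<Sum>i<n. c i * y i a0) = 0"
      by (rule sum.neutral) (auto simp: y_def)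
    then have cn: "c n = 0"
      using c[rule_format, OF d(1)] d(2) by (simp add: y_def)
    have "(\<Sum>i<n. c i * x i a) = 0" if "a \<in> A - {a0}" for a
    proof -
      have "(\<Sum>i<n. c i * x i a) = (\<Sum>i<n. c i * y i a)"
        using that by (intro sum.cong) (auto simp: y_def)
      then show ?thesis using c cn that by auto
    qed
    then have "\<forall>i<n. c i = 0" using xi by blast
    then show ?thesis using cn by (auto simp: less_Suc_eq)
  qed
  show ?case using 1 2 by blast
qed


section \<open>Infinite sums and contractions in weighted sup norms\<close>

lemma has_sum_finite_sum:
  fixes f :: "'i \<Rightarrow> 'k \<Rightarrow> 'b::topological_comm_monoid_add"
  assumes "finite A" "\<And>a. a \<in> A \<Longrightarrow> (f a has_sum s a) B"
  shows "((\<lambda>x. \<Sum>a\<in>A. f a x) has_sum (\<Sum>a\<in>A. s a)) B"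
  using assms by (induction A rule: finite_induct) (auto intro!: has_sum_add)

lemma infsum_finite_sum:
  fixes f :: "'i \<Rightarrow> 'k \<Rightarrow> 'b::{topological_comm_monoid_add, t2_space}"
  assumes "finite A" "\<And>a. a \<in> A \<Longrightarrow> f a summable_on B"
  shows "(\<lambda>x. \<Sum>a\<in>A. f a x) summable_on B" and "(\<Sum>\<^sub>\<infinity>x\<in>B. \<Sum>a\<in>A. f a x) = (\<Sum>a\<in>A. \<Sum>\<^sub>\<infinity>x\<in>B. f a x)"
proof -
  have "((\<lambda>x. \<Sum>a\<in>A. f a x) has_sum (\<Sum>a\<in>A. \<Sum>\<^sub>\<infinity>x\<in>B. f a x)) B"
    using assms by (intro has_sum_finite_sum) auto
  then show "(\<lambda>x. \<Sum>a\<in>A. f a x) summable_on B" "(\<Sum>\<^sub>\<infinity>x\<in>B. \<Sum>a\<in>A. f a x) = (\<Sum>a\<in>A. \<Sum>\<^sub>\<infinity>x\<in>B. f a x)"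
    by (auto simp: has_sum_imp_summable infsumI)
qed

text \<open>The Schur test for a weighted sup norm, one row at a time: conjugating by the diagonal
  matrix \<open>w\<close> turns the entry in column \<open>\<kappa>'\<close> into
  \<open>a \<kappa>' * (w \<kappa> / w \<kappa>')\<close>, and row sums of absolute values bound an
  operator on bounded sequences.\<close>

lemma weighted_row_bound:
  fixes a u :: "'k \<Rightarrow> complex" and w :: "'k \<Rightarrow> real"
  assumes w: "\<And>\<kappa>. w \<kappa> > 0"
    and sm: "(\<lambda>\<kappa>'. norm (a \<kappa>') * (w \<kappa> / w \<kappa>')) summable_on UNIV"
    and le: "(\<Sum>\<^sub>\<infinity>\<kappa>'. norm (a \<kappa>') * (w \<kappa> / w \<kappa>')) \<le> C"
    and u: "\<And>\<kappa>. norm (u \<kappa>) * w \<kappa> \<le> B"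
  shows "(\<lambda>\<kappa>'. a \<kappa>' * u \<kappa>') summable_on UNIV"
    and "norm (\<Sum>\<^sub>\<infinity>\<kappa>'. a \<kappa>' * u \<kappa>') * w \<kappa> \<le> C * B"
proof -
  have B: "0 \<le> B" using u[of \<kappa>] w[of \<kappa>] by (smt (verit) mult_nonneg_nonneg norm_ge_zero)
  have le1: "norm (a \<kappa>' * u \<kappa>') \<le> norm (a \<kappa>') * (w \<kappa> / w \<kappa>') * (B / w \<kappa>)" for \<kappa>'
  proof -
    have "norm (u \<kappa>') \<le> B / w \<kappa>'" using u[of \<kappa>'] w[of \<kappa>'] by (simp add: field_simps)
    then have "norm (a \<kappa>') * norm (u \<kappa>') \<le> norm (a \<kappa>') * (B / w \<kappa>')"
      by (rule mult_left_mono) simp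
    then show ?thesis using w[of \<kappa>] by (simp add: norm_mult field_simps)
  qed
  have s1: "(\<lambda>\<kappa>'. norm (a \<kappa>') * (w \<kappa> / w \<kappa>') * (B / w \<kappa>)) summable_on UNIV"
    by (intro summable_on_cmult_left sm)
  then have s2: "(\<lambda>\<kappa>'. norm (a \<kappa>' * u \<kappa>')) summable_on UNIV"
    by (rule summable_on_comparison_test) (use le1 in auto)
  then show "(\<lambda>\<kappa>'. a \<kappa>' * u \<kappa>') summable_on UNIV"
    by (rule abs_summable_summable)
  have "norm (\<Sum>\<^sub>\<infinity>\<kappa>'. a \<kappa>' * u \<kappa>') \<le> (\<Sum>\<^sub>\<infinity>\<kappa>'. norm (a \<kappa>' * u \<kappa>'))"
    by (rule norm_infsum_bound[OF s2])
  also have "\<dots> \<le> (\<Sum>\<^sub>\<infinity>\<kappa>'. norm (a \<kappa>') * (w \<kappa> / w \<kappa>') * (B / w \<kappa>))"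
    by (rule infsum_mono[OF s2 s1]) (use le1 in auto)
  also have "\<dots> = (\<Sum>\<^sub>\<infinity>\<kappa>'. norm (a \<kappa>') * (w \<kappa> / w \<kappa>')) * (B / w \<kappa>)"
    by (rule infsum_cmult_left) (use sm in auto)
  also have "\<dots> \<le> C * (B / w \<kappa>)"
    using B w[of \<kappa>] by (intro mult_right_mono le) simp
  finally show "norm (\<Sum>\<^sub>\<infinity>\<kappa>'. a \<kappa>' * u \<kappa>') * w \<kappa> \<le> C * B"
    using w[of \<kappa>] by (simp add: field_simps)
qed

text \<open>Banach's fixed point theorem for \<open>u = y + A u\<close>. The complete space is that
  of bounded continuous functions on the \<open>discrete\<close> copy of the index type, where
  continuity is automatic; its elements stand for \<open>w * u\<close>, so the sup norm there is the
  weighted norm.\<close>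

lemma weighted_contraction:
  fixes A :: "'k \<Rightarrow> 'k \<Rightarrow> complex" and w :: "'k \<Rightarrow> real"
  assumes w: "\<And>\<kappa>. w \<kappa> > 0"
    and sm: "\<And>\<kappa>. (\<lambda>\<kappa>'. norm (A \<kappa> \<kappa>') * (w \<kappa> / w \<kappa>')) summable_on UNIV"
    and le: "\<And>\<kappa>. (\<Sum>\<^sub>\<infinity>\<kappa>'. norm (A \<kappa> \<kappa>') * (w \<kappa> / w \<kappa>')) \<le> 1 / 2"
    and y: "\<And>\<kappa>. norm (y \<kappa>) * w \<kappa> \<le> M"
  shows "\<exists>!u. (\<exists>M. \<forall>\<kappa>. norm (u \<kappa>) * w \<kappa> \<le> M) \<and>
              (\<forall>\<kappa>. u \<kappa> = y \<kappa> + (\<Sum>\<^sub>\<infinity>\<kappa>'. A \<kappa> \<kappa>' * u \<kappa>'))"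
proof -
  note sm' = weighted_row_bound(1)[OF w sm le] and bd = weighted_row_bound(2)[OF w sm le]
  define U where "U = (\<lambda>(b::'k discrete \<Rightarrow>\<^sub>C complex) \<kappa>. apply_bcontfun b (discrete \<kappa>) / w \<kappa>)"
  define F where "F = (\<lambda>u \<kappa>. y \<kappa> + (\<Sum>\<^sub>\<infinity>\<kappa>'. A \<kappa> \<kappa>' * u \<kappa>'))"
  define \<Phi> where "\<Phi> = (\<lambda>b. Bcontfun (\<lambda>n. F (U b) (of_discrete n) * w (of_discrete n)))"
  have Ub: "norm (U b \<kappa>) * w \<kappa> \<le> norm b" for b \<kappa>
    using norm_bounded[of b "discrete \<kappa>"] w[of \<kappa>] by (simp add: U_def norm_divide)
  have Fb: "norm (F (U b) \<kappa> * w \<kappa>) \<le> M + 1 / 2 * norm b" for b \<kappa>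
  proof -
    have "norm (F (U b) \<kappa> * w \<kappa>) = norm (F (U b) \<kappa>) * w \<kappa>"
      using w[of \<kappa>] by (simp add: norm_mult)
    also have "\<dots> \<le> (norm (y \<kappa>) + norm (\<Sum>\<^sub>\<infinity>\<kappa>'. A \<kappa> \<kappa>' * U b \<kappa>')) * w \<kappa>"
      using w[of \<kappa>] unfolding F_def by (intro mult_right_mono norm_triangle_ineq) simp
    also have "\<dots> \<le> M + 1 / 2 * norm b"
      using y[of \<kappa>] bd[of "U b" "norm b" \<kappa>, OF Ub] by (simp add: distrib_right)
    finally show ?thesis .
  qed
  have ap: "apply_bcontfun (\<Phi> b) n = F (U b) (of_discrete n) * w (of_discrete n)" for b n
    unfolding \<Phi>_def
    by (subst Bcontfun_inverse) (auto intro!: bcontfun_normI Fb simp: continuous_on_open_vimage Discrete_Topology.open_discrete)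
  have Fdiff: "F u \<kappa> - F v \<kappa> = (\<Sum>\<^sub>\<infinity>\<kappa>'. A \<kappa> \<kappa>' * (u \<kappa>' - v \<kappa>'))"
    if "\<And>\<kappa>. norm (u \<kappa>) * w \<kappa> \<le> B" "\<And>\<kappa>. norm (v \<kappa>) * w \<kappa> \<le> B'" for u v B B' \<kappa>
  proof -
    have "(\<Sum>\<^sub>\<infinity>\<kappa>'. A \<kappa> \<kappa>' * u \<kappa>') = (\<Sum>\<^sub>\<infinity>\<kappa>'. A \<kappa> \<kappa>' * v \<kappa>' + A \<kappa> \<kappa>' * (u \<kappa>' - v \<kappa>'))"
      by (simp add: algebra_simps)
    also have "\<dots> = (\<Sum>\<^sub>\<infinity>\<kappa>'. A \<kappa> \<kappa>' * v \<kappa>') + (\<Sum>\<^sub>\<infinity>\<kappa>'. A \<kappa> \<kappa>' * (u \<kappa>' - v \<kappa>'))"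
    proof (rule infsum_add[OF sm'[of v, OF that(2)] sm'])
      fix \<kappa>
      have "norm (u \<kappa> - v \<kappa>) * w \<kappa> \<le> (norm (u \<kappa>) + norm (v \<kappa>)) * w \<kappa>"
        using w[of \<kappa>] by (intro mult_right_mono norm_triangle_ineq4) simp
      then show "norm (u \<kappa> - v \<kappa>) * w \<kappa> \<le> B + B'"
        using that(1)[of \<kappa>] that(2)[of \<kappa>] by (simp add: distrib_right)
    qed
    finally show ?thesis by (simp add: F_def)
  qed
  have "dist (\<Phi> b) (\<Phi> c) \<le> 1 / 2 * dist b c" for b c
  proof (rule dist_bound)
    fix n
    let ?\<kappa> = "of_discrete n :: 'k"
    have db: "norm (U b \<kappa> - U c \<kappa>) * w \<kappa> \<le> dist b c" for \<kappa>
      using dist_bounded[of b "discrete \<kappa>" c] w[of \<kappa>]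
      by (simp add: U_def dist_norm norm_divide flip: diff_divide_distrib)
    have "dist (apply_bcontfun (\<Phi> b) n) (apply_bcontfun (\<Phi> c) n) = norm (F (U b) ?\<kappa> - F (U c) ?\<kappa>) * w ?\<kappa>"
      using w[of ?\<kappa>] by (simp add: ap dist_norm norm_mult flip: left_diff_distrib)
    also have "\<dots> \<le> 1 / 2 * dist b c"
      unfolding Fdiff[of "U b" _ "U c", OF Ub Ub] by (rule bd) (rule db)
    finally show "dist (apply_bcontfun (\<Phi> b) n) (apply_bcontfun (\<Phi> c) n) \<le> 1 / 2 * dist b c" .
  qed
  then have "\<exists>!b. \<Phi> b = b"
    using banach_fix_type[of "1/2" \<Phi>] by auto
  then obtain b where b: "\<Phi> b = b" by auto
  have "U b \<kappa> = F (U b) \<kappa>" for \<kappa>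
  proof -
    have "apply_bcontfun b (discrete \<kappa>) = F (U b) \<kappa> * w \<kappa>"
      using ap[of b "discrete \<kappa>"] b by (simp add: discrete_inverse)
    then show ?thesis using w[of \<kappa>] unfolding U_def by (simp add: field_simps)
  qed
  then have ex: "(\<exists>M. \<forall>\<kappa>. norm (U b \<kappa>) * w \<kappa> \<le> M) \<and> (\<forall>\<kappa>. U b \<kappa> = F (U b) \<kappa>)"
    using Ub by blast
  \<comment> \<open>Uniqueness is argued on the sequences themselves: the difference starts below
    \<open>B + B'\<close>, and each use of the equation halves its bound.\<close>
  have un: "u = v" if u: "\<And>\<kappa>. norm (u \<kappa>) * w \<kappa> \<le> B" "\<And>\<kappa>. u \<kappa> = F u \<kappa>"
    and v: "\<And>\<kappa>. norm (v \<kappa>) * w \<kappa> \<le> B'" "\<And>\<kappa>. v \<kappa> = F v \<kappa>" for u v B B'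
  proof -
    have step: "norm (u \<kappa> - v \<kappa>) * w \<kappa> \<le> 1 / 2 * D" if "\<And>\<kappa>. norm (u \<kappa> - v \<kappa>) * w \<kappa> \<le> D" for D \<kappa>
      using bd[of "\<lambda>\<kappa>. u \<kappa> - v \<kappa>" D \<kappa>, OF that] Fdiff[of u B v B' \<kappa>, OF u(1) v(1)] u(2)[of \<kappa>] v(2)[of \<kappa>]
      by simp
    have D0: "norm (u \<kappa> - v \<kappa>) * w \<kappa> \<le> B + B'" for \<kappa>
    proof -
      have "norm (u \<kappa> - v \<kappa>) * w \<kappa> \<le> (norm (u \<kappa>) + norm (v \<kappa>)) * w \<kappa>"
        using w[of \<kappa>] by (intro mult_right_mono norm_triangle_ineq4) simp
      then show ?thesis using u(1)[of \<kappa>] v(1)[of \<kappa>] by (simp add: distrib_right)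
    qed
    have Dn: "norm (u \<kappa> - v \<kappa>) * w \<kappa> \<le> (1 / 2) ^ n * (B + B')" for n \<kappa>
    proof (induction n arbitrary: \<kappa>)
      case 0
      then show ?case using D0 by simp
    next
      case (Suc n)
      show ?case using step[OF Suc.IH] by simp
    qed
    have "norm (u \<kappa> - v \<kappa>) * w \<kappa> \<le> 0" for \<kappa>
    proof (rule LIMSEQ_le_const)
      show "(\<lambda>n. (1 / 2) ^ n * (B + B')) \<longlonglongrightarrow> 0"
        by (intro tendsto_mult_left_zero LIMSEQ_realpow_zero) auto
    qed (use Dn in auto)
    then have "u \<kappa> = v \<kappa>" for \<kappa>
      using w[of \<kappa>] by (smt (verit) mult_pos_pos zero_less_norm_iff right_minus_eq)
    then show ?thesis by (rule ext)
  qed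
  show ?thesis
    by (rule ex1I[of _ "U b"]) (use ex un in \<open>unfold F_def, blast+\<close>)
qed

text \<open>Lyapunov-Schmidt reduction: a solution is determined by its values at the finitely many
  \<open>\<kappa>\<close> with \<open>\<mu> \<kappa>\<close> small, and among those the points of \<open>S\<close> with \<open>\<mu> \<kappa> = 0\<close> carry free values but no
  equation, since \<open>\<tau> \<noteq> 1\<close> makes their equations trivial.\<close>

theorem invariant_kernel_dimension:
  fixes V :: "'k \<Rightarrow> 'k \<Rightarrow> complex" and w :: "'k \<Rightarrow> real" and \<mu> :: "'k \<Rightarrow> complex" and C :: real
  assumes w: "\<And>\<kappa>. w \<kappa> > 0" and w_rho: "\<And>\<kappa>. w (\<rho> \<kappa>) = w \<kappa>"
    and sm: "\<And>\<kappa>. (\<lambda>\<kappa>'. norm (V \<kappa> \<kappa>') * (w \<kappa> / w \<kappa>')) summable_on UNIV"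
    and le: "\<And>\<kappa>. (\<Sum>\<^sub>\<infinity>\<kappa>'. norm (V \<kappa> \<kappa>') * (w \<kappa> / w \<kappa>')) \<le> C"
    and fin: "\<And>R. finite {\<kappa>. norm (\<mu> \<kappa>) \<le> R}"
    and bij: "bij \<rho>" and V_rho: "\<And>\<kappa> \<kappa>'. V (\<rho> \<kappa>) (\<rho> \<kappa>') = \<tau> * V \<kappa> \<kappa>'"
    and lam_rho: "\<And>\<kappa>. \<mu> (\<rho> \<kappa>) = \<tau> * \<mu> \<kappa>" and tau: "norm \<tau> = 1" "\<tau> \<noteq> 1"
    and fix_rho: "\<And>\<kappa>. \<mu> \<kappa> = 0 \<Longrightarrow> \<rho> \<kappa> = \<kappa>"
    and V_S: "\<And>\<kappa> \<kappa>'. V \<kappa> \<kappa>' \<noteq> 0 \<Longrightarrow> \<kappa> \<in> S \<longleftrightarrow> \<kappa>' \<in> S"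
    and n: "n \<le> card {\<kappa> \<in> S. \<mu> \<kappa> = 0}"
  shows "\<exists>u :: nat \<Rightarrow> 'k \<Rightarrow> complex.
           (\<forall>i<n. (\<exists>M. \<forall>\<kappa>. norm (u i \<kappa>) * w \<kappa> \<le> M) \<and> (\<forall>\<kappa>. u i (\<rho> \<kappa>) = u i \<kappa>) \<and>
              (\<forall>\<kappa>. \<kappa> \<notin> S \<longrightarrow> u i \<kappa> = 0) \<and>
              (\<forall>\<kappa>. (\<lambda>\<kappa>'. V \<kappa> \<kappa>' * u i \<kappa>') summable_on UNIV) \<and>
              (\<forall>\<kappa>. \<mu> \<kappa> * u i \<kappa> + (\<Sum>\<^sub>\<infinity>\<kappa>'. V \<kappa> \<kappa>' * u i \<kappa>') = 0)) \<and>
           (\<forall>c. (\<forall>\<kappa>. (\<Sum>i<n. c i * u i \<kappa>) = 0) \<longrightarrow> (\<forall>i<n. c i = 0))"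
proof -
  define bdd where "bdd = (\<lambda>u :: 'k \<Rightarrow> complex. \<exists>M. \<forall>\<kappa>. norm (u \<kappa>) * w \<kappa> \<le> M)"
  define VV where "VV = (\<lambda>u \<kappa>. \<Sum>\<^sub>\<infinity>\<kappa>'. V \<kappa> \<kappa>' * u \<kappa>')"
  \<comment> \<open>The factor 2 makes the row sums of \<open>V / \<mu>\<close> at most 1/2 outside
    \<open>low\<close>. Since \<open>0 \<le> C\<close>, all zeros of \<open>\<mu>\<close> lie in
    \<open>low\<close>.\<close>
  define low where "low = {\<kappa>. norm (\<mu> \<kappa>) \<le> 2 * C}"
  \<comment> \<open>For \<open>y\<close> supported in \<open>low\<close>, \<open>u = y + T u\<close>
    says that \<open>u = y\<close> on \<open>low\<close> and \<open>\<mu> * u + V u = 0\<close>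
    elsewhere: the equations off \<open>low\<close> are solved with prescribed values on
    \<open>low\<close>.\<close>
  define T where "T = (\<lambda>\<kappa> \<kappa>'. if \<kappa> \<in> low then 0 else - V \<kappa> \<kappa>' / \<mu> \<kappa>)"
  have w0: "0 \<le> w \<kappa>" for \<kappa> using w by (rule less_imp_le)
  have C0: "0 \<le> C"
    by (rule order_trans[OF infsum_nonneg le[of undefined]]) (simp add: w0)
  have lam0: "\<mu> \<kappa> \<noteq> 0" if "\<kappa> \<notin> low" for \<kappa>
    using that C0 by (auto simp: low_def)
  have fin_low: "finite low" unfolding low_def by (rule fin)
  have low_rho: "\<rho> \<kappa> \<in> low \<longleftrightarrow> \<kappa> \<in> low" for \<kappa>
    by (simp add: low_def lam_rho norm_mult tau)
  have V_sm: "(\<lambda>\<kappa>'. V \<kappa> \<kappa>' * u \<kappa>') summable_on UNIV" if u: "bdd u" for u \<kappa>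
  proof -
    from u obtain B where "\<And>\<kappa>. norm (u \<kappa>) * w \<kappa> \<le> B" by (auto simp: bdd_def)
    then show ?thesis by (rule weighted_row_bound(1)[OF w sm le])
  qed
  have VV_sum: "VV (\<lambda>\<kappa>. \<Sum>a\<in>A. c a * f a \<kappa>) = (\<lambda>\<kappa>. \<Sum>a\<in>A. c a * VV (f a) \<kappa>)"
    if "finite A" "\<And>a. a \<in> A \<Longrightarrow> bdd (f a)" for A :: "('k \<Rightarrow> complex) set" and c f
  proof
    fix \<kappa>
    have "VV (\<lambda>\<kappa>. \<Sum>a\<in>A. c a * f a \<kappa>) \<kappa> = (\<Sum>\<^sub>\<infinity>\<kappa>'. \<Sum>a\<in>A. c a * (V \<kappa> \<kappa>' * f a \<kappa>'))"
      by (simp add: VV_def sum_distrib_left mult_ac)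
    also have "\<dots> = (\<Sum>a\<in>A. \<Sum>\<^sub>\<infinity>\<kappa>'. c a * (V \<kappa> \<kappa>' * f a \<kappa>'))"
      by (rule infsum_finite_sum) (use that V_sm in \<open>auto intro!: summable_on_cmult_right\<close>)
    also have "\<dots> = (\<Sum>a\<in>A. c a * VV (f a) \<kappa>)"
      by (intro sum.cong refl) (simp add: VV_def infsum_cmult_right')
    finally show "VV (\<lambda>\<kappa>. \<Sum>a\<in>A. c a * f a \<kappa>) \<kappa> = (\<Sum>a\<in>A. c a * VV (f a) \<kappa>)" .
  qed
  have bdd_sum: "bdd (\<lambda>\<kappa>. \<Sum>a\<in>A. c a * f a \<kappa>)"
    if "finite A" "\<And>a. a \<in> A \<Longrightarrow> bdd (f a)" for A :: "('k \<Rightarrow> complex) set" and c f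
  proof -
    from that(2) have "\<forall>a\<in>A. \<exists>M. \<forall>\<kappa>. norm (f a \<kappa>) * w \<kappa> \<le> M" by (simp add: bdd_def)
    then obtain M where M: "\<And>a \<kappa>. a \<in> A \<Longrightarrow> norm (f a \<kappa>) * w \<kappa> \<le> M a" by metis
    have "norm (\<Sum>a\<in>A. c a * f a \<kappa>) * w \<kappa> \<le> (\<Sum>a\<in>A. norm (c a) * M a)" for \<kappa>
    proof -
      have "norm (\<Sum>a\<in>A. c a * f a \<kappa>) * w \<kappa> \<le> (\<Sum>a\<in>A. norm (c a * f a \<kappa>)) * w \<kappa>"
        using w[of \<kappa>] by (intro mult_right_mono norm_sum) simp
      also have "\<dots> = (\<Sum>a\<in>A. norm (c a) * (norm (f a \<kappa>) * w \<kappa>))"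
        by (simp add: sum_distrib_right norm_mult mult.assoc)
      also have "\<dots> \<le> (\<Sum>a\<in>A. norm (c a) * M a)"
        by (intro sum_mono mult_left_mono M) auto
      finally show ?thesis .
    qed
    then show ?thesis unfolding bdd_def by blast
  qed
  have bdd_fin: "bdd y" if "\<And>\<kappa>. \<kappa> \<notin> low \<Longrightarrow> y \<kappa> = 0" for y
    unfolding bdd_def
  proof (intro exI allI)
    fix \<kappa>
    show "norm (y \<kappa>) * w \<kappa> \<le> (\<Sum>\<kappa>\<in>low. norm (y \<kappa>) * w \<kappa>)"
    proof (cases "\<kappa> \<in> low")
      case True
      then show ?thesis
        using fin_low w0 by (intro member_le_sum) auto
    next
      case False
      then show ?thesis using that w0 by (auto intro!: sum_nonneg)
    qed
  qed
  have T_norm: "norm (T \<kappa> \<kappa>') * (w \<kappa> / w \<kappa>') \<le> norm (V \<kappa> \<kappa>') * (w \<kappa> / w \<kappa>') * (1 / norm (\<mu> \<kappa>))" for \<kappa> \<kappa>'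
    using w0[of \<kappa>] w0[of \<kappa>'] by (cases "\<kappa> \<in> low") (simp_all add: T_def norm_divide mult.commute)
  have T_sm: "(\<lambda>\<kappa>'. norm (T \<kappa> \<kappa>') * (w \<kappa> / w \<kappa>')) summable_on UNIV" for \<kappa>
    by (rule summable_on_comparison_test[OF summable_on_cmult_left[OF sm[of \<kappa>], of "1 / norm (\<mu> \<kappa>)"]])
       (use T_norm w0 in auto)
  have T_le: "(\<Sum>\<^sub>\<infinity>\<kappa>'. norm (T \<kappa> \<kappa>') * (w \<kappa> / w \<kappa>')) \<le> 1 / 2" for \<kappa>
  proof (cases "\<kappa> \<in> low")
    case True
    then show ?thesis by (simp add: T_def)
  next
    case False
    have "(\<Sum>\<^sub>\<infinity>\<kappa>'. norm (T \<kappa> \<kappa>') * (w \<kappa> / w \<kappa>')) \<le> (\<Sum>\<^sub>\<infinity>\<kappa>'. norm (V \<kappa> \<kappa>') * (w \<kappa> / w \<kappa>') * (1 / norm (\<mu> \<kappa>)))"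
      by (rule infsum_mono[OF T_sm summable_on_cmult_left[OF sm] T_norm])
    also have "\<dots> = (\<Sum>\<^sub>\<infinity>\<kappa>'. norm (V \<kappa> \<kappa>') * (w \<kappa> / w \<kappa>')) * (1 / norm (\<mu> \<kappa>))"
      by (rule infsum_cmult_left) (rule sm)
    also have "\<dots> \<le> C * (1 / norm (\<mu> \<kappa>))"
      by (intro mult_right_mono le) simp
    also have "\<dots> \<le> 1 / 2"
      using False lam0[OF False] by (simp add: low_def field_simps)
    finally show ?thesis .
  qed
  define sol where "sol = (\<lambda>y u. bdd u \<and> (\<forall>\<kappa>. u \<kappa> = y \<kappa> + (\<Sum>\<^sub>\<infinity>\<kappa>'. T \<kappa> \<kappa>' * u \<kappa>')))"
  have sol_iff: "sol y u \<longleftrightarrow> bdd u \<and> (\<forall>\<kappa>. u \<kappa> = y \<kappa> + (if \<kappa> \<in> low then 0 else - VV u \<kappa> / \<mu> \<kappa>))" for y u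
  proof -
    have "(\<Sum>\<^sub>\<infinity>\<kappa>'. T \<kappa> \<kappa>' * u \<kappa>') = (if \<kappa> \<in> low then 0 else - VV u \<kappa> / \<mu> \<kappa>)" for \<kappa>
    proof (cases "\<kappa> \<in> low")
      case False
      then have "(\<Sum>\<^sub>\<infinity>\<kappa>'. T \<kappa> \<kappa>' * u \<kappa>') = (\<Sum>\<^sub>\<infinity>\<kappa>'. (- 1 / \<mu> \<kappa>) * (V \<kappa> \<kappa>' * u \<kappa>'))"
        by (simp add: T_def)
      then show ?thesis using False by (simp only: infsum_cmult_right') (simp add: VV_def)
    qed (simp add: T_def)
    then show ?thesis by (simp add: sol_def)
  qed
  have sol_ex1: "\<exists>!u. sol y u" if "bdd y" for y
  proof -
    from that obtain M where "\<And>\<kappa>. norm (y \<kappa>) * w \<kappa> \<le> M" by (auto simp: bdd_def)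
    then show ?thesis
      unfolding sol_def bdd_def by (intro weighted_contraction[OF w T_sm T_le])
  qed
  \<comment> \<open>The admissible prescribed values. \<open>L\<close> extends them to the solution
    of the equations outside \<open>low\<close>.\<close>
  define Y where "Y = {f :: 'k \<Rightarrow> complex. (\<forall>\<kappa>. f (\<rho> \<kappa>) = f \<kappa>) \<and> (\<forall>\<kappa>. f \<kappa> \<noteq> 0 \<longrightarrow> \<kappa> \<in> S \<and> \<kappa> \<in> low)}"
  define L where "L = (\<lambda>y. THE u. sol y u)"
  have Y_bdd: "bdd y" if "y \<in> Y" for y
    using that by (intro bdd_fin) (auto simp: Y_def)
  have L: "sol y (L y)" if "y \<in> Y" for y
    unfolding L_def by (rule theI'[OF sol_ex1[OF Y_bdd[OF that]]])
  have L_bdd: "bdd (L y)" if "y \<in> Y" for y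
    using L[OF that] by (simp add: sol_iff)
  have VV_comp: "VV u (\<rho> \<kappa>) = \<tau> * VV (u \<circ> \<rho>) \<kappa>" for u \<kappa>
  proof -
    have "VV u (\<rho> \<kappa>) = (\<Sum>\<^sub>\<infinity>\<kappa>'. V (\<rho> \<kappa>) (\<rho> \<kappa>') * u (\<rho> \<kappa>'))"
      unfolding VV_def by (rule infsum_reindex_bij_betw[OF bij, symmetric])
    then show ?thesis by (simp add: V_rho VV_def infsum_cmult_right' mult.assoc)
  qed
  have L_rho: "L y (\<rho> \<kappa>) = L y \<kappa>" if y: "y \<in> Y" for y \<kappa>
  proof -
    have tau0: "\<tau> \<noteq> 0" using tau(1) by auto
    \<comment> \<open>Rotating a solution gives a solution for the same data, since
      \<open>\<tau>\<close> cancels between \<open>V\<close> and \<open>\<mu>\<close>; uniqueness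
      then yields invariance.\<close>
    have "sol y (L y \<circ> \<rho>)"
      unfolding sol_iff
    proof (intro conjI allI)
      show "bdd (L y \<circ> \<rho>)"
        using L_bdd[OF y] unfolding bdd_def by (metis comp_apply w_rho)
      fix \<kappa>
      have "L y (\<rho> \<kappa>) = y (\<rho> \<kappa>) + (if \<rho> \<kappa> \<in> low then 0 else - VV (L y) (\<rho> \<kappa>) / \<mu> (\<rho> \<kappa>))"
        using L[OF y] unfolding sol_iff by blast
      then show "(L y \<circ> \<rho>) \<kappa> = y \<kappa> + (if \<kappa> \<in> low then 0 else - VV (L y \<circ> \<rho>) \<kappa> / \<mu> \<kappa>)"
        using y tau0 by (simp add: low_rho VV_comp lam_rho Y_def)
    qed
    then have "L y \<circ> \<rho> = L y"
      using sol_ex1[OF Y_bdd[OF y]] L[OF y] by blast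
    then show ?thesis by (metis comp_apply)
  qed
  have L_S: "L y \<kappa> = 0" if y: "y \<in> Y" and "\<kappa> \<notin> S" for y \<kappa>
  proof -
    \<comment> \<open>By \<open>V_S\<close> the matrix does not couple \<open>S\<close> to its
      complement, so cutting \<open>L y\<close> off outside \<open>S\<close> gives another solution
      for the same data, and uniqueness applies again.\<close>
    define v where "v = (\<lambda>\<kappa>. if \<kappa> \<in> S then L y \<kappa> else 0)"
    have VVv: "VV v \<kappa> = (if \<kappa> \<in> S then VV (L y) \<kappa> else 0)" for \<kappa>
    proof -
      have "V \<kappa> \<kappa>' * v \<kappa>' = (if \<kappa> \<in> S then V \<kappa> \<kappa>' * L y \<kappa>' else 0)" for \<kappa>'
        using V_S[of \<kappa> \<kappa>'] by (auto simp: v_def)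
      then show ?thesis by (simp add: VV_def)
    qed
    have "sol y v"
      unfolding sol_iff
    proof (intro conjI allI)
      obtain M where "\<And>\<kappa>. norm (L y \<kappa>) * w \<kappa> \<le> M" using L_bdd[OF y] by (auto simp: bdd_def)
      then have "norm (v \<kappa>) * w \<kappa> \<le> max M 0" for \<kappa>
        by (auto simp: v_def max_def) (smt (verit))+
      then show "bdd v" unfolding bdd_def by blast
      fix \<kappa>
      have "L y \<kappa> = y \<kappa> + (if \<kappa> \<in> low then 0 else - VV (L y) \<kappa> / \<mu> \<kappa>)"
        using L[OF y] unfolding sol_iff by blast
      then show "v \<kappa> = y \<kappa> + (if \<kappa> \<in> low then 0 else - VV v \<kappa> / \<mu> \<kappa>)"
        using y by (auto simp: fun_cong[OF v_def, of \<kappa>] VVv Y_def)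
    qed
    then have "v = L y"
      using sol_ex1[OF Y_bdd[OF y]] L[OF y] by blast
    then show ?thesis using that(2) by (metis v_def)
  qed
  have L_low: "L y \<kappa> = y \<kappa>" if "y \<in> Y" "\<kappa> \<in> low" for y \<kappa>
    using L[OF that(1)] that(2) unfolding sol_iff by force
  have L_high: "\<mu> \<kappa> * L y \<kappa> + VV (L y) \<kappa> = 0" if "y \<in> Y" "\<kappa> \<notin> low" for y \<kappa>
  proof -
    have "L y \<kappa> = y \<kappa> + - VV (L y) \<kappa> / \<mu> \<kappa>" "y \<kappa> = 0"
      using L[OF that(1)] that unfolding sol_iff Y_def by force+
    then show ?thesis using lam0[OF that(2)] by simp
  qed
  have VV_out: "VV (L y) \<kappa> = 0" if "y \<in> Y" "\<kappa> \<notin> S" for y \<kappa>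
  proof -
    have "V \<kappa> \<kappa>' * L y \<kappa>' = 0" for \<kappa>'
      using V_S[of \<kappa> \<kappa>'] L_S[OF that(1), of \<kappa>'] that(2) by auto
    then show ?thesis unfolding VV_def by (intro infsum_0)
  qed
  have VV_zero: "VV (L y) \<kappa> = 0" if y: "y \<in> Y" and "\<mu> \<kappa> = 0" for y \<kappa>
  proof -
    have "L y \<circ> \<rho> = L y" using L_rho[OF y] by auto
    then have "VV (L y) \<kappa> = \<tau> * VV (L y) \<kappa>"
      using VV_comp[of "L y" \<kappa>] fix_rho[OF that(2)] by simp
    then show ?thesis using tau(2) by simp
  qed
  \<comment> \<open>The equations left on \<open>low\<close>, divided by \<open>\<mu>\<close>:
    numerator and denominator both acquire \<open>\<tau>\<close> under \<open>\<rho>\<close>, so the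
    residual \<open>G y\<close> is itself invariant and imposes only as many conditions as
    \<open>YL\<close> has dimensions.\<close>
  define G where "G = (\<lambda>y \<kappa>. if \<kappa> \<in> S \<and> \<kappa> \<in> low \<and> \<mu> \<kappa> \<noteq> 0 then y \<kappa> + VV (L y) \<kappa> / \<mu> \<kappa> else 0)"
  define YL where "YL = {f \<in> Y. \<forall>\<kappa>. \<mu> \<kappa> = 0 \<longrightarrow> f \<kappa> = 0}"
  have G_YL: "G y \<in> YL" if y: "y \<in> Y" for y
  proof -
    have eq: "G y \<kappa> = (if \<kappa> \<in> low \<and> \<mu> \<kappa> \<noteq> 0 then y \<kappa> + VV (L y) \<kappa> / \<mu> \<kappa> else 0)" for \<kappa>
      using y VV_out[OF y, of \<kappa>] by (auto simp: G_def Y_def)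
    have "L y \<circ> \<rho> = L y" using L_rho[OF y] by auto
    then have VVr: "VV (L y) (\<rho> \<kappa>) = \<tau> * VV (L y) \<kappa>" for \<kappa> using VV_comp[of "L y" \<kappa>] by simp
    have "G y (\<rho> \<kappa>) = G y \<kappa>" for \<kappa>
      using tau(1) y by (auto simp: eq low_rho lam_rho VVr Y_def)
    then show ?thesis by (auto simp: YL_def Y_def G_def)
  qed
  interpret fn: vector_space "\<lambda>(c::complex) (f :: 'k \<Rightarrow> complex) \<kappa>. c * f \<kappa>"
    by unfold_locales (auto simp: algebra_simps fun_eq_iff)
  have fn_sum: "(\<Sum>a\<in>A. (\<lambda>\<kappa>. c a * f a \<kappa>)) = (\<lambda>\<kappa>. \<Sum>a\<in>A. c a * f a \<kappa>)"
    for A :: "('k \<Rightarrow> complex) set" and c :: "_ \<Rightarrow> complex" and f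
    by (induction A rule: infinite_finite_induct) (auto simp: fun_eq_iff)
  define \<delta> where "\<delta> = (\<lambda>(z::'k) \<kappa>. if \<kappa> = z then 1 else (0::complex))"
  define Z where "Z = {\<kappa> \<in> S. \<mu> \<kappa> = 0}"
  have Z_low: "z \<in> low" if "\<mu> z = 0" for z using that C0 by (simp add: low_def)
  have fin_Z: "finite Z"
    by (rule finite_subset[OF _ fin_low]) (use Z_low in \<open>auto simp: Z_def\<close>)
  have YL_span: "YL \<subseteq> fn.span (\<delta> ` low)"
  proof
    fix f assume f: "f \<in> YL"
    have "f = (\<Sum>z\<in>low. (\<lambda>\<kappa>. f z * \<delta> z \<kappa>))"
    proof
      fix \<kappa>
      have "(\<Sum>z\<in>A. (\<lambda>\<kappa>. f z * \<delta> z \<kappa>)) \<kappa> = (\<Sum>z\<in>A. f z * \<delta> z \<kappa>)" for A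
        by (induction A rule: infinite_finite_induct) auto
      then show "f \<kappa> = (\<Sum>z\<in>low. (\<lambda>\<kappa>. f z * \<delta> z \<kappa>)) \<kappa>"
        using f fin_low by (auto simp: \<delta>_def YL_def Y_def if_distrib cong: if_cong)
    qed
    also have "\<dots> \<in> fn.span (\<delta> ` low)"
      by (intro fn.span_sum fn.span_scale fn.span_base) auto
    finally show "f \<in> fn.span (\<delta> ` low)" .
  qed
  obtain Bs where Bs: "Bs \<subseteq> YL" "fn.independent Bs" "YL \<subseteq> fn.span Bs"
    by (rule fn.basis_exists[of YL])
  have fin_Bs: "finite Bs"
    using fn.independent_span_bound[of "\<delta> ` low" Bs] fin_low Bs(1,2) YL_span by simp
  \<comment> \<open>The unknowns are a basis of \<open>YL\<close> and the unit vectors at the zeros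
    of \<open>\<mu>\<close> in \<open>S\<close>. The residuals lie in the span of \<open>Bs\<close>,
    so the surplus of unknowns is \<open>card Z\<close>.\<close>
  define A where "A = Bs \<union> \<delta> ` Z"
  have fin_A: "finite A" using fin_Bs fin_Z by (simp add: A_def)
  have \<delta>Y: "\<delta> z \<in> Y" if "z \<in> Z" for z
  proof -
    \<comment> \<open>The point \<open>z\<close> is fixed by the bijection \<open>\<rho>\<close>, so
      its unit vector is invariant.\<close>
    have "(\<rho> \<kappa> = z) = (\<kappa> = z)" for \<kappa>
      using fix_rho[of z] that bij by (auto simp: Z_def bij_def inj_def)
    then show ?thesis using that Z_low by (auto simp: Y_def \<delta>_def Z_def)
  qed
  have AY: "A \<subseteq> Y" using Bs(1) \<delta>Y by (auto simp: A_def YL_def)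
  have inj_\<delta>: "inj_on \<delta> Z" by (auto simp: inj_on_def \<delta>_def fun_eq_iff split: if_splits)
  have "\<delta> z \<notin> YL" if "z \<in> Z" for z
  proof
    assume "\<delta> z \<in> YL"
    then have "\<delta> z z = 0" using that by (simp add: YL_def Z_def)
    then show False by (simp add: \<delta>_def)
  qed
  then have disj: "Bs \<inter> \<delta> ` Z = {}"
    using Bs(1) by blast
  have A_ind: "d a = 0" if d: "\<And>\<kappa>. (\<Sum>a\<in>A. d a * a \<kappa>) = 0" and a: "a \<in> A" for d a
  proof -
    have split: "(\<Sum>a\<in>A. d a * a \<kappa>) = (\<Sum>a\<in>Bs. d a * a \<kappa>) + (\<Sum>z\<in>Z. d (\<delta> z) * \<delta> z \<kappa>)" for \<kappa>
      unfolding A_def using fin_Bs fin_Z disj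
      by (simp add: sum.union_disjoint sum.reindex[OF inj_\<delta>])
    have dz: "d (\<delta> z) = 0" if z: "z \<in> Z" for z
    proof -
      \<comment> \<open>Elements of \<open>YL\<close> vanish at the zeros of \<open>\<mu>\<close>,
        so evaluation there isolates the coefficients of the unit vectors.\<close>
      have "(\<Sum>a\<in>Bs. d a * a z) = 0"
        using Bs(1) z by (intro sum.neutral) (auto simp: YL_def Z_def)
      moreover have "(\<Sum>z'\<in>Z. d (\<delta> z') * \<delta> z' z) = d (\<delta> z)"
        using fin_Z z by (simp add: \<delta>_def if_distrib cong: if_cong)
      ultimately show ?thesis using d[of z] split[of z] by simp
    qed
    have "(\<Sum>a\<in>Bs. d a * a \<kappa>) = 0" for \<kappa>
      using d[of \<kappa>] split[of \<kappa>] dz by simp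
    then have "(\<Sum>a\<in>Bs. (\<lambda>\<kappa>. d a * a \<kappa>)) = 0"
      unfolding fn_sum by (auto simp: fun_eq_iff)
    then have "d b = 0" if "b \<in> Bs" for b
      using fn.independentD[OF Bs(2) fin_Bs subset_refl] that by blast
    then show ?thesis using a dz by (auto simp: A_def)
  qed
  have "card A = card Bs + card Z"
    unfolding A_def using fin_Bs fin_Z disj by (simp add: card_Un_disjoint card_image[OF inj_\<delta>])
  then have "card Bs + n \<le> card A" using n by (simp add: Z_def)
  moreover have "G ` A \<subseteq> fn.span Bs" using G_YL AY Bs(3) by auto
  ultimately obtain x where x: "\<And>i. i < n \<Longrightarrow> (\<Sum>a\<in>A. (\<lambda>\<kappa>. x i a * G a \<kappa>)) = 0"
    and x_ind: "\<And>c. (\<forall>a\<in>A. (\<Sum>i<n. c i * x i a) = 0) \<Longrightarrow> (\<forall>i<n. c i = 0)"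
    using fn.independent_combinations[OF fin_A fin_Bs, of n G] by blast
  define u where "u = (\<lambda>i \<kappa>. \<Sum>a\<in>A. x i a * L a \<kappa>)"
  have L_bdd_A: "bdd (L a)" if "a \<in> A" for a using that AY L_bdd by blast
  have u_bdd: "bdd (u i)" for i
    unfolding u_def by (rule bdd_sum[OF fin_A L_bdd_A])
  have "VV (u i) = (\<lambda>\<kappa>. \<Sum>a\<in>A. x i a * VV (L a) \<kappa>)" for i
    unfolding u_def by (rule VV_sum[OF fin_A L_bdd_A])
  then have VVu: "VV (u i) \<kappa> = (\<Sum>a\<in>A. x i a * VV (L a) \<kappa>)" for i \<kappa>
    by simp
  have eqn: "\<mu> \<kappa> * u i \<kappa> + VV (u i) \<kappa> = 0" if i: "i < n" for i \<kappa>
  proof -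
    have e: "\<mu> \<kappa> * u i \<kappa> + VV (u i) \<kappa> = (\<Sum>a\<in>A. x i a * (\<mu> \<kappa> * L a \<kappa> + VV (L a) \<kappa>))"
      unfolding VVu by (simp add: u_def sum_distrib_left algebra_simps sum.distrib)
    \<comment> \<open>Outside \<open>low\<close> the equation holds by construction of
      \<open>L\<close>, outside \<open>S\<close> both terms vanish, and at zeros of
      \<open>\<mu>\<close> symmetry gives it. Only the last case uses the relation
      \<open>x i\<close>.\<close>
    consider "\<kappa> \<notin> low" | "\<kappa> \<notin> S" | "\<mu> \<kappa> = 0" | "\<kappa> \<in> low" "\<kappa> \<in> S" "\<mu> \<kappa> \<noteq> 0" by blast
    then show ?thesis
    proof cases
      case 1
      then show ?thesis unfolding e using AY L_high by (intro sum.neutral) auto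
    next
      case 2
      then show ?thesis unfolding e using AY L_S VV_out by (intro sum.neutral) auto
    next
      case 3
      then show ?thesis unfolding e using AY VV_zero by (intro sum.neutral) auto
    next
      case 4
      have "(\<Sum>a\<in>A. x i a * G a \<kappa>) = 0"
        using x[OF i] unfolding fn_sum by (simp add: fun_eq_iff)
      moreover have "(\<Sum>a\<in>A. x i a * (\<mu> \<kappa> * L a \<kappa> + VV (L a) \<kappa>)) = (\<Sum>a\<in>A. \<mu> \<kappa> * (x i a * G a \<kappa>))"
        using 4 L_low AY by (intro sum.cong refl) (auto simp: G_def field_simps)
      ultimately show ?thesis unfolding e by (simp add: sum_distrib_left[symmetric])
    qed
  qed
  have ind: "\<forall>i<n. c i = 0" if c: "\<forall>\<kappa>. (\<Sum>i<n. c i * u i \<kappa>) = 0" for c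
  proof (rule x_ind, rule ballI)
    fix a assume a: "a \<in> A"
    show "(\<Sum>i<n. c i * x i a) = 0"
    proof (rule A_ind[of "\<lambda>a. \<Sum>i<n. c i * x i a", OF _ a])
      fix \<kappa>
      show "(\<Sum>a\<in>A. (\<Sum>i<n. c i * x i a) * a \<kappa>) = 0"
      proof (cases "\<kappa> \<in> low")
        case True
        \<comment> \<open>On \<open>low\<close> each \<open>L a\<close> equals \<open>a\<close>, so
          a relation between the \<open>u i\<close> restricts to one between the elements of
          \<open>A\<close>.\<close>
        have "(\<Sum>a\<in>A. (\<Sum>i<n. c i * x i a) * a \<kappa>) = (\<Sum>a\<in>A. \<Sum>i<n. c i * (x i a * L a \<kappa>))"
          using AY L_low True by (intro sum.cong) (auto simp: sum_distrib_right mult.assoc)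
        also have "\<dots> = (\<Sum>i<n. c i * u i \<kappa>)"
          by (subst sum.swap) (simp add: u_def sum_distrib_left)
        finally show ?thesis using c by simp
      next
        case False
        then show ?thesis using AY by (intro sum.neutral) (auto simp: Y_def)
      qed
    qed
  qed
  have "\<forall>i<n. (\<exists>M. \<forall>\<kappa>. norm (u i \<kappa>) * w \<kappa> \<le> M) \<and> (\<forall>\<kappa>. u i (\<rho> \<kappa>) = u i \<kappa>) \<and>
              (\<forall>\<kappa>. \<kappa> \<notin> S \<longrightarrow> u i \<kappa> = 0) \<and>
              (\<forall>\<kappa>. (\<lambda>\<kappa>'. V \<kappa> \<kappa>' * u i \<kappa>') summable_on UNIV) \<and>
              (\<forall>\<kappa>. \<mu> \<kappa> * u i \<kappa> + (\<Sum>\<^sub>\<infinity>\<kappa>'. V \<kappa> \<kappa>' * u i \<kappa>') = 0)"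
  proof (intro allI impI conjI)
    fix i \<kappa> assume "i < n"
    show "\<exists>M. \<forall>\<kappa>. norm (u i \<kappa>) * w \<kappa> \<le> M" using u_bdd unfolding bdd_def by blast
    show "u i (\<rho> \<kappa>) = u i \<kappa>" unfolding u_def using AY L_rho by (intro sum.cong) auto
    show "\<kappa> \<notin> S \<Longrightarrow> u i \<kappa> = 0" unfolding u_def using AY L_S by (intro sum.neutral) auto
    show "(\<lambda>\<kappa>'. V \<kappa> \<kappa>' * u i \<kappa>') summable_on UNIV" by (rule V_sm[OF u_bdd])
    show "\<mu> \<kappa> * u i \<kappa> + (\<Sum>\<^sub>\<infinity>\<kappa>'. V \<kappa> \<kappa>' * u i \<kappa>') = 0"
      using eqn[OF \<open>i < n\<close>] by (simp add: VV_def)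
  qed
  then show ?thesis using ind by blast
qed

section \<open>Fourier series on the plane\<close>

lemma continuous_integrable_interval:
  fixes f :: "real \<Rightarrow> complex"
  assumes "continuous_on UNIV f"
  shows "f integrable_on {a..b}"
  using assms by (intro integrable_continuous_interval continuous_on_subset[OF assms]) auto

lemma continuous_on_polynomial_cis:
  fixes f :: "complex \<Rightarrow> real"
  assumes "real_polynomial_function f"
  shows "continuous_on UNIV (\<lambda>t. f (cis (2 * pi * t)))"
proof (rule continuous_on_compose2[of UNIV f])
  show "continuous_on UNIV f"
    using assms by (intro continuous_on_polymonial_function) (simp add: real_polynomial_function_eq)
qed (auto intro!: continuous_intros)

text \<open>With \<open>h\<close> arbitrary, the product case of the induction is immediate: \<open>h f\<close> satisfies the
  hypotheses whenever \<open>h\<close> does.\<close>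

lemma orthogonal_polynomial_multiple:
  fixes r :: "complex \<Rightarrow> real"
  assumes "real_polynomial_function r"
  shows "continuous_on UNIV h \<Longrightarrow> (\<And>n::int. integral {0..1} (\<lambda>t. h t * cis (2 * pi * n * t)) = 0) \<Longrightarrow>
    integral {0..1} (\<lambda>t. h t * of_real (r (cis (2 * pi * t))) * cis (2 * pi * (n::int) * t)) = 0"
  using assms
proof (induction r arbitrary: h n rule: real_polynomial_function.induct)
  case (linear r)
  \<comment> \<open>A real-linear \<open>r\<close> has the form \<open>A * z + B * cnj z\<close>; on
    the circle this is \<open>A * cis x + B * cis (- x)\<close>, so multiplication by it shifts the
    frequency \<open>n\<close> by 1 up and down.\<close>
  define A B where "A = (of_real (r 1) - \<i> * of_real (r \<i>)) / 2" and "B = (of_real (r 1) + \<i> * of_real (r \<i>)) / 2"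
  have r: "r z = Re z * r 1 + Im z * r \<i>" for z
  proof -
    have "r z = r (Re z *\<^sub>R 1 + Im z *\<^sub>R \<i>)"
      by (rule arg_cong[of _ _ r]) (simp add: complex_eq_iff)
    also have "\<dots> = Re z * r 1 + Im z * r \<i>"
      using linear(1) by (simp add: bounded_linear.linear linear_add linear_scale)
    finally show ?thesis .
  qed
  have rc: "of_real (r (cis x)) = A * cis x + B * cis (- x)" for x
    unfolding r[of "cis x"] A_def B_def by (simp add: complex_eq_iff field_simps)
  have eq: "h t * of_real (r (cis (2 * pi * t))) * cis (2 * pi * n * t) =
        A * (h t * cis (2 * pi * of_int (n + 1) * t)) + B * (h t * cis (2 * pi * of_int (n - 1) * t))" for t
    by (simp add: rc cis_mult[symmetric] cis_divide[symmetric] algebra_simps)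
       (simp add: cis_mult field_simps)
  have c: "continuous_on UNIV (\<lambda>t. h t * cis (2 * pi * of_int k * t))" for k
    by (intro continuous_intros linear)
  show ?case
    unfolding eq
    by (subst integral_add)
       (use linear(3)[of "n + 1"] linear(3)[of "n - 1"] c in \<open>auto intro!: continuous_integrable_interval continuous_intros integrable_on_mult_right linear(2)\<close>)
next
  case (const c)
  have "integral {0..1} (\<lambda>t. of_real c * (h t * cis (2 * pi * n * t))) = 0"
    using const(2) by simp
  then show ?case by (simp add: mult_ac)
next
  case (add f g)
  have c: "continuous_on UNIV (\<lambda>t. f (cis (2 * pi * t)))" "continuous_on UNIV (\<lambda>t. g (cis (2 * pi * t)))"
    using add(1,2) by (auto intro: continuous_on_polynomial_cis)
  have "integral {0..1} (\<lambda>t. h t * of_real (f (cis (2 * pi * t))) * cis (2 * pi * n * t) +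
      h t * of_real (g (cis (2 * pi * t))) * cis (2 * pi * n * t)) = 0"
    by (subst integral_add) (use add c in \<open>auto intro!: continuous_integrable_interval continuous_intros\<close>)
  then show ?case by (simp add: algebra_simps)
next
  case (mult f g)
  have c: "continuous_on UNIV (\<lambda>t. f (cis (2 * pi * t)))"
    using mult(1) by (rule continuous_on_polynomial_cis)
  have "integral {0..1} (\<lambda>t. (h t * of_real (f (cis (2 * pi * t)))) * of_real (g (cis (2 * pi * t))) * cis (2 * pi * n * t)) = 0"
    using mult.prems c by (intro mult.IH(2) mult.IH(1)) (auto intro!: continuous_intros)
  then show ?case by (simp add: mult_ac)
qed

text \<open>Stone-Weierstrass on the circle: \<open>h\<close> is orthogonal to every polynomial in
  the real and imaginary parts of \<open>cis (2 * pi * t)\<close>, and these approximate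
  \<open>h\<close> uniformly, so \<open>h\<close> is orthogonal to itself.\<close>

lemma fourier_unique_1d:
  fixes h :: "real \<Rightarrow> complex"
  assumes cont: "continuous_on UNIV h" and per: "\<And>t. h (t + 1) = h t"
    and zero: "\<And>n::int. integral {0..1} (\<lambda>t. h t * cis (2 * pi * n * t)) = 0"
  shows "h t = 0"
proof -
  define p where "p = (\<lambda>t::real. cis (2 * pi * t))"
  define G where "G = (\<lambda>z. h (Arg2pi z / (2 * pi)))"
  have contp: "continuous_on A p" for A unfolding p_def by (intro continuous_intros)
  have h01: "h 1 = h 0" using per[of 0] by simp
  have Gp: "G (p t) = h t" if "t \<in> {0..1}" for t
  proof (cases "t = 1")
    case True
    then show ?thesis using h01 by (simp add: G_def p_def Arg2pi_of_real[of 1, simplified])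
  next
    case False
    have "Arg2pi (p t) = 2 * pi * t"
      by (rule Arg2pi_unique[of 1]) (use that False in \<open>auto simp: p_def cis_conv_exp\<close>)
    then show ?thesis by (simp add: G_def)
  qed
  have surj: "\<exists>t\<in>{0..1}. z = p t" if "z \<in> sphere 0 1" for z
  proof (rule bexI[of _ "Arg2pi z / (2 * pi)"])
    show "z = p (Arg2pi z / (2 * pi))"
      using that complex_norm_eq_1_exp[of z] by (simp add: p_def cis_conv_exp)
  qed (use Arg2pi[of z] in \<open>auto simp: field_simps\<close>)
  \<comment> \<open>The circle is a quotient of the compact interval: the preimage of a closed set
    under \<open>G\<close> is the image under \<open>p\<close> of a compact set. Thus the jump of
    \<open>Arg2pi\<close> at 1 causes no discontinuity.\<close>
  have contG: "continuous_on (sphere 0 1) G"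
    unfolding continuous_on_closed_vimage[OF closed_sphere]
  proof (intro allI impI)
    fix C :: "complex set" assume "closed C"
    then have "closed (h -` C)"
      using cont by (simp add: continuous_on_closed_vimage[OF closed_UNIV])
    then have "compact ({0..1} \<inter> h -` C)" by (intro compact_Int_closed) auto
    then have "compact (p ` ({0..1} \<inter> h -` C))" by (intro compact_continuous_image contp)
    also have "p ` ({0..1} \<inter> h -` C) = G -` C \<inter> sphere 0 1"
    proof safe
      fix t assume "t \<in> {0..1}" "h t \<in> C"
      then show "p t \<in> G -` C" "p t \<in> sphere 0 1" using Gp[of t] by (auto simp: p_def)
    next
      fix z assume "G z \<in> C" "z \<in> sphere 0 1"
      then show "z \<in> p ` ({0..1} \<inter> h -` C)" using surj[of z] Gp by auto
    qed
    finally show "closed (G -` C \<inter> sphere 0 1)" by (rule compact_imp_closed)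
  qed
  obtain B where B: "\<And>t. t \<in> {0..1} \<Longrightarrow> norm (h t) \<le> B"
  proof -
    have "compact (h ` {0..1})"
      by (intro compact_continuous_image continuous_on_subset[OF cont]) auto
    then obtain B where "\<forall>x\<in>h ` {0..1}. norm x \<le> B"
      using compact_imp_bounded bounded_iff by blast
    then show ?thesis by (intro that[of B]) auto
  qed
  have B0: "0 \<le> B" using B[of 0] by (smt (verit) atLeastAtMost_iff norm_ge_zero)
  have int0: "integral {0..1} (\<lambda>t. h t * cnj (h t)) = 0"
  proof (rule ccontr)
    let ?I = "integral {0..1} (\<lambda>t. h t * cnj (h t))"
    assume "?I \<noteq> 0"
    \<comment> \<open>Replacing one factor \<open>h\<close> by its approximation changes the
      integral by at most \<open>B * e\<close>, which this choice keeps within half of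
      \<open>norm ?I\<close>; the added 1 covers \<open>B = 0\<close>.\<close>
    define e where "e = norm ?I / (2 * (B + 1))"
    have e: "0 < e" using \<open>?I \<noteq> 0\<close> B0 by (simp add: e_def)
    obtain g where g: "polynomial_function g" "\<And>z. z \<in> sphere 0 1 \<Longrightarrow> norm (G z - g z) < e"
      using Stone_Weierstrass_polynomial_function[OF compact_sphere contG e] by blast
    have gR: "real_polynomial_function (\<lambda>z. Re (g z))" "real_polynomial_function (\<lambda>z. Im (g z))"
      using g(1) bounded_linear_Re bounded_linear_Im by (auto simp: polynomial_function_def o_def)
    have cg: "continuous_on UNIV (\<lambda>t. g (p t))"
      by (rule continuous_on_compose2[OF continuous_on_polymonial_function[OF g(1), of UNIV] contp]) auto
    have R: "integral {0..1} (\<lambda>t. h t * of_real (Re (g (p t)))) = 0"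
      using orthogonal_polynomial_multiple[OF gR(1) cont zero, of 0] by (simp add: p_def)
    have I: "integral {0..1} (\<lambda>t. h t * of_real (Im (g (p t)))) = 0"
      using orthogonal_polynomial_multiple[OF gR(2) cont zero, of 0] by (simp add: p_def)
    have "h t * cnj (g (p t)) = h t * of_real (Re (g (p t))) - \<i> * (h t * of_real (Im (g (p t))))" for t
      by (simp add: complex_eq_iff algebra_simps)
    then have "integral {0..1} (\<lambda>t. h t * cnj (g (p t))) =
        integral {0..1} (\<lambda>t. h t * of_real (Re (g (p t))) - \<i> * (h t * of_real (Im (g (p t)))))"
      by simp
    also have "\<dots> = 0"
      using R I
      by (subst integral_diff) (auto intro!: continuous_integrable_interval continuous_intros cont cg)
    finally have gz: "integral {0..1} (\<lambda>t. h t * cnj (g (p t))) = 0" .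
    have "integral {0..1} (\<lambda>t. h t * cnj (h t - g (p t))) =
        ?I - integral {0..1} (\<lambda>t. h t * cnj (g (p t)))"
      unfolding complex_cnj_diff right_diff_distrib
      by (subst integral_diff) (auto intro!: continuous_integrable_interval continuous_intros cont cg)
    then have "norm ?I = norm (integral {0..1} (\<lambda>t. h t * cnj (h t - g (p t))))"
      using gz by simp
    also have "\<dots> \<le> B * e * (1 - 0)"
    proof (rule integral_bound)
      show "continuous_on {0..1} (\<lambda>t. h t * cnj (h t - g (p t)))"
        by (rule continuous_on_subset[of UNIV]) (auto intro!: continuous_intros cont cg)
      fix t :: real assume t: "t \<in> {0..1}"
      have "norm (h t - g (p t)) \<le> e"
        using g(2)[of "p t"] Gp[OF t] by (auto simp: p_def intro: less_imp_le)
      then show "norm (h t * cnj (h t - g (p t))) \<le> B * e"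
        using B[OF t] B0 unfolding norm_mult complex_mod_cnj by (intro mult_mono) auto
    qed auto
    also have "\<dots> \<le> norm ?I / 2 * (B / (B + 1))" by (simp add: e_def mult.commute)
    also have "\<dots> \<le> norm ?I / 2 * 1" using B0 by (intro mult_left_mono) auto
    finally show False using \<open>?I \<noteq> 0\<close> by simp
  qed
  have ci: "continuous_on {0..1} (\<lambda>t. (norm (h t))\<^sup>2)"
    by (intro continuous_intros continuous_on_subset[OF cont]) auto
  have "h t * cnj (h t) = of_real ((norm (h t))\<^sup>2)" for t
    by (rule complex_norm_square[symmetric])
  then have "integral {0..1} (\<lambda>t. of_real ((norm (h t))\<^sup>2) :: complex) = 0"
    using int0 by simp
  moreover have "integral {0..1} (\<lambda>t. of_real ((norm (h t))\<^sup>2) :: complex) = of_real (integral {0..1} (\<lambda>t. (norm (h t))\<^sup>2))"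
    by (intro integral_unique has_integral_of_real integrable_integral integrable_continuous_interval ci)
  ultimately have "integral {0..1} (\<lambda>t. (norm (h t))\<^sup>2) = 0" by simp
  then have "\<forall>t\<in>{0..1}. (norm (h t))\<^sup>2 = 0"
    by (subst (asm) integral_eq_0_iff[OF ci]) simp_all
  then have z: "h t = 0" if "t \<in> {0..1}" for t
    using that by simp
  have perz: "h (t + of_int n) = h t" for t n
  proof (induction n rule: int_induct[of _ 0])
    case (step1 i)
    then show ?case using per[of "t + of_int i"] by (simp add: add_ac)
  next
    case (step2 i)
    then show ?case using per[of "t + of_int (i - 1)"] by (simp add: add_ac)
  qed simp
  have "h t = h (frac t)" using perz[of "frac t" "\<lfloor>t\<rfloor>"] by (simp add: frac_def)
  then show ?thesis using z[of "frac t"] frac_lt_1[of t] by simp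
qed

section \<open>Cube roots of unity, the dual lattice and its characters\<close>

lemma om_cis: "om = cis (2 * pi / 3)"
  by (simp add: om_def cis_conv_exp mult_ac)

lemma om_Complex: "om = Complex (- 1 / 2) (sqrt 3 / 2)"
  unfolding om_cis using cos_120 sin_120 by (simp add: complex_eq_iff)

lemma om2_Complex: "om\<^sup>2 = Complex (- 1 / 2) (- sqrt 3 / 2)"
  by (simp add: om_Complex power2_eq_square complex_eq_iff)

lemma Re_om: "Re om = - 1 / 2" and Im_om: "Im om = sqrt 3 / 2"
  and Re_om2: "Re (om\<^sup>2) = - 1 / 2" and Im_om2: "Im (om\<^sup>2) = - sqrt 3 / 2"
  by (simp_all add: om2_Complex) (simp_all add: om_Complex)

lemma cnj_om: "cnj om = om\<^sup>2"
  by (rule complex_eqI) (simp_all add: Re_om Im_om Re_om2 Im_om2)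

lemma om_powi: "om powi n = cis (2 * pi * n / 3)"
  by (simp add: om_cis cis_power_int mult_ac)

lemma om_powi_eq_iff: "om powi m = om powi n \<longleftrightarrow> [m = n] (mod 3)"
proof -
  have "om powi m = om powi n \<longleftrightarrow> cis (2 * pi * (real_of_int (m - n) / 3)) = 1"
    unfolding om_powi by (simp add: cis_divide[symmetric] diff_divide_distrib right_diff_distrib)
  also have "\<dots> \<longleftrightarrow> (\<exists>k::int. real_of_int (m - n) / 3 = k)"
  proof
    assume "cis (2 * pi * (real_of_int (m - n) / 3)) = 1"
    then have "cos (2 * pi * (real_of_int (m - n) / 3)) = 1"
      by (metis cis.sel(1) one_complex.sel(1))
    then obtain k :: int where "2 * pi * (real_of_int (m - n) / 3) = real_of_int k * 2 * pi"
      unfolding cos_one_2pi_int by blast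
    then show "\<exists>k::int. real_of_int (m - n) / 3 = k" by (intro exI[of _ k]) simp
  next
    assume "\<exists>k::int. real_of_int (m - n) / 3 = k"
    then show "cis (2 * pi * (real_of_int (m - n) / 3)) = 1" by (metis Ints_of_int cis_multiple_2pi)
  qed
  also have "\<dots> \<longleftrightarrow> (\<exists>k. m - n = 3 * k)"
    by (rule ex_cong1, subst of_int_eq_iff[where 'a = real, symmetric]) (simp add: field_simps)
  also have "\<dots> \<longleftrightarrow> [m = n] (mod 3)"
    by (simp add: cong_iff_dvd_diff dvd_def)
  finally show ?thesis .
qed

text \<open>The dual of the lattice generated by \<open>lattice_pt 3 0\<close> and
  \<open>lattice_pt 0 3\<close>, as complex numbers paired by the real inner product, see
  \<open>freq_lattice_pt\<close>. In this form the number itself is the symbol of the operator: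
  \<open>2 * Dzbar\<close> multiplies \<open>character k\<close> by \<open>freq k\<close>.\<close>

definition freq :: "int \<times> int \<Rightarrow> complex" where
  "freq k = (of_int (fst k) * om\<^sup>2 - of_int (snd k) * om) / of_real (sqrt 3)"

definition character :: "int \<times> int \<Rightarrow> complex \<Rightarrow> complex" where
  "character k z = cis (freq k \<bullet> z)"

lemma Re_freq: "Re (freq k) = (of_int (snd k) - of_int (fst k)) / (2 * sqrt 3)"
  and Im_freq: "Im (freq k) = - (of_int (fst k) + of_int (snd k)) / 2"
  by (simp_all add: freq_def Re_om Im_om Re_om2 Im_om2 Re_divide_of_real Im_divide_of_real field_simps)

lemma Re_lattice_pt: "Re (lattice_pt a b) = - (2 * pi * sqrt 3 / 3) * (a - b)"
  and Im_lattice_pt: "Im (lattice_pt a b) = - (2 * pi / 3) * (a + b)"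
  by (simp_all add: lattice_pt_def Re_om Im_om Re_om2 Im_om2 Re_divide_of_real Im_divide_of_real field_simps)

lemma freq_lattice_pt: "freq k \<bullet> lattice_pt a b = 2 * pi / 3 * (fst k * a + snd k * b)"
  by (simp add: inner_complex_def Re_freq Im_freq Re_lattice_pt Im_lattice_pt field_simps)

lemma freq_add: "freq (k + l) = freq k + freq l"
  and freq_diff: "freq (k - l) = freq k - freq l"
  by (simp_all add: freq_def field_simps)

lemma norm_freq_squared: "(norm (freq k))\<^sup>2 = ((of_int (fst k))\<^sup>2 + (of_int (snd k))\<^sup>2 + of_int (fst k) * of_int (snd k)) / 3"
  by (simp add: cmod_power2 Re_freq Im_freq power_divide power_mult_distrib) (simp add: power2_eq_square field_simps)

lemma norm_freq_le: "norm (freq k) \<le> \<bar>fst k\<bar> + \<bar>snd k\<bar>"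
proof -
  have "(a\<^sup>2 + b\<^sup>2 + a * b) / 3 \<le> (\<bar>a\<bar> + \<bar>b\<bar>)\<^sup>2" for a b :: real
  proof -
    define q where "q = \<bar>a * b\<bar>"
    have e: "(\<bar>a\<bar> + \<bar>b\<bar>)\<^sup>2 = a\<^sup>2 + b\<^sup>2 + 2 * q" by (simp add: q_def power2_sum abs_mult)
    have "(x + y + c) / 3 \<le> x + y + 2 * q" if "0 \<le> x" "0 \<le> y" "c \<le> q" "0 \<le> q" for x y c :: real
      using that by (simp add: field_simps)
    then show ?thesis unfolding e by (simp add: q_def)
  qed
  then have "(norm (freq k))\<^sup>2 \<le> (\<bar>real_of_int (fst k)\<bar> + \<bar>of_int (snd k)\<bar>)\<^sup>2"
    unfolding norm_freq_squared by blast
  then show ?thesis by (simp add: power2_le_iff_abs_le)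
qed

text \<open>From \<open>(a + b)^2 \<ge> 0\<close> the form \<open>a^2 + a * b + b^2\<close> is at
  least \<open>(a^2 + b^2) / 2\<close>; this gives the factor \<open>sqrt 6\<close>, rounded up to
  3.\<close>

lemma norm_freq_ge: "\<bar>real_of_int (fst k)\<bar> \<le> 3 * norm (freq k)" "\<bar>real_of_int (snd k)\<bar> \<le> 3 * norm (freq k)"
proof -
  have "0 \<le> (real_of_int (fst k) + of_int (snd k))\<^sup>2" by simp
  then have "(real_of_int (fst k))\<^sup>2 + (of_int (snd k))\<^sup>2 \<le> 6 * (norm (freq k))\<^sup>2"
    unfolding norm_freq_squared by (simp add: power2_sum)
  then have "\<bar>real_of_int (fst k)\<bar>\<^sup>2 \<le> (3 * norm (freq k))\<^sup>2" "\<bar>real_of_int (snd k)\<bar>\<^sup>2 \<le> (3 * norm (freq k))\<^sup>2"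
    using zero_le_power2[of "real_of_int (fst k)"] zero_le_power2[of "real_of_int (snd k)"] zero_le_power2[of "norm (freq k)"]
    unfolding power_mult_distrib power2_abs by (simp_all, linarith+)
  then show "\<bar>real_of_int (fst k)\<bar> \<le> 3 * norm (freq k)" "\<bar>real_of_int (snd k)\<bar> \<le> 3 * norm (freq k)"
    using power2_le_imp_le norm_ge_zero by (metis mult_nonneg_nonneg zero_le_numeral)+
qed

lemma freq_eq_0_iff: "freq k = 0 \<longleftrightarrow> k = 0"
  using norm_freq_ge[of k] by (auto simp: freq_def prod_eq_iff)

lemma finite_freq_le: "finite {k. norm (freq k) \<le> R}"
proof (rule finite_subset)
  show "{k. norm (freq k) \<le> R} \<subseteq> {- \<lceil>3 * R\<rceil>..\<lceil>3 * R\<rceil>} \<times> {- \<lceil>3 * R\<rceil>..\<lceil>3 * R\<rceil>}"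
  proof
    fix k assume "k \<in> {k. norm (freq k) \<le> R}"
    then have "\<bar>real_of_int (fst k)\<bar> \<le> 3 * R" "\<bar>real_of_int (snd k)\<bar> \<le> 3 * R"
      using norm_freq_ge[of k] by auto
    then show "k \<in> {- \<lceil>3 * R\<rceil>..\<lceil>3 * R\<rceil>} \<times> {- \<lceil>3 * R\<rceil>..\<lceil>3 * R\<rceil>}"
      by (cases k) (auto simp: abs_le_iff; linarith)
  qed
qed simp

lemma character_add: "character (k + l) z = character k z * character l z"
  and norm_character [simp]: "norm (character k z) = 1"
  by (simp_all add: character_def freq_add inner_add_left cis_mult)

lemma continuous_on_character [continuous_intros]:
  "continuous_on A f \<Longrightarrow> continuous_on A (\<lambda>x. character k (f x))"
  unfolding character_def by (intro continuous_intros)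

lemma character_lattice: "character k (z + lattice_pt a b) = om powi (fst k * a + snd k * b) * character k z"
  unfolding character_def inner_add_right freq_lattice_pt om_powi
  by (simp add: cis_mult[symmetric] mult.commute)

lemma character_periodic:
  "character k (z + lattice_pt 3 0) = character k z" "character k (z + lattice_pt 0 3) = character k z"
  using om_powi_eq_iff[of "3 * _" 0] by (auto simp: character_lattice cong_iff_dvd_diff mult.commute)

text \<open>The adjoint of the rotation \<open>z \<mapsto> om * z\<close>, on frequency indices: in
  the inner product with \<open>om * z\<close> the factor moves over as
  \<open>cnj om * freq k\<close>, which is again a frequency.\<close>

definition rot :: "int \<times> int \<Rightarrow> int \<times> int" where
  "rot k = (snd k, - fst k - snd k)"

lemma bij_rot: "bij rot"
  by (rule bij_betw_byWitness[of _ "\<lambda>k. (- fst k - snd k, fst k)"]) (auto simp: rot_def)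

lemma freq_rot: "freq (rot k) = cnj om * freq k"
  by (simp add: freq_def rot_def cnj_om)
     (simp add: om_Complex complex_eq_iff power2_eq_square Re_divide_of_real Im_divide_of_real field_simps)

lemma character_om: "character k (om * z) = character (rot k) z"
proof -
  have "freq k \<bullet> (om * z) = (cnj om * freq k) \<bullet> z"
    by (simp add: inner_complex_def algebra_simps)
  then show ?thesis by (simp add: character_def freq_rot)
qed

section \<open>Fourier coefficients over the period cell\<close>

definition cell_pt :: "real \<Rightarrow> real \<Rightarrow> complex" where
  "cell_pt s t = s *\<^sub>R lattice_pt 3 0 + t *\<^sub>R lattice_pt 0 3"

definition periodic3 :: "(complex \<Rightarrow> complex) \<Rightarrow> bool" where
  "periodic3 f \<longleftrightarrow> (\<forall>z. f (z + lattice_pt 3 0) = f z \<and> f (z + lattice_pt 0 3) = f z)"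

text \<open>Cell coordinates run over the unit square, so no area factor occurs. Iterated
  one-dimensional integrals allow each variable to be treated by theorems on the interval.\<close>

definition coef :: "(complex \<Rightarrow> complex) \<Rightarrow> int \<times> int \<Rightarrow> complex" where
  "coef f k = integral {0..1} (\<lambda>s. integral {0..1} (\<lambda>t. f (cell_pt s t) * character (- k) (cell_pt s t)))"

lemma character_cell_pt: "character k (cell_pt s t) = cis (2 * pi * fst k * s) * cis (2 * pi * snd k * t)"
  by (simp add: character_def cell_pt_def inner_add_right freq_lattice_pt cis_mult mult_ac)

lemma cell_pt_surj: "\<exists>s t. z = cell_pt s t"
proof (intro exI)
  \<comment> \<open>The dual vectors \<open>freq (1, 0)\<close> and \<open>freq (0, 1)\<close> read
    off the two coordinates: each pairs to \<open>2 * pi\<close> with its own cell edge and to 0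
    with the other.\<close>
  show "z = cell_pt (freq (1, 0) \<bullet> z / (2 * pi)) (freq (0, 1) \<bullet> z / (2 * pi))"
    by (simp add: complex_eq_iff cell_pt_def inner_complex_def Re_freq Im_freq Re_lattice_pt Im_lattice_pt field_simps)
qed

lemma continuous_on_cell_pt [continuous_intros]:
  "continuous_on A f \<Longrightarrow> continuous_on A g \<Longrightarrow> continuous_on A (\<lambda>x. cell_pt (f x) (g x))"
  unfolding cell_pt_def by (intro continuous_intros)

lemma integral_cis: "integral {0..1} (\<lambda>t. cis (2 * pi * of_int n * t)) = (if n = 0 then 1 else 0)"
proof (cases "n = 0")
  case False
  define c where "c = 1 / (\<i> * of_real (2 * pi * n))"
  define g where "g = (\<lambda>t::real. c * cis (2 * pi * n * t))"
  have c: "c * (\<i> * of_real (2 * pi * n)) = 1" using False by (simp add: c_def)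
  have "((\<lambda>t. cis (2 * pi * n * t)) has_integral (g 1 - g 0)) {0..1}"
  proof (rule fundamental_theorem_of_calculus)
    fix t :: real
    have "(g has_derivative (\<lambda>h. c * ((2 * pi * n * h) *\<^sub>R (\<i> * cis (2 * pi * n * t))))) (at t within {0..1})"
      unfolding g_def by (rule has_derivative_mult_right, rule has_derivative_cis) (auto intro!: derivative_eq_intros)
    moreover have "c * ((2 * pi * n * h) *\<^sub>R (\<i> * cis (2 * pi * n * t))) = h *\<^sub>R cis (2 * pi * n * t)" for h
    proof -
      have "c * ((2 * pi * n * h) *\<^sub>R (\<i> * cis (2 * pi * n * t))) =
          (c * (\<i> * of_real (2 * pi * n))) * (of_real h * cis (2 * pi * n * t))"
        by (simp add: scaleR_conv_of_real)
      then show ?thesis unfolding c by (simp add: scaleR_conv_of_real)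
    qed
    ultimately show "(g has_vector_derivative cis (2 * pi * n * t)) (at t within {0..1})"
      unfolding has_vector_derivative_def by simp
  qed simp
  moreover have "g 1 = g 0"
    by (simp add: g_def)
  ultimately show ?thesis using False by (simp add: integral_unique)
qed simp

lemma continuous_cell_integral:
  assumes "continuous_on UNIV f"
  shows "continuous_on UNIV (\<lambda>s. integral {0..1} (\<lambda>t. f (cell_pt s t) * character k (cell_pt s t)))"
    and "continuous_on UNIV (\<lambda>t. integral {0..1} (\<lambda>s. f (cell_pt s t) * character k (cell_pt s t)))"
proof -
  have c: "continuous_on A (\<lambda>x. f (g x))" if "continuous_on A g" for A and g :: "real \<times> real \<Rightarrow> complex"
    by (rule continuous_on_compose2[OF assms that]) simp
  have "continuous_on (UNIV \<times> cbox 0 (1::real)) (\<lambda>(s, t). f (cell_pt s t) * character k (cell_pt s t))"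
       "continuous_on (UNIV \<times> cbox 0 (1::real)) (\<lambda>(t, s). f (cell_pt s t) * character k (cell_pt s t))"
    unfolding split_beta by (intro continuous_intros c)+
  from this[THEN integral_continuous_on_param]
  show "continuous_on UNIV (\<lambda>s. integral {0..1} (\<lambda>t. f (cell_pt s t) * character k (cell_pt s t)))"
    "continuous_on UNIV (\<lambda>t. integral {0..1} (\<lambda>s. f (cell_pt s t) * character k (cell_pt s t)))"
    by simp_all
qed

lemma continuous_cell:
  assumes "continuous_on UNIV f"
  shows "continuous_on UNIV (\<lambda>t. f (cell_pt s t) * character k (cell_pt s t))"
    and "continuous_on UNIV (\<lambda>s. f (cell_pt s t) * character k (cell_pt s t))"
proof -
  have c: "continuous_on UNIV (\<lambda>x. f (g x))" if "continuous_on UNIV g" for g :: "real \<Rightarrow> complex"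
    by (rule continuous_on_compose2[OF assms that]) simp
  show "continuous_on UNIV (\<lambda>t. f (cell_pt s t) * character k (cell_pt s t))"
       "continuous_on UNIV (\<lambda>s. f (cell_pt s t) * character k (cell_pt s t))"
    by (intro continuous_intros c)+
qed

lemma coef_swap:
  assumes "continuous_on UNIV f"
  shows "coef f k = integral {0..1} (\<lambda>t. integral {0..1} (\<lambda>s. f (cell_pt s t) * character (- k) (cell_pt s t)))"
proof -
  have c: "continuous_on A (\<lambda>x. f (g x))" if "continuous_on A g" for A and g :: "real \<times> real \<Rightarrow> complex"
    by (rule continuous_on_compose2[OF assms that]) simp
  have "continuous_on (cbox (0,0) (1,1)) (\<lambda>(s, t). f (cell_pt s t) * character (- k) (cell_pt s t))"
    by (simp add: split_beta) (intro continuous_intros c)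
  from integral_swap_continuous[OF this] show ?thesis by (simp add: coef_def)
qed

lemma coef_diff:
  assumes "continuous_on UNIV f" "continuous_on UNIV g"
  shows "coef (\<lambda>z. f z - g z) k = coef f k - coef g k"
  unfolding coef_def left_diff_distrib
  by (simp add: integral_diff continuous_integrable_interval continuous_cell continuous_cell_integral assms)

lemma norm_coef_le:
  assumes f: "continuous_on UNIV f" and B: "\<And>s t. s \<in> {0..1} \<Longrightarrow> t \<in> {0..1} \<Longrightarrow> norm (f (cell_pt s t)) \<le> B"
  shows "norm (coef f k) \<le> B"
proof -
  have "norm (integral {0..1} (\<lambda>t. f (cell_pt s t) * character (- k) (cell_pt s t))) \<le> B * (1 - 0)"
    if "s \<in> {0..1}" for s
    using B[OF that] by (intro integral_bound)
      (auto simp: norm_mult intro: continuous_on_subset[OF continuous_cell(1)[OF f]])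
  then have "norm (coef f k) \<le> B * (1 - 0)"
    unfolding coef_def
    by (intro integral_bound) (auto intro: continuous_on_subset[OF continuous_cell_integral(1)[OF f]])
  then show ?thesis by simp
qed

lemma coef_bounded:
  assumes "continuous_on UNIV f"
  shows "\<exists>B. \<forall>k. norm (coef f k) \<le> B"
proof -
  have "compact ((\<lambda>x. f (cell_pt (fst x) (snd x))) ` ({0..1} \<times> {0..1}))"
    by (intro compact_continuous_image compact_Times compact_Icc
        continuous_on_compose2[OF assms] continuous_intros) auto
  then obtain B where "\<forall>y\<in>(\<lambda>x. f (cell_pt (fst x) (snd x))) ` ({0..1} \<times> {0..1}). norm y \<le> B"
    using compact_imp_bounded bounded_iff by blast
  then have "norm (f (cell_pt s t)) \<le> B" if "s \<in> {0..1}" "t \<in> {0..1}" for s t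
    using that by force
  then show ?thesis using norm_coef_le[OF assms] by blast
qed

lemma coef_character_sum:
  assumes "finite F"
  shows "coef (\<lambda>z. \<Sum>l\<in>F. c l * character l z) k = (if k \<in> F then c k else 0)"
proof -
  have "character l (cell_pt s t) * character (- k) (cell_pt s t) =
      cis (2 * pi * of_int (fst l - fst k) * s) * cis (2 * pi * of_int (snd l - snd k) * t)" for l s t
    using character_add[of l "- k" "cell_pt s t"] character_cell_pt[of "l + - k" s t] by simp
  then have e: "(\<Sum>l\<in>F. c l * character l (cell_pt s t)) * character (- k) (cell_pt s t) =
    (\<Sum>l\<in>F. c l * (cis (2 * pi * of_int (fst l - fst k) * s) * cis (2 * pi * of_int (snd l - snd k) * t)))" for s t
    by (simp only: sum_distrib_right mult.assoc)
  have i1: "integral {0..1} (\<lambda>t. \<Sum>l\<in>F. c l * (cis (2 * pi * of_int (fst l - fst k) * s) * cis (2 * pi * of_int (snd l - snd k) * t)))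
    = (\<Sum>l\<in>F. c l * cis (2 * pi * of_int (fst l - fst k) * s) * (if snd l = snd k then 1 else 0))" for s
    using assms by (subst integral_sum)
      (auto intro!: continuous_integrable_interval continuous_intros sum.cong
            simp: integral_cis[where n = "snd _ - snd _", unfolded of_int_diff])
  have i2: "integral {0..1} (\<lambda>s. \<Sum>l\<in>F. c l * cis (2 * pi * of_int (fst l - fst k) * s) * (if snd l = snd k then 1 else 0))
    = (\<Sum>l\<in>F. c l * (if fst l = fst k then 1 else 0) * (if snd l = snd k then 1 else 0))"
    using assms by (subst integral_sum)
      (auto intro!: continuous_integrable_interval continuous_intros sum.cong
            simp: integral_cis[where n = "fst _ - fst _", unfolded of_int_diff])
  have "coef (\<lambda>z. \<Sum>l\<in>F. c l * character l z) k = (\<Sum>l\<in>F. c l * (if fst l = fst k then 1 else 0) * (if snd l = snd k then 1 else 0))"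
    unfolding coef_def e i1 i2 ..
  also have "\<dots> = (\<Sum>l\<in>F. if l = k then c l else 0)"
    by (intro sum.cong) (auto simp: prod_eq_iff)
  finally show ?thesis using assms by simp
qed

section \<open>Absolutely convergent Fourier series\<close>

definition fseries :: "(int \<times> int \<Rightarrow> complex) \<Rightarrow> complex \<Rightarrow> complex" where
  "fseries c z = (\<Sum>\<^sub>\<infinity>k. c k * character k z)"

lemma fseries_uniform:
  assumes "(\<lambda>k. norm (c k)) summable_on UNIV"
  shows "uniform_limit UNIV (\<lambda>F z. \<Sum>k\<in>F. c k * character k z) (fseries c) (finite_subsets_at_top UNIV)"
  using Weierstrass_m_test_general[of UNIV UNIV "\<lambda>k z. c k * character k z" "\<lambda>k. norm (c k)"] assms
  by (simp add: norm_mult fseries_def[abs_def])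

lemma fseries_has_sum:
  assumes "(\<lambda>k. norm (c k)) summable_on UNIV"
  shows "((\<lambda>k. c k * character k z) has_sum fseries c z) UNIV"
  unfolding fseries_def
  by (rule has_sum_infsum, rule abs_summable_summable) (simp add: norm_mult assms)

lemma continuous_on_fseries:
  assumes "(\<lambda>k. norm (c k)) summable_on UNIV"
  shows "continuous_on A (fseries c)"
proof -
  have "continuous_on UNIV (fseries c)"
    by (rule uniform_limit_theorem[OF _ fseries_uniform[OF assms]])
       (auto intro!: always_eventually continuous_intros)
  then show ?thesis by (rule continuous_on_subset) simp
qed

text \<open>A partial sum over a finite \<open>F\<close> containing \<open>k\<close> already has
  coefficient \<open>c k\<close>, and \<open>coef\<close> is bounded by the sup norm, so uniform
  convergence transfers this to the limit.\<close>

lemma coef_fseries: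
  assumes c: "(\<lambda>k. norm (c k)) summable_on UNIV"
  shows "coef (fseries c) k = c k"
proof -
  have "norm (coef (fseries c) k - c k) \<le> e" if e: "e > 0" for e
  proof -
    have "\<forall>\<^sub>F F in finite_subsets_at_top UNIV. \<forall>z. norm ((\<Sum>k\<in>F. c k * character k z) - fseries c z) < e"
      using uniform_limitD[OF fseries_uniform[OF c] e] by (simp add: dist_norm)
    moreover have "\<forall>\<^sub>F F in finite_subsets_at_top UNIV. finite F \<and> {k} \<subseteq> F \<and> F \<subseteq> UNIV"
      unfolding eventually_finite_subsets_at_top by (intro exI[of _ "{k}"]) auto
    ultimately have "\<forall>\<^sub>F F in finite_subsets_at_top UNIV.
        (\<forall>z. norm ((\<Sum>k\<in>F. c k * character k z) - fseries c z) < e) \<and> finite F \<and> k \<in> F"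
      by eventually_elim auto
    then obtain F where F: "\<And>z. norm ((\<Sum>k\<in>F. c k * character k z) - fseries c z) < e" "finite F" "k \<in> F"
      using eventually_happens'[OF finite_subsets_at_top_neq_bot] by blast
    have cs: "continuous_on UNIV (\<lambda>z. \<Sum>k\<in>F. c k * character k z)" by (intro continuous_intros)
    have "c k - coef (fseries c) k = coef (\<lambda>z. (\<Sum>k\<in>F. c k * character k z) - fseries c z) k"
      using F(2,3) by (simp add: coef_diff cs continuous_on_fseries[OF c] coef_character_sum)
    also have "norm \<dots> \<le> e"
      using F(1) by (intro norm_coef_le) (auto intro!: continuous_intros continuous_on_fseries[OF c] less_imp_le)
    finally show ?thesis by (simp add: norm_minus_commute)
  qed
  then show ?thesis using field_le_epsilon[of "norm (coef (fseries c) k - c k)" 0] by simp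
qed

lemma fseries_inject:
  assumes "(\<lambda>k. norm (c k)) summable_on UNIV" "(\<lambda>k. norm (d k)) summable_on UNIV" "\<And>z. fseries c z = fseries d z"
  shows "c = d"
proof
  fix k
  have "fseries c = fseries d" using assms(3) by (rule ext)
  then show "c k = d k" using coef_fseries[OF assms(1), of k] coef_fseries[OF assms(2), of k] by simp
qed

text \<open>One-dimensional uniqueness, applied twice: for fixed \<open>n\<close> the function of
  \<open>s\<close> given by the \<open>n\<close>-th integral in \<open>t\<close> has only zero
  coefficients and hence vanishes; then the same holds for \<open>f (cell_pt s t)\<close> as a
  function of \<open>t\<close>.\<close>

lemma coef_eq_0_imp:
  assumes f: "continuous_on UNIV f" "periodic3 f" and z: "\<And>k. coef f k = 0"
  shows "f z = 0"
proof -
  obtain s t where st: "z = cell_pt s t" using cell_pt_surj by blast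
  have cs: "cell_pt (s + 1) t = cell_pt s t + lattice_pt 3 0" "cell_pt s (t + 1) = cell_pt s t + lattice_pt 0 3" for s t
    by (simp_all add: cell_pt_def algebra_simps)
  have p: "f (cell_pt (s + 1) t) = f (cell_pt s t)" "f (cell_pt s (t + 1)) = f (cell_pt s t)" for s t
    using f(2) by (simp_all add: cs periodic3_def)
  have c: "continuous_on UNIV (\<lambda>x. f (g x))" if "continuous_on UNIV g" for g :: "real \<Rightarrow> complex"
    by (rule continuous_on_compose2[OF f(1) that]) simp
  have inner: "integral {0..1} (\<lambda>t. f (cell_pt s t) * cis (2 * pi * of_int n * t)) = 0" for n s
  proof (rule fourier_unique_1d[where h = "\<lambda>s. integral {0..1} (\<lambda>t. f (cell_pt s t) * cis (2 * pi * of_int n * t))"])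
    show "continuous_on UNIV (\<lambda>s. integral {0..1} (\<lambda>t. f (cell_pt s t) * cis (2 * pi * of_int n * t)))"
      using continuous_cell_integral(1)[OF f(1), of "(0, n)"] by (simp add: character_cell_pt)
    fix m :: int
    have "integral {0..1} (\<lambda>s. integral {0..1} (\<lambda>t. f (cell_pt s t) * cis (2 * pi * of_int n * t)) * cis (2 * pi * of_int m * s))
      = coef f (- m, - n)"
      unfolding coef_def integral_mult_left[symmetric] by (simp add: character_cell_pt mult_ac)
    then show "integral {0..1} (\<lambda>s. integral {0..1} (\<lambda>t. f (cell_pt s t) * cis (2 * pi * of_int n * t)) * cis (2 * pi * of_int m * s)) = 0"
      using z by simp
  qed (simp add: p)
  have "f (cell_pt s t) = 0"
    by (rule fourier_unique_1d[where h = "\<lambda>t. f (cell_pt s t)"]) (auto intro!: c continuous_intros p inner)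
  then show ?thesis by (simp add: st)
qed

section \<open>Derivatives of smooth periodic functions and decay of coefficients\<close>

lemma smooth_continuous: "smooth f \<Longrightarrow> continuous_on A f"
  unfolding smooth_def by (metis continuous_on_subset subset_UNIV times_diff.simps(1))

lemma smooth_differentiable: "smooth f \<Longrightarrow> f differentiable (at x)"
  unfolding smooth_def by (metis times_diff.simps(2))

lemma smooth_derivative: "smooth f \<Longrightarrow> smooth (\<lambda>x. frechet_derivative f (at x) v)"
  unfolding smooth_def by (metis times_diff.simps(2))

lemma frechet_derivative_scale:
  fixes f :: "complex \<Rightarrow> complex"
  assumes "f differentiable (at (of_int c * x))"
  shows "((\<lambda>z. a * f (of_int c * z)) has_derivative (\<lambda>v. (a * of_int c) * frechet_derivative f (at (of_int c * x)) v)) (at x)"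
proof -
  let ?F = "frechet_derivative f (at (of_int c * x))"
  have F: "(f has_derivative ?F) (at (of_int c * x))"
    using assms by (simp add: frechet_derivative_works)
  have "((\<lambda>z. of_int c * z) has_derivative (\<lambda>v. of_int c * v)) (at x)"
    by (auto intro!: derivative_eq_intros)
  from has_derivative_compose[OF this F]
  have "((\<lambda>z. a * f (of_int c * z)) has_derivative (\<lambda>v. a * ?F (of_int c * v))) (at x)"
    by (rule has_derivative_mult_right)
  \<comment> \<open>\<open>f\<close> is only real differentiable; its derivative commutes with the
    factor \<open>of_int c\<close> because this factor is real.\<close>
  moreover have "?F (of_int c * v) = of_int c * ?F v" for v
    using linear_scale[OF has_derivative_linear[OF F], of "real_of_int c" v]
    by (simp add: scaleR_conv_of_real)
  ultimately show ?thesis by (simp add: mult.assoc)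
qed

text \<open>The prefactor \<open>a\<close> is arbitrary because each differentiation replaces it by
  \<open>a * of_int c\<close>.\<close>

lemma times_diff_scale:
  fixes f :: "complex \<Rightarrow> complex"
  shows "times_diff n f \<Longrightarrow> times_diff n (\<lambda>z. a * f (of_int c * z))"
proof (induction n arbitrary: f a)
  case 0
  have "continuous_on UNIV (\<lambda>z. f (of_int c * z))"
    by (rule continuous_on_compose2[of UNIV f]) (use 0 in \<open>auto intro!: continuous_intros\<close>)
  then show ?case by (auto intro!: continuous_intros)
next
  case (Suc n)
  have d: "f differentiable (at x)" for x using Suc.prems by simp
  have "frechet_derivative (\<lambda>z. a * f (of_int c * z)) (at x) v = (a * of_int c) * frechet_derivative f (at (of_int c * x)) v" for x v
    by (subst frechet_derivative_at[OF frechet_derivative_scale[OF d], symmetric]) (rule refl)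
  moreover have "(\<lambda>z. a * f (of_int c * z)) differentiable (at x)" for x
    using frechet_derivative_scale[OF d] differentiableI by blast
  ultimately show ?case
    using Suc.IH[of "\<lambda>x. frechet_derivative f (at x) _" "a * of_int c"] Suc.prems by simp
qed

lemma smooth_scale:
  fixes f :: "complex \<Rightarrow> complex"
  shows "smooth f \<Longrightarrow> smooth (\<lambda>z. a * f (of_int c * z))"
  by (simp add: smooth_def times_diff_scale)

lemma has_derivative_character:
  "(character k has_derivative (\<lambda>v. \<i> * of_real (freq k \<bullet> v) * character k z)) (at z within A)"
proof -
  have "((\<lambda>z. freq k \<bullet> z) has_derivative (\<lambda>v. freq k \<bullet> v)) (at z within A)"
    by (rule bounded_linear_imp_has_derivative[OF bounded_linear_inner_right])
  from has_derivative_cis[OF this]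
  show ?thesis
    unfolding character_def[abs_def] by (simp add: scaleR_conv_of_real mult_ac)
qed

lemma has_derivative_times_character:
  assumes "f differentiable (at z)"
  shows "((\<lambda>z. f z * character k z) has_derivative
    (\<lambda>v. frechet_derivative f (at z) v * character k z + \<i> * of_real (freq k \<bullet> v) * (f z * character k z))) (at z)"
proof -
  have F: "(f has_derivative frechet_derivative f (at z)) (at z)"
    using assms by (simp add: frechet_derivative_works)
  show ?thesis
    by (rule has_derivative_eq_rhs[OF has_derivative_mult[OF F has_derivative_character]])
      (auto simp: algebra_simps)
qed

lemma has_vector_derivative_line:
  fixes g :: "complex \<Rightarrow> complex"
  assumes "(g has_derivative G) (at (z + t *\<^sub>R v))"
  shows "((\<lambda>t. g (z + t *\<^sub>R v)) has_vector_derivative G v) (at t within A)"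
proof -
  have "((\<lambda>t. z + t *\<^sub>R v) has_derivative (\<lambda>h. h *\<^sub>R v)) (at t within A)"
    by (auto intro!: derivative_eq_intros)
  from has_derivative_compose[OF this assms]
  show ?thesis
    using linear_scale[OF has_derivative_linear[OF assms]] by (simp add: has_vector_derivative_def)
qed

lemma continuous_on_line:
  fixes f :: "complex \<Rightarrow> complex"
  assumes "continuous_on UNIV f"
  shows "continuous_on A (\<lambda>t::real. f (z + t *\<^sub>R v))"
  by (rule continuous_on_compose2[OF assms]) (auto intro!: continuous_intros)

text \<open>Integration by parts along one period: \<open>f * character k\<close> takes equal values
  at both ends, so its derivative integrates to 0.\<close>

lemma line_integral_derivative:
  assumes f: "smooth f" and per: "f (z + v) = f z" "character k (z + v) = character k z"
  shows "integral {0..1} (\<lambda>t. frechet_derivative f (at (z + t *\<^sub>R v)) v * character k (z + t *\<^sub>R v)) =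
    - \<i> * of_real (freq k \<bullet> v) * integral {0..1} (\<lambda>t. f (z + t *\<^sub>R v) * character k (z + t *\<^sub>R v))"
proof -
  let ?p = "\<lambda>t. z + t *\<^sub>R v"
  have "((\<lambda>t. frechet_derivative f (at (?p t)) v * character k (?p t) +
      \<i> * of_real (freq k \<bullet> v) * (f (?p t) * character k (?p t))) has_integral
      (f (?p 1) * character k (?p 1) - f (?p 0) * character k (?p 0))) {0..1}"
    using has_vector_derivative_line[OF has_derivative_times_character[OF smooth_differentiable[OF f]]]
    by (intro fundamental_theorem_of_calculus) auto
  then have has0: "((\<lambda>t. frechet_derivative f (at (?p t)) v * character k (?p t) +
      \<i> * of_real (freq k \<bullet> v) * (f (?p t) * character k (?p t))) has_integral 0) {0..1}"
    using per by simp
  have c: "continuous_on UNIV (\<lambda>t. f (?p t))" "continuous_on UNIV (\<lambda>t. frechet_derivative f (at (?p t)) v)"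
      "continuous_on UNIV (\<lambda>t. character k (?p t))"
    using continuous_on_line[OF smooth_continuous[OF f]] continuous_on_line[OF smooth_continuous[OF smooth_derivative[OF f]]]
    by (auto intro!: continuous_intros)
  from integral_unique[OF has0]
  have "integral {0..1} (\<lambda>t. frechet_derivative f (at (?p t)) v * character k (?p t)) +
      \<i> * of_real (freq k \<bullet> v) * integral {0..1} (\<lambda>t. f (?p t) * character k (?p t)) = 0"
    by (subst (asm) integral_add) (auto intro!: continuous_integrable_interval continuous_on_mult continuous_on_const c)
  then show ?thesis by (simp add: add_eq_0_iff)
qed

text \<open>Integration by parts along a cell edge, in the cell coordinate belonging to it. For the
  edge of \<open>s\<close> the order of integration is exchanged, as \<open>s\<close> is the outer
  variable of \<open>coef\<close>.\<close>

lemma coef_derivative: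
  assumes f: "smooth f" "periodic3 f"
  shows "coef (\<lambda>z. frechet_derivative f (at z) (lattice_pt 3 0)) k = \<i> * of_real (2 * pi * fst k) * coef f k"
    and "coef (\<lambda>z. frechet_derivative f (at z) (lattice_pt 0 3)) k = \<i> * of_real (2 * pi * snd k) * coef f k"
proof -
  have p: "f (z + lattice_pt 3 0) = f z" "f (z + lattice_pt 0 3) = f z" for z
    using f(2) by (simp_all add: periodic3_def)
  have cont: "continuous_on UNIV (\<lambda>z. frechet_derivative f (at z) v)" for v
    by (intro smooth_continuous smooth_derivative f)
  have 1: "integral {0..1} (\<lambda>s. frechet_derivative f (at (cell_pt s t)) (lattice_pt 3 0) * character (- k) (cell_pt s t)) =
     \<i> * of_real (2 * pi * fst k) * integral {0..1} (\<lambda>s. f (cell_pt s t) * character (- k) (cell_pt s t))" for t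
    using line_integral_derivative[OF f(1) p(1) character_periodic(1), of "t *\<^sub>R lattice_pt 0 3" "- k"]
    by (simp add: freq_lattice_pt cell_pt_def add.commute mult_ac)
  have 2: "integral {0..1} (\<lambda>t. frechet_derivative f (at (cell_pt s t)) (lattice_pt 0 3) * character (- k) (cell_pt s t)) =
     \<i> * of_real (2 * pi * snd k) * integral {0..1} (\<lambda>t. f (cell_pt s t) * character (- k) (cell_pt s t))" for s
    using line_integral_derivative[OF f(1) p(2) character_periodic(2), of "s *\<^sub>R lattice_pt 3 0" "- k"]
    by (simp add: freq_lattice_pt cell_pt_def mult_ac)
  show "coef (\<lambda>z. frechet_derivative f (at z) (lattice_pt 3 0)) k = \<i> * of_real (2 * pi * fst k) * coef f k"
    unfolding coef_swap[OF cont] coef_swap[OF smooth_continuous[OF f(1)]] 1 by simp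
  show "coef (\<lambda>z. frechet_derivative f (at z) (lattice_pt 0 3)) k = \<i> * of_real (2 * pi * snd k) * coef f k"
    unfolding coef_def 2 by simp
qed

lemma frechet_derivative_periodic:
  assumes "f differentiable (at z)" "\<And>z. f (z + a) = f z"
  shows "frechet_derivative f (at (z + a)) = frechet_derivative f (at z)"
proof -
  have F: "(f has_derivative frechet_derivative f (at z)) (at (z + a + - a))"
    using assms(1) by (simp add: frechet_derivative_works)
  have "((\<lambda>w. w + - a) has_derivative (\<lambda>h. h)) (at (z + a))"
    by (auto intro!: derivative_eq_intros)
  from has_derivative_compose[OF this F]
  have "((\<lambda>w. f (w + - a)) has_derivative frechet_derivative f (at z)) (at (z + a))" by simp
  moreover have "f (w + - a) = f w" for w using assms(2)[of "w + - a"] by simp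
  ultimately show ?thesis by (metis (no_types, lifting) ext frechet_derivative_at)
qed

lemma periodic3_derivative:
  assumes "smooth f" "periodic3 f"
  shows "periodic3 (\<lambda>z. frechet_derivative f (at z) v)"
  using assms by (simp add: periodic3_def frechet_derivative_periodic smooth_differentiable)

text \<open>Each power costs one derivative along the cell edges: since
  \<open>2 * pi \<ge> 1\<close>, their coefficients dominate \<open>\<bar>fst k\<bar>\<close> and
  \<open>\<bar>snd k\<bar>\<close> times that of \<open>f\<close>, and the summand 1 of the base is
  covered by \<open>f\<close> itself.\<close>

lemma coef_decay:
  "smooth f \<Longrightarrow> periodic3 f \<Longrightarrow> \<exists>B. \<forall>k. norm (coef f k) * (1 + \<bar>real_of_int (fst k)\<bar> + \<bar>real_of_int (snd k)\<bar>) ^ n \<le> B"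
proof (induction n arbitrary: f)
  case 0
  then show ?case using coef_bounded[OF smooth_continuous] by simp
next
  case (Suc n)
  let ?N = "\<lambda>k. 1 + \<bar>real_of_int (fst k)\<bar> + \<bar>real_of_int (snd k)\<bar>"
  let ?f1 = "\<lambda>z. frechet_derivative f (at z) (lattice_pt 3 0)"
  let ?f2 = "\<lambda>z. frechet_derivative f (at z) (lattice_pt 0 3)"
  obtain B0 B1 B2 where B: "\<And>k. norm (coef f k) * ?N k ^ n \<le> B0"
    "\<And>k. norm (coef ?f1 k) * ?N k ^ n \<le> B1" "\<And>k. norm (coef ?f2 k) * ?N k ^ n \<le> B2"
    using Suc.IH[OF Suc.prems] Suc.IH[of ?f1] Suc.IH[of ?f2] Suc.prems smooth_derivative periodic3_derivative
    by metis
  have pi1: "x \<le> 2 * pi * x" if "0 \<le> x" for x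
    using mult_right_mono[OF _ that, of 1 "2 * pi"] pi_ge_two by simp
  have "norm (coef f k) * ?N k ^ Suc n \<le> B0 + B1 + B2" for k
  proof -
    have "\<bar>real_of_int (fst k)\<bar> * norm (coef f k) \<le> norm (coef ?f1 k)"
      unfolding coef_derivative[OF Suc.prems]
      using pi1[of "\<bar>real_of_int (fst k)\<bar> * norm (coef f k)"] by (simp add: norm_mult abs_mult)
    moreover have "\<bar>real_of_int (snd k)\<bar> * norm (coef f k) \<le> norm (coef ?f2 k)"
      unfolding coef_derivative[OF Suc.prems]
      using pi1[of "\<bar>real_of_int (snd k)\<bar> * norm (coef f k)"] by (simp add: norm_mult abs_mult)
    ultimately have "norm (coef f k) * ?N k \<le> norm (coef f k) + norm (coef ?f1 k) + norm (coef ?f2 k)"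
      by (simp add: algebra_simps)
    then have "norm (coef f k) * ?N k * ?N k ^ n \<le> (norm (coef f k) + norm (coef ?f1 k) + norm (coef ?f2 k)) * ?N k ^ n"
      by (rule mult_right_mono) simp
    also have "\<dots> \<le> B0 + B1 + B2"
      using B[of k] by (simp add: distrib_right)
    finally show ?thesis by (simp add: mult.assoc)
  qed
  then show ?case by blast
qed

section \<open>Summability over the frequency lattice and the weight\<close>

lemma summable_on_inverse_squares:
  "(\<lambda>n::int. 1 / (1 + \<bar>real_of_int n\<bar>)\<^sup>2) summable_on UNIV"
proof -
  let ?g = "\<lambda>n::int. 1 / (1 + \<bar>real_of_int n\<bar>)\<^sup>2"
  have "summable (\<lambda>n. inverse (real (Suc n) ^ 2))"
    using inverse_power_summable[of 2, where 'a = real] by (subst summable_Suc_iff) simp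
  then have "summable (\<lambda>n::nat. 1 / (1 + real n)\<^sup>2)" by (simp add: inverse_eq_divide)
  then have s: "(\<lambda>n::nat. 1 / (1 + real n)\<^sup>2) summable_on UNIV"
    by (rule summable_nonneg_imp_summable_on) simp
  have "?g summable_on range int"
    by (subst summable_on_reindex) (use s in \<open>auto simp: o_def\<close>)
  moreover have "?g summable_on range (\<lambda>n. - int n)"
    by (subst summable_on_reindex) (use s in \<open>auto simp: o_def inj_def\<close>)
  ultimately have "?g summable_on (range int \<union> range (\<lambda>n. - int n))"
    by (rule summable_on_union)
  moreover have "range int \<union> range (\<lambda>n. - int n) = UNIV"
  proof -
    have "n \<in> range int \<union> range (\<lambda>n. - int n)" for n by (cases n rule: int_cases2) auto
    then show ?thesis by blast
  qed
  ultimately show ?thesis by simp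
qed

lemma summable_on_product:
  fixes f :: "'i \<Rightarrow> real" and g :: "'j \<Rightarrow> real"
  assumes "f summable_on UNIV" "g summable_on UNIV" "\<And>x. 0 \<le> f x" "\<And>x. 0 \<le> g x"
  shows "(\<lambda>k. f (fst k) * g (snd k)) summable_on UNIV"
proof -
  have "(\<lambda>k. f (fst k) * g (snd k)) summable_on Sigma UNIV (\<lambda>_. UNIV)"
  proof (rule summable_on_SigmaI)
    show "((\<lambda>y. f (fst (x, y)) * g (snd (x, y))) has_sum f x * infsum g UNIV) UNIV" for x
      using assms(2) by (auto intro!: has_sum_cmult_right)
    show "(\<lambda>x. f x * infsum g UNIV) summable_on UNIV"
      using assms(1) by (rule summable_on_cmult_left)
  qed (use assms in auto)
  then show ?thesis by simp
qed

lemma summable_on_lattice_squares: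
  "(\<lambda>k::int \<times> int. 1 / ((1 + \<bar>real_of_int (fst k)\<bar>)\<^sup>2 * (1 + \<bar>real_of_int (snd k)\<bar>)\<^sup>2)) summable_on UNIV"
  using summable_on_product[OF summable_on_inverse_squares summable_on_inverse_squares] by simp

text \<open>The exponent leaves room for a factor \<open>freq k\<close> in an absolutely convergent series.\<close>

definition weight :: "int \<times> int \<Rightarrow> real" where
  "weight k = (1 + norm (freq k)) ^ 5"

lemma weight_pos: "0 < weight k"
  by (simp add: weight_def add_pos_nonneg)

text \<open>The source is \<open>1 + norm (a + b) \<le> (1 + norm a) * (1 + norm b)\<close>. The
  result bounds \<open>weight k / weight l\<close> by \<open>weight (k - l)\<close>, which makes
  convolution bounded in the weighted norm.\<close>

lemma weight_submult: "weight k \<le> weight (k - l) * weight l"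
proof -
  have "norm (freq k) \<le> norm (freq (k - l)) + norm (freq l)"
    using norm_triangle_ineq[of "freq (k - l)" "freq l"] by (simp add: freq_diff)
  then have "1 + norm (freq k) \<le> (1 + norm (freq (k - l))) * (1 + norm (freq l))"
    using mult_nonneg_nonneg[OF norm_ge_zero[of "freq (k - l)"] norm_ge_zero[of "freq l"]]
    by (simp only: distrib_left distrib_right mult_1_left mult_1_right)
  then have "(1 + norm (freq k)) ^ 5 \<le> ((1 + norm (freq (k - l))) * (1 + norm (freq l))) ^ 5"
    by (rule power_mono) simp
  then show ?thesis by (simp add: weight_def power_mult_distrib)
qed

lemma summable_on_weight: "(\<lambda>k. (1 + norm (freq k)) / weight k) summable_on UNIV"
proof (rule summable_on_comparison_test)
  \<comment> \<open>The quotient is \<open>1 / (1 + norm (freq k)) ^ 4\<close>; two of the four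
    powers go to each index, and \<open>81 = 3 ^ 4\<close> comes from
    \<open>norm_freq_ge\<close>.\<close>
  show "(\<lambda>k::int \<times> int. 81 * (1 / ((1 + \<bar>real_of_int (fst k)\<bar>)\<^sup>2 * (1 + \<bar>real_of_int (snd k)\<bar>)\<^sup>2))) summable_on UNIV"
    by (rule summable_on_cmult_right[OF summable_on_lattice_squares])
  fix k :: "int \<times> int"
  let ?a = "1 + \<bar>real_of_int (fst k)\<bar>" and ?b = "1 + \<bar>real_of_int (snd k)\<bar>" and ?c = "1 + norm (freq k)"
  have ab: "?a \<le> 3 * ?c" "?b \<le> 3 * ?c" using norm_freq_ge[of k] by auto
  have c: "0 < ?c" by (simp add: add_pos_nonneg)
  have "?a\<^sup>2 * ?b\<^sup>2 \<le> (3 * ?c)\<^sup>2 * (3 * ?c)\<^sup>2"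
    using ab by (intro mult_mono power_mono) auto
  also have "(3 * x)\<^sup>2 * (3 * x)\<^sup>2 = 81 * x ^ 4" for x :: real
    by (simp add: power2_eq_square eval_nat_numeral)
  finally have "?a\<^sup>2 * ?b\<^sup>2 \<le> 81 * ?c ^ 4" .
  then have "1 / ?c ^ 4 \<le> 81 * (1 / (?a\<^sup>2 * ?b\<^sup>2))"
    using c by (simp add: divide_simps)
  moreover have "?c / weight k = 1 / ?c ^ 4"
    using c by (simp add: weight_def eval_nat_numeral)
  ultimately show "?c / weight k \<le> 81 * (1 / (?a\<^sup>2 * ?b\<^sup>2))" by simp
qed (auto simp: weight_def)

lemma weight_bound_summable:
  assumes "\<And>k. norm (c k) * weight k \<le> M"
  shows "(\<lambda>k. norm (c k)) summable_on UNIV" and "(\<lambda>k. norm (freq k * c k)) summable_on UNIV"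
proof -
  have M: "norm (c k) \<le> M * ((1 + norm (freq k)) / weight k)" "norm (freq k * c k) \<le> M * ((1 + norm (freq k)) / weight k)" for k
  proof -
    have "norm (c k) \<le> M / weight k" using assms[of k] weight_pos[of k] by (simp add: field_simps)
    then have "norm (c k) * (1 + norm (freq k)) \<le> M / weight k * (1 + norm (freq k))"
      by (rule mult_right_mono) simp
    then have *: "norm (c k) + norm (freq k) * norm (c k) \<le> M * ((1 + norm (freq k)) / weight k)"
      by (simp add: algebra_simps add_divide_distrib)
    have "0 \<le> norm (freq k) * norm (c k)" by simp
    then show "norm (c k) \<le> M * ((1 + norm (freq k)) / weight k)" using * by linarith
    show "norm (freq k * c k) \<le> M * ((1 + norm (freq k)) / weight k)"
      using * norm_ge_zero[of "c k"] unfolding norm_mult by linarith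
  qed
  have s: "(\<lambda>k. M * ((1 + norm (freq k)) / weight k)) summable_on UNIV"
    by (rule summable_on_cmult_right[OF summable_on_weight])
  show "(\<lambda>k. norm (c k)) summable_on UNIV" "(\<lambda>k. norm (freq k * c k)) summable_on UNIV"
    by (rule summable_on_comparison_test[OF s]; use M in simp)+
qed

lemma coef_weight_summable:
  assumes "smooth f" "periodic3 f"
  shows "(\<lambda>k. norm (coef f k) * weight k) summable_on UNIV"
proof -
  let ?N = "\<lambda>k. 1 + \<bar>real_of_int (fst k)\<bar> + \<bar>real_of_int (snd k)\<bar>"
  \<comment> \<open>\<open>9 = 5 + 2 + 2\<close>: the power in \<open>weight\<close> and an inverse
    square for each of the two indices.\<close>
  obtain B where B: "\<And>k. norm (coef f k) * ?N k ^ 9 \<le> B"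
    using coef_decay[OF assms] by blast
  show ?thesis
  proof (rule summable_on_comparison_test[OF summable_on_cmult_right[OF summable_on_lattice_squares, of B]])
    fix k :: "int \<times> int"
    let ?a = "1 + \<bar>real_of_int (fst k)\<bar>" and ?b = "1 + \<bar>real_of_int (snd k)\<bar>"
    have N1: "1 \<le> ?N k" by simp
    have "1 + norm (freq k) \<le> ?N k" using norm_freq_le[of k] by simp
    then have "weight k \<le> ?N k ^ 5" unfolding weight_def by (intro power_mono) auto
    moreover have "?a\<^sup>2 * ?b\<^sup>2 \<le> ?N k ^ 2 * ?N k ^ 2"
      by (intro mult_mono power_mono) auto
    ultimately have "weight k * (?a\<^sup>2 * ?b\<^sup>2) \<le> ?N k ^ 5 * (?N k ^ 2 * ?N k ^ 2)"
      using weight_pos[of k] by (intro mult_mono) auto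
    also have "\<dots> = ?N k ^ 9" by (simp flip: power_add)
    finally have "norm (coef f k) * (weight k * (?a\<^sup>2 * ?b\<^sup>2)) \<le> norm (coef f k) * ?N k ^ 9"
      by (rule mult_left_mono) simp
    also have "\<dots> \<le> B" by (rule B)
    finally show "norm (coef f k) * weight k \<le> B * (1 / (?a\<^sup>2 * ?b\<^sup>2))"
      by (simp add: field_simps add_pos_nonneg)
  qed (simp add: weight_pos less_imp_le)
qed

lemma summable_of_weight_summable:
  assumes "(\<lambda>k. norm (c k) * weight k) summable_on UNIV"
  shows "(\<lambda>k. norm (c k)) summable_on UNIV"
proof (rule summable_on_comparison_test[OF assms])
  fix k
  have "1 \<le> weight k" unfolding weight_def by (rule one_le_power) simp
  then show "norm (c k) \<le> norm (c k) * weight k"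
    using mult_left_mono[of 1 "weight k" "norm (c k)"] by simp
qed simp

lemma periodic3_fseries: "periodic3 (fseries c)"
  by (simp add: periodic3_def fseries_def character_periodic)

text \<open>\<open>f\<close> and its series are continuous and periodic with the same coefficients,
  so uniqueness applies to their difference.\<close>

theorem fourier_expansion:
  assumes f: "smooth f" "periodic3 f"
  shows "f z = fseries (coef f) z"
proof -
  have s: "(\<lambda>k. norm (coef f k)) summable_on UNIV"
    by (rule summable_of_weight_summable[OF coef_weight_summable[OF f]])
  have "f z - fseries (coef f) z = 0"
  proof (rule coef_eq_0_imp[where f = "\<lambda>z. f z - fseries (coef f) z"])
    show "continuous_on UNIV (\<lambda>z. f z - fseries (coef f) z)"
      by (intro continuous_intros smooth_continuous f continuous_on_fseries s)
    show "periodic3 (\<lambda>z. f z - fseries (coef f) z)"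
      using f(2) periodic3_fseries[of "coef f"] by (simp add: periodic3_def)
    show "coef (\<lambda>z. f z - fseries (coef f) z) k = 0" for k
      by (simp add: coef_diff smooth_continuous f continuous_on_fseries s coef_fseries)
  qed
  then show ?thesis by simp
qed

text \<open>The Cauchy product: the double series converges absolutely and is summed once by rows
  and once, after the shear \<open>(k, l) \<mapsto> (k - l, l)\<close>, by total frequency.\<close>

lemma fseries_mult:
  assumes c: "(\<lambda>k. norm (c k)) summable_on UNIV" and d: "(\<lambda>k. norm (d k)) summable_on UNIV"
  shows "((\<lambda>k. (\<Sum>\<^sub>\<infinity>l. c (k - l) * d l) * character k z) has_sum (fseries c z * fseries d z)) UNIV"
    and "\<And>k. (\<lambda>l. c (k - l) * d l) summable_on UNIV"
proof -
  let ?p = "\<lambda>x. (c (fst x) * character (fst x) z) * (d (snd x) * character (snd x) z)"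
  let ?q = "\<lambda>x. (c (fst x - snd x) * d (snd x)) * character (fst x) z"
  have "(\<lambda>x. norm (c (fst x)) * norm (d (snd x))) summable_on UNIV"
    by (rule summable_on_product[OF c d]) auto
  then have "(\<lambda>x. norm (?p x)) summable_on UNIV"
    by (simp only: norm_mult norm_character mult_1_right)
  then have sp: "?p summable_on UNIV"
    by (rule abs_summable_summable)
  have hp: "(?p has_sum (fseries c z * fseries d z)) (Sigma UNIV (\<lambda>_. UNIV))"
  proof (rule has_sum_SigmaI)
    show "((\<lambda>y. ?p (x, y)) has_sum (c x * character x z * fseries d z)) UNIV" for x
      using has_sum_cmult_right[OF fseries_has_sum[OF d]] by simp
    show "((\<lambda>x. c x * character x z * fseries d z) has_sum (fseries c z * fseries d z)) UNIV"
      using has_sum_cmult_left[OF fseries_has_sum[OF c]] by simp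
  qed (use sp in simp)
  have bij: "bij (\<lambda>x :: (int \<times> int) \<times> (int \<times> int). (fst x - snd x, snd x))"
    by (rule bij_betw_byWitness[of _ "\<lambda>x. (fst x + snd x, snd x)"]) auto
  have pq: "?p (fst x - snd x, snd x) = ?q x" for x
    using character_add[of "fst x - snd x" "snd x" z] by (simp add: mult_ac)
  have hq: "(?q has_sum (fseries c z * fseries d z)) (Sigma UNIV (\<lambda>_. UNIV))"
    using has_sum_reindex_bij_betw[OF bij, of ?p "fseries c z * fseries d z"] hp unfolding pq by simp
  have sq: "(\<lambda>y. ?q (k, y)) summable_on UNIV" for k
    using summable_on_SigmaD1[of "\<lambda>x y. ?q (x, y)" UNIV "\<lambda>_. UNIV" k] has_sum_imp_summable[OF hq]
    by (simp add: case_prod_beta')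
  have sd: "(\<lambda>l. c (k - l) * d l) summable_on UNIV" for k
  proof -
    \<comment> \<open>Dividing by the character, which has modulus 1, removes \<open>z\<close> from
      the summability statement.\<close>
    have "character k z \<noteq> 0" using norm_character[of k z] by (metis norm_zero zero_neq_one)
    then show ?thesis using sq[of k] by (simp add: summable_on_cmult_left')
  qed
  then show "\<And>k. (\<lambda>l. c (k - l) * d l) summable_on UNIV" .
  show "((\<lambda>k. (\<Sum>\<^sub>\<infinity>l. c (k - l) * d l) * character k z) has_sum (fseries c z * fseries d z)) UNIV"
  proof (rule has_sum_SigmaD[OF hq])
    show "((\<lambda>y. ?q (k, y)) has_sum (\<Sum>\<^sub>\<infinity>l. c (k - l) * d l) * character k z) UNIV" for k
      using has_sum_cmult_left[OF has_sum_infsum[OF sd[of k]], of "character k z"] by simp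
  qed
qed

section \<open>Weak derivatives of Fourier series\<close>

lemma integrable_compact_support:
  fixes f :: "complex \<Rightarrow> complex"
  assumes f: "continuous_on UNIV f" and K: "compact K" "\<And>z. z \<notin> K \<Longrightarrow> f z = 0"
  shows "integrable lebesgue f"
proof -
  have "integrable lborel (\<lambda>z. indicator K z *\<^sub>R f z)"
    by (rule borel_integrable_compact) (use K(1) continuous_on_subset[OF f] in auto)
  also have "(\<lambda>z. indicator K z *\<^sub>R f z) = f"
    using K(2) by (auto simp: indicator_def)
  finally show ?thesis
    using continuous_on_subset[OF f]
    by (subst integrable_completion) (auto intro: borel_measurable_continuous_onI)
qed

lemma frechet_derivative_outside:
  fixes f :: "complex \<Rightarrow> complex"
  assumes "compact K" "\<And>z. z \<notin> K \<Longrightarrow> f z = 0" "z \<notin> K"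
  shows "frechet_derivative f (at z) v = 0"
proof -
  have "open (- K)" using assms(1) by (simp add: compact_imp_closed open_Compl)
  have "(f has_derivative (\<lambda>_. 0)) (at z)"
    by (rule has_derivative_transform_within_open[OF has_derivative_const \<open>open (- K)\<close>]) (use assms in auto)
  from frechet_derivative_at[OF this, symmetric] show ?thesis by simp
qed

text \<open>The difference quotients of \<open>f\<close> have integral 0 by translation invariance.
  They are bounded by the mean value theorem, supported in one compact set and converge to
  \<open>F z v\<close>, so dominated convergence applies.\<close>

lemma integral_derivative_compact_support:
  fixes f :: "complex \<Rightarrow> complex"
  assumes f: "\<And>z. (f has_derivative F z) (at z)" and cont: "continuous_on UNIV (\<lambda>z. F z v)"
    and K: "compact K" "\<And>z. z \<notin> K \<Longrightarrow> f z = 0"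
  shows "(LINT z|lebesgue. F z v) = 0"
proof -
  have fc: "continuous_on UNIV f"
    by (intro continuous_at_imp_continuous_on ballI has_derivative_continuous[OF f])
  have F0: "F z v = 0" if "z \<notin> K" for z
    using frechet_derivative_outside[where f = f, OF K that] by (simp add: frechet_derivative_at[OF f, symmetric])
  obtain B where B: "\<And>z. norm (F z v) \<le> B"
  proof -
    have "compact ((\<lambda>z. F z v) ` K)"
      by (intro compact_continuous_image K continuous_on_subset[OF cont]) auto
    then obtain B where B: "\<forall>y\<in>(\<lambda>z. F z v) ` K. norm y \<le> B"
      using compact_imp_bounded bounded_iff by blast
    have "norm (F z v) \<le> max B 0" for z
    proof (cases "z \<in> K")
      case True
      then have "norm (F z v) \<le> B" using B by blast
      then show ?thesis by simp
    qed (simp add: F0)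
    then show ?thesis using that by blast
  qed
  define s where "s = (\<lambda>n z. of_nat (Suc n) * (f (z + (1 / real (Suc n)) *\<^sub>R v) - f z))"
  \<comment> \<open>Contains the support of every quotient, as all steps lie between 0 and
    1.\<close>
  define K' where "K' = (\<lambda>(z, t). z + t *\<^sub>R v) ` (K \<times> {-1..0})"
  have K': "compact K'"
    unfolding K'_def
    by (intro compact_continuous_image compact_Times K) (auto simp: split_beta intro!: continuous_intros)
  have in_K': "z \<in> K'" if "z + t *\<^sub>R v \<in> K" "0 \<le> t" "t \<le> 1" for z t
    unfolding K'_def by (rule image_eqI[of _ _ "(z + t *\<^sub>R v, - t)"]) (use that in auto)
  have lip: "norm (s n z) \<le> B" for n z
  proof -
    let ?h = "1 / real (Suc n)"
    have "norm (f (z + ?h *\<^sub>R v) - f (z + 0 *\<^sub>R v)) \<le> B * norm (?h - 0)"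
    proof (rule differentiable_bound[where S = UNIV and f = "\<lambda>t. f (z + t *\<^sub>R v)" and f' = "\<lambda>t h. h *\<^sub>R F (z + t *\<^sub>R v) v"])
      fix t :: real
      show "((\<lambda>t. f (z + t *\<^sub>R v)) has_derivative (\<lambda>h. h *\<^sub>R F (z + t *\<^sub>R v) v)) (at t within UNIV)"
        using has_vector_derivative_line[OF f, where A = UNIV and t = t] by (simp add: has_vector_derivative_def)
      show "onorm (\<lambda>h. h *\<^sub>R F (z + t *\<^sub>R v) v) \<le> B"
        using onorm_scaleR_left[OF bounded_linear_ident, of "F (z + t *\<^sub>R v) v"] B onorm_id[where 'a = real]
        by (simp add: id_def)
    qed auto
    moreover have "norm (s n z) = real (Suc n) * norm (f (z + ?h *\<^sub>R v) - f z)"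
      unfolding s_def norm_mult norm_of_nat ..
    ultimately show ?thesis by (simp add: field_simps del: of_nat_Suc)
  qed
  have s0: "s n z = 0" if "z \<notin> K'" for n z
    using in_K'[of z 0] in_K'[of z "1 / real (Suc n)"] that K(2) by (force simp: s_def)
  have fm: "f \<in> borel_measurable borel" "(\<lambda>z. F z v) \<in> borel_measurable borel"
    using fc cont by (auto intro: borel_measurable_continuous_onI)
  have int_f: "integrable lborel f"
    using integrable_compact_support[OF fc K] fm by (simp add: integrable_completion)
  have int_s: "(LINT z|lborel. s n z) = 0" for n
  proof -
    define c where "c = (1 / real (Suc n)) *\<^sub>R v"
    have d: "lborel = distr lborel borel (\<lambda>z. c + z)" by (simp add: lborel_distr_plus)
    have "(LINT z|lborel. f z) = (LINT z|distr lborel borel (\<lambda>z. c + z). f z)"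
      by (subst d[symmetric]) (rule refl)
    also have "\<dots> = (LINT z|lborel. f (c + z))"
      by (rule integral_distr) (use fm in auto)
    finally have e: "(LINT z|lborel. f (z + c)) = (LINT z|lborel. f z)" by (simp add: add.commute)
    have "integrable (distr lborel borel (\<lambda>z. c + z)) f" using int_f by (subst d[symmetric])
    then have "integrable lborel (\<lambda>z. f (z + c))"
      by (subst (asm) integrable_distr_eq) (use fm in \<open>auto simp: add.commute\<close>)
    then have "(LINT z|lborel. f (z + c) - f z) = 0"
      using int_f e by simp
    then show ?thesis unfolding s_def c_def[symmetric] by simp
  qed
  have "(\<lambda>n. LINT z|lborel. s n z) \<longlonglongrightarrow> (LINT z|lborel. F z v)"
  proof (rule integral_dominated_convergence[where w = "\<lambda>z. indicator K' z *\<^sub>R B"])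
    show "(\<lambda>z. F z v) \<in> borel_measurable lborel" using fm by simp
    show "s n \<in> borel_measurable lborel" for n unfolding s_def using fm by measurable
    show "integrable lborel (\<lambda>z. indicator K' z *\<^sub>R B)"
      by (rule borel_integrable_compact[OF K']) auto
    show "AE z in lborel. norm (s n z) \<le> indicator K' z *\<^sub>R B" for n
      using lip s0 by (intro AE_I2) (auto simp: indicator_def)
    show "AE z in lborel. (\<lambda>n. s n z) \<longlonglongrightarrow> F z v"
    proof (rule AE_I2)
      fix z
      have "((\<lambda>t. f (z + t *\<^sub>R v)) has_vector_derivative F z v) (at 0)"
        using has_vector_derivative_line[of f "F z" z 0 v UNIV] f[of z] by simp
      then have l: "((\<lambda>h. norm (f (z + h *\<^sub>R v) - f z - h *\<^sub>R F z v) / norm h) \<longlongrightarrow> 0) (at 0)"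
        by (simp add: has_vector_derivative_def has_derivative_at)
      have "\<forall>\<^sub>F h in at 0. norm (f (z + h *\<^sub>R v) - f z - h *\<^sub>R F z v) / norm h =
          norm ((1 / h) *\<^sub>R (f (z + h *\<^sub>R v) - f z) - F z v)"
        unfolding eventually_at_filter
      proof (intro always_eventually allI impI)
        fix h :: real assume "h \<noteq> 0"
        then have "(1 / h) *\<^sub>R (f (z + h *\<^sub>R v) - f z) - F z v = (1 / h) *\<^sub>R (f (z + h *\<^sub>R v) - f z - h *\<^sub>R F z v)"
          by (simp add: scaleR_diff_right)
        then show "norm (f (z + h *\<^sub>R v) - f z - h *\<^sub>R F z v) / norm h =
          norm ((1 / h) *\<^sub>R (f (z + h *\<^sub>R v) - f z) - F z v)" by simp
      qed
      from tendsto_cong[OF this, THEN iffD1, OF l]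
      have lim: "((\<lambda>h. (1 / h) *\<^sub>R (f (z + h *\<^sub>R v) - f z)) \<longlongrightarrow> F z v) (at 0)"
        by (rule LIM_zero_cancel[OF tendsto_norm_zero_cancel])
      have "filterlim (\<lambda>n. 1 / real (Suc n)) (at 0) sequentially"
        unfolding filterlim_at using LIMSEQ_inverse_real_of_nat by (auto simp: inverse_eq_divide)
      from filterlim_compose[OF lim this]
      show "(\<lambda>n. s n z) \<longlonglongrightarrow> F z v"
        by (simp add: s_def scaleR_conv_of_real)
    qed
  qed
  then have "(LINT z|lborel. F z v) = 0"
    unfolding int_s using LIMSEQ_unique tendsto_const by blast
  then show ?thesis using fm by (simp add: integral_completion)
qed

lemma test_function_derivative:
  assumes "test_function \<phi>"
  obtains K where "compact K" "\<And>z. z \<notin> K \<Longrightarrow> \<phi> z = 0" "\<And>z. z \<notin> K \<Longrightarrow> Dzbar \<phi> z = 0"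
    "continuous_on UNIV \<phi>" "continuous_on UNIV (Dzbar \<phi>)"
proof -
  from assms obtain K where sm: "smooth \<phi>" and K: "compact K" "\<And>z. z \<notin> K \<Longrightarrow> \<phi> z = 0"
    by (auto simp: test_function_def)
  have D0: "Dzbar \<phi> z = 0" if "z \<notin> K" for z
    using frechet_derivative_outside[where f = \<phi>, OF K that] by (simp add: Dzbar_def)
  have "continuous_on UNIV (Dzbar \<phi>)"
    unfolding Dzbar_def[abs_def]
    by (intro continuous_intros smooth_continuous smooth_derivative sm) simp
  then show ?thesis using that K D0 smooth_continuous[OF sm] by blast
qed

text \<open>The two integrands add up to \<open>Dzbar\<close> of the product
  \<open>\<phi> * character k\<close>, by the Leibniz rule and
  \<open>Dzbar (character k) = freq k / 2 * character k\<close>; compact support makes the integral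
  0.\<close>

lemma weak_Dzbar_character:
  assumes "test_function \<phi>"
  shows "(LINT z|lebesgue. (freq k / 2 * character k z) * \<phi> z) + (LINT z|lebesgue. character k z * Dzbar \<phi> z) = 0"
proof -
  obtain K where K: "compact K" "\<And>z. z \<notin> K \<Longrightarrow> \<phi> z = 0" "\<And>z. z \<notin> K \<Longrightarrow> Dzbar \<phi> z = 0"
    and c: "continuous_on UNIV \<phi>" "continuous_on UNIV (Dzbar \<phi>)"
    using test_function_derivative[OF assms] by blast
  have sm: "smooth \<phi>" using assms by (simp add: test_function_def)
  define F where "F = (\<lambda>z v. frechet_derivative \<phi> (at z) v * character k z + \<i> * of_real (freq k \<bullet> v) * (\<phi> z * character k z))"
  have Fd: "((\<lambda>z. \<phi> z * character k z) has_derivative F z) (at z)" for z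
    unfolding F_def by (rule has_derivative_times_character[OF smooth_differentiable[OF sm]])
  have Fc: "continuous_on UNIV (\<lambda>z. F z v)" for v
    unfolding F_def by (intro continuous_intros smooth_continuous smooth_derivative sm)
  have F0: "F z v = 0" if "z \<notin> K" for z v
    using frechet_derivative_outside[where f = \<phi>, OF K(1,2) that] K(2)[OF that] by (simp add: F_def)
  have Fi: "integrable lebesgue (\<lambda>z. F z v)" for v
    by (rule integrable_compact_support[OF Fc K(1) F0])
  have int: "(LINT z|lebesgue. F z v) = 0" for v
    by (rule integral_derivative_compact_support[OF Fd Fc K(1)]) (use K(2) in auto)
  have eq: "(freq k / 2 * character k z) * \<phi> z + character k z * Dzbar \<phi> z = (F z 1 + \<i> * F z \<i>) / (2 * \<i>)" for z
  proof -
    have alg: "((a + \<i> * b) / 2 * c) * f + c * ((1 / \<i>) * ((x + \<i> * y) / 2)) =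
      ((x * c + \<i> * a * (f * c)) + \<i> * (y * c + \<i> * b * (f * c))) / (2 * \<i>)" for a b c f x y :: complex
      by (simp add: field_simps)
    have "freq k = of_real (freq k \<bullet> 1) + \<i> * of_real (freq k \<bullet> \<i>)"
      by (simp add: complex_eq_iff inner_complex_def)
    then show ?thesis unfolding F_def Dzbar_def
      using alg[of "of_real (freq k \<bullet> 1)" "of_real (freq k \<bullet> \<i>)" "character k z" "\<phi> z"] by metis
  qed
  have "(LINT z|lebesgue. (freq k / 2 * character k z) * \<phi> z) + (LINT z|lebesgue. character k z * Dzbar \<phi> z) =
    (LINT z|lebesgue. (freq k / 2 * character k z) * \<phi> z + character k z * Dzbar \<phi> z)"
    by (rule Bochner_Integration.integral_add[symmetric])
       (rule integrable_compact_support[OF _ K(1)], auto intro!: continuous_intros c simp: K)+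
  also have "\<dots> = ((LINT z|lebesgue. F z 1) + \<i> * (LINT z|lebesgue. F z \<i>)) / (2 * \<i>)"
    unfolding eq using Fi by simp
  finally show ?thesis by (simp add: int)
qed

text \<open>The defect \<open>T\<close> of the identity vanishes on finite partial sums and is
  continuous under uniform convergence, because \<open>\<phi>\<close> and
  \<open>Dzbar \<phi>\<close> are integrable. Summability of \<open>freq k * c k\<close> makes the
  derived series converge uniformly as well.\<close>

lemma weak_Dzbar_fseries:
  assumes c: "(\<lambda>k. norm (c k)) summable_on UNIV" and d: "(\<lambda>k. norm (freq k * c k)) summable_on UNIV"
  shows "weak_Dzbar (fseries c) (\<lambda>z. fseries (\<lambda>k. freq k * c k) z / 2)"
  unfolding weak_Dzbar_def
proof (intro allI impI)
  fix \<phi> assume \<phi>: "test_function \<phi>"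
  obtain K where K: "compact K" "\<And>z. z \<notin> K \<Longrightarrow> \<phi> z = 0" "\<And>z. z \<notin> K \<Longrightarrow> Dzbar \<phi> z = 0"
    and cont: "continuous_on UNIV \<phi>" "continuous_on UNIV (Dzbar \<phi>)"
    using test_function_derivative[OF \<phi>] by blast
  let ?d = "\<lambda>k. freq k * c k"
  define T where "T = (\<lambda>w u. (LINT z|lebesgue. w z * \<phi> z) + (LINT z|lebesgue. u z * Dzbar \<phi> z))"
  define A where "A = (LINT z|lebesgue. norm (\<phi> z)) + (LINT z|lebesgue. norm (Dzbar \<phi> z))"
  have i1: "integrable lebesgue (\<lambda>z. f z * \<phi> z)" if "continuous_on UNIV f" for f
    by (rule integrable_compact_support[OF _ K(1)]) (use K that in \<open>auto intro!: continuous_intros cont\<close>)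
  have i2: "integrable lebesgue (\<lambda>z. f z * Dzbar \<phi> z)" if "continuous_on UNIV f" for f
    by (rule integrable_compact_support[OF _ K(1)]) (use K that in \<open>auto intro!: continuous_intros cont\<close>)
  have j: "integrable lebesgue \<phi>" "integrable lebesgue (Dzbar \<phi>)"
    using i1[of "\<lambda>_. 1"] i2[of "\<lambda>_. 1"] by simp_all
  have A0: "0 \<le> A" unfolding A_def by (intro add_nonneg_nonneg) simp_all
  have T_diff: "norm (T w u - T w' u') \<le> e * A"
    if "continuous_on UNIV w" "continuous_on UNIV u" "continuous_on UNIV w'" "continuous_on UNIV u'"
      "\<And>z. norm (w z - w' z) \<le> e" "\<And>z. norm (u z - u' z) \<le> e" for w u w' u' e
  proof -
    have e0: "0 \<le> e" using that(5)[of 0] norm_ge_zero order_trans by blast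
    have "T w u - T w' u' = (LINT z|lebesgue. (w z - w' z) * \<phi> z) + (LINT z|lebesgue. (u z - u' z) * Dzbar \<phi> z)"
      unfolding T_def left_diff_distrib using i1[OF that(1)] i1[OF that(3)] i2[OF that(2)] i2[OF that(4)] by simp
    moreover have "norm (LINT z|lebesgue. (w z - w' z) * \<phi> z) \<le> (LINT z|lebesgue. e * norm (\<phi> z))"
      by (rule Bochner_Integration.integral_norm_bound_integral)
         (use that j in \<open>auto intro!: i1 continuous_intros mult_right_mono simp: norm_mult\<close>)
    moreover have "norm (LINT z|lebesgue. (u z - u' z) * Dzbar \<phi> z) \<le> (LINT z|lebesgue. e * norm (Dzbar \<phi> z))"
      by (rule Bochner_Integration.integral_norm_bound_integral)
         (use that j in \<open>auto intro!: i2 continuous_intros mult_right_mono simp: norm_mult\<close>)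
    ultimately show ?thesis
      using norm_triangle_ineq[of "LINT z|lebesgue. (w z - w' z) * \<phi> z" "LINT z|lebesgue. (u z - u' z) * Dzbar \<phi> z"]
      by (simp add: A_def distrib_left)
  qed
  have T_fin: "T (\<lambda>z. (\<Sum>k\<in>F. ?d k * character k z) / 2) (\<lambda>z. \<Sum>k\<in>F. c k * character k z) = 0" if "finite F" for F
  proof -
    have "(LINT z|lebesgue. (\<Sum>k\<in>F. ?d k * character k z) / 2 * \<phi> z) =
       (LINT z|lebesgue. (\<Sum>k\<in>F. c k * ((freq k / 2 * character k z) * \<phi> z)))"
      by (simp add: sum_distrib_left sum_distrib_right sum_divide_distrib mult_ac)
    also have "\<dots> = (\<Sum>k\<in>F. c k * (LINT z|lebesgue. (freq k / 2 * character k z) * \<phi> z))"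
      by (subst Bochner_Integration.integral_sum)
         (auto intro!: integrable_mult_right i1 continuous_intros)
    finally have 1: "(LINT z|lebesgue. (\<Sum>k\<in>F. ?d k * character k z) / 2 * \<phi> z) =
       (\<Sum>k\<in>F. c k * (LINT z|lebesgue. (freq k / 2 * character k z) * \<phi> z))" .
    have "(LINT z|lebesgue. (\<Sum>k\<in>F. c k * character k z) * Dzbar \<phi> z) =
       (LINT z|lebesgue. (\<Sum>k\<in>F. c k * (character k z * Dzbar \<phi> z)))"
      by (simp add: sum_distrib_left sum_distrib_right mult_ac)
    also have "\<dots> = (\<Sum>k\<in>F. c k * (LINT z|lebesgue. character k z * Dzbar \<phi> z))"
      by (subst Bochner_Integration.integral_sum)
         (auto intro!: integrable_mult_right i2 continuous_intros)
    finally have 2: "(LINT z|lebesgue. (\<Sum>k\<in>F. c k * character k z) * Dzbar \<phi> z) =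
       (\<Sum>k\<in>F. c k * (LINT z|lebesgue. character k z * Dzbar \<phi> z))" .
    show ?thesis unfolding T_def 1 2
      by (simp only: sum.distrib[symmetric] distrib_left[symmetric] weak_Dzbar_character[OF \<phi>]) simp
  qed
  have "norm (T (\<lambda>z. fseries ?d z / 2) (fseries c)) \<le> 0 + e" if e: "0 < e" for e
  proof -
    define e' where "e' = e / (A + 1)"
    have e': "0 < e'" using e A0 by (simp add: e'_def)
    have "\<forall>\<^sub>F F in finite_subsets_at_top UNIV. \<forall>z. norm ((\<Sum>k\<in>F. c k * character k z) - fseries c z) < e'"
      "\<forall>\<^sub>F F in finite_subsets_at_top UNIV. \<forall>z. norm ((\<Sum>k\<in>F. ?d k * character k z) - fseries ?d z) < e'"
      using uniform_limitD[OF fseries_uniform[OF c] e'] uniform_limitD[OF fseries_uniform[OF d] e'] by (simp_all add: dist_norm)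
    moreover have "\<forall>\<^sub>F F in finite_subsets_at_top UNIV. finite F"
      by (intro eventually_finite_subsets_at_top_weakI) simp
    ultimately have "\<forall>\<^sub>F F in finite_subsets_at_top UNIV. finite F \<and>
       (\<forall>z. norm ((\<Sum>k\<in>F. c k * character k z) - fseries c z) < e') \<and>
       (\<forall>z. norm ((\<Sum>k\<in>F. ?d k * character k z) - fseries ?d z) < e')"
      by eventually_elim auto
    then obtain F where F: "finite F" "\<And>z. norm ((\<Sum>k\<in>F. c k * character k z) - fseries c z) < e'"
       "\<And>z. norm ((\<Sum>k\<in>F. ?d k * character k z) - fseries ?d z) < e'"
      using eventually_happens'[OF finite_subsets_at_top_neq_bot] by blast
    have "norm (T (\<lambda>z. fseries ?d z / 2) (fseries c) -
        T (\<lambda>z. (\<Sum>k\<in>F. ?d k * character k z) / 2) (\<lambda>z. \<Sum>k\<in>F. c k * character k z)) \<le> e' * A"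
    proof (rule T_diff)
      fix z
      show "norm (fseries c z - (\<Sum>k\<in>F. c k * character k z)) \<le> e'"
        using F(2)[of z] by (simp add: norm_minus_commute)
      have "norm (fseries ?d z / 2 - (\<Sum>k\<in>F. ?d k * character k z) / 2) = norm ((\<Sum>k\<in>F. ?d k * character k z) - fseries ?d z) / 2"
        by (simp add: norm_divide norm_minus_commute flip: diff_divide_distrib)
      then show "norm (fseries ?d z / 2 - (\<Sum>k\<in>F. ?d k * character k z) / 2) \<le> e'"
        using F(3)[of z] e' by simp
    qed (auto intro!: continuous_intros continuous_on_fseries c d)
    moreover have "e' * A \<le> e" using e A0 by (simp add: e'_def field_simps)
    ultimately show ?thesis by (simp add: T_fin[OF F(1)])
  qed
  then have "norm (T (\<lambda>z. fseries ?d z / 2) (fseries c)) \<le> 0"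
    by (rule field_le_epsilon)
  then show "(LINT z|lebesgue. fseries ?d z / 2 * \<phi> z) = - (LINT z|lebesgue. fseries c z * Dzbar \<phi> z)"
    by (simp add: T_def add_eq_0_iff2)
qed

section \<open>The kernel in a sector\<close>

lemma cnj_om_powi: "cnj om powi n = om powi (- n)"
  by (simp add: om_cis cis_cnj cis_power_int)

lemma om_nonzero: "om \<noteq> 0"
  by (simp add: om_cis)

lemma om_mult_cnj: "om * cnj om = 1"
  by (simp add: om_cis cis_cnj cis_mult)

lemma norm_om: "norm om = 1"
  by (simp add: om_cis)

lemma fseries_translate:
  "fseries c (z + lattice_pt x y) = fseries (\<lambda>k. om powi (fst k * x + snd k * y) * c k) z"
  by (simp add: fseries_def character_lattice mult_ac)

lemma fseries_rotate: "fseries c z = fseries (c \<circ> rot) (om * z)"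
proof -
  have "fseries c z = (\<Sum>\<^sub>\<infinity>k. c (rot k) * character (rot k) z)"
    unfolding fseries_def by (rule infsum_reindex_bij_betw[OF bij_rot, symmetric])
  then show ?thesis by (simp add: fseries_def character_om)
qed

lemma fseries_cmult: "fseries (\<lambda>k. b * c k) z = b * fseries c z"
  by (simp add: fseries_def mult.assoc infsum_cmult_right')

lemma lattice_pt_scale: "of_int c * lattice_pt x y = lattice_pt (c * x) (c * y)"
  by (simp add: lattice_pt_def algebra_simps)

section \<open>Fourier coefficients of the scaled potentials\<close>

context
  fixes U :: "complex \<Rightarrow> complex" and a :: complex and c :: int and f :: "complex \<Rightarrow> complex"
  assumes U: "is_potential U" and f_def: "f = (\<lambda>z. a * U (of_int c * z))"
begin

lemma scaled_potential_smooth: "smooth f"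
  using U unfolding f_def is_potential_def by (blast intro: smooth_scale)

lemma scaled_potential_translate: "f (z + lattice_pt x y) = om powi (- (c * (x + y))) * f z"
  using U by (simp add: f_def is_potential_def distrib_left lattice_pt_scale cnj_om_powi)

lemma scaled_potential_rotate: "f (om * z) = om * f z"
proof -
  have "U (of_int c * (om * z)) = om * U (of_int c * z)"
    using U by (simp add: is_potential_def mult.left_commute)
  then show ?thesis by (simp add: f_def)
qed

lemma scaled_potential_periodic3: "periodic3 f"
  using scaled_potential_translate[of _ 3 0] scaled_potential_translate[of _ 0 3] om_powi_eq_iff[of "- (c * 3)" 0]
  by (simp add: periodic3_def cong_iff_dvd_diff)

lemmas scaled_potential_expansion = fourier_expansion[OF scaled_potential_smooth scaled_potential_periodic3]
lemmas scaled_potential_weight = coef_weight_summable[OF scaled_potential_smooth scaled_potential_periodic3]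
lemmas scaled_potential_summable = summable_of_weight_summable[OF scaled_potential_weight]

text \<open>Since \<open>f (cnj om * w) = cnj om * f w\<close>, the sequences
  \<open>coef f \<circ> rot\<close> and \<open>cnj om * coef f\<close> have the same series.\<close>

lemma scaled_potential_coef_rot: "coef f (rot k) = cnj om * coef f k"
proof -
  have "coef f \<circ> rot = (\<lambda>k. cnj om * coef f k)"
  proof (rule fseries_inject)
    show "(\<lambda>k. norm ((coef f \<circ> rot) k)) summable_on UNIV"
      using summable_on_reindex_bij_betw[OF bij_rot, of "\<lambda>k. norm (coef f k)"] scaled_potential_summable by simp
    show "(\<lambda>k. norm (cnj om * coef f k)) summable_on UNIV"
      using scaled_potential_summable by (simp add: norm_mult norm_om)
    fix w
    have w: "w = om * (cnj om * w)" by (simp add: om_mult_cnj flip: mult.assoc)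
    have "fseries (coef f \<circ> rot) w = f (cnj om * w)"
      using fseries_rotate[of "coef f" "cnj om * w"] w scaled_potential_expansion by simp
    also have "\<dots> = cnj om * f w"
      using scaled_potential_rotate[of "cnj om * w"] w om_mult_cnj
      by (metis mult.assoc mult.commute mult_1)
    also have "\<dots> = fseries (\<lambda>k. cnj om * coef f k) w"
      using scaled_potential_expansion by (simp add: fseries_cmult)
    finally show "fseries (coef f \<circ> rot) w = fseries (\<lambda>k. cnj om * coef f k) w" .
  qed
  then show ?thesis by (metis comp_apply)
qed

text \<open>Translation by a lattice point multiplies \<open>f\<close> by one root of unity and its
  \<open>m\<close>-th term by another. Uniqueness of coefficients forces them to agree where the
  coefficient is nonzero, and the two generators of the lattice give the two congruences.\<close>

lemma scaled_potential_coef_cong: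
  assumes "coef f m \<noteq> 0"
  shows "[fst m = - c] (mod 3)" "[snd m = - c] (mod 3)"
proof -
  have "om powi (fst m * x + snd m * y) = om powi (- (c * (x + y)))" for x y
  proof -
    have "(\<lambda>k. om powi (fst k * x + snd k * y) * coef f k) = (\<lambda>k. om powi (- (c * (x + y))) * coef f k)"
    proof (rule fseries_inject)
      show "(\<lambda>k. norm (om powi (fst k * x + snd k * y) * coef f k)) summable_on UNIV"
        "(\<lambda>k. norm (om powi (- (c * (x + y))) * coef f k)) summable_on UNIV"
        using scaled_potential_summable by (simp_all add: norm_mult norm_power_int norm_om)
    qed (simp add: fseries_translate[symmetric] fseries_cmult scaled_potential_expansion[symmetric] scaled_potential_translate)
    from fun_cong[OF this, of m] show ?thesis using assms by simp
  qed
  from this[of 1 0] this[of 0 1] show "[fst m = - c] (mod 3)" "[snd m = - c] (mod 3)"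
    by (simp_all add: om_powi_eq_iff)
qed

end

lemma borel_measurable_lebesgue_continuous:
  fixes u :: "complex \<Rightarrow> 'b::topological_space"
  assumes "continuous_on UNIV u"
  shows "u \<in> borel_measurable lebesgue"
  using borel_measurable_continuous_onI[OF assms] by (simp add: measurable_completion)

lemma continuous_L2loc:
  assumes "continuous_on UNIV u"
  shows "u \<in> L2loc"
proof -
  have c: "continuous_on A (\<lambda>z. (norm (u z))\<^sup>2)" for A
    by (intro continuous_intros continuous_on_subset[OF assms]) simp
  have "set_integrable lebesgue K (\<lambda>z. (norm (u z))\<^sup>2)" if "compact K" for K
  proof -
    have "integrable lborel (\<lambda>z. indicator K z *\<^sub>R (norm (u z))\<^sup>2)"
      by (rule borel_integrable_compact[OF that c])
    then show ?thesis
      unfolding set_integrable_def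
      by (subst integrable_completion)
         (use that in \<open>auto intro!: borel_measurable_continuous_onI c borel_measurable_scaleR borel_measurable_indicator borel_compact\<close>)
  qed
  then show ?thesis
    using borel_measurable_lebesgue_continuous[OF assms] by (simp add: L2loc_def)
qed

text \<open>An open null set is empty. This turns almost everywhere relations between the
  constructed functions into relations at every point.\<close>

lemma AE_continuous_eq_0:
  fixes f :: "complex \<Rightarrow> 'b::real_normed_vector"
  assumes f: "continuous_on UNIV f" and ae: "AE z in lebesgue. f z = 0"
  shows "f z = 0"
proof -
  have "open {z. f z \<noteq> 0}"
    by (rule open_Collect_neq[OF f continuous_on_const])
  moreover have "negligible {z. f z \<noteq> 0}"
    unfolding negligible_iff_null_sets
    by (subst AE_iff_null_sets) (use ae \<open>open {z. f z \<noteq> 0}\<close> in auto)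
  ultimately have "{z. f z \<noteq> 0} = {}" using open_not_negligible by blast
  then show ?thesis by auto
qed

text \<open>Together with \<open>dilation\<close> this writes all nine matrix entries by one
  formula; uncoupled pairs get amplitude 0.\<close>

definition amplitude :: "complex \<times> complex \<Rightarrow> 3 \<Rightarrow> 3 \<Rightarrow> complex" where
  "amplitude \<alpha> i j = (if i = 1 \<and> j = 2 \<or> i = 2 \<and> j = 1 then fst \<alpha>
     else if i = 2 \<and> j = 3 \<or> i = 3 \<and> j = 2 then snd \<alpha> else 0)"

definition dilation :: "int \<Rightarrow> int \<Rightarrow> 3 \<Rightarrow> 3 \<Rightarrow> int" where
  "dilation p P i j = (if i = 1 \<and> j = 2 then p else if i = 2 \<and> j = 1 then - p
     else if i = 2 \<and> j = 3 then P else if i = 3 \<and> j = 2 then - P else 0)"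

text \<open>The residue class mod 3 of both frequency indices of component \<open>i\<close> in
  sector \<open>r\<close>, found by moving the diagonal factors of the sector condition to the
  right-hand side. The constant vector \<open>e\<^sub>i\<close> lies in the sector iff this class is
  0.\<close>

definition shift :: "int \<Rightarrow> int \<Rightarrow> int \<Rightarrow> 3 \<Rightarrow> int" where
  "shift p q r i = (if i = 1 then r - p else if i = 2 then r else r + q)"

lemma potential_matrix_entry:
  "potential_matrix U p (of_int P) \<alpha> z $ i $ j = amplitude \<alpha> i j * U (of_int (dilation p P i j) * z)"
proof -
  have "\<forall>i j :: 3. potential_matrix U p (of_int P) \<alpha> z $ i $ j = amplitude \<alpha> i j * U (of_int (dilation p P i j) * z)"
    unfolding forall_3 by (simp add: potential_matrix_def Let_def amplitude_def dilation_def)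
  then show ?thesis by blast
qed

text \<open>The potential in entry \<open>(i, j)\<close> has its frequencies in the class of
  \<open>- dilation p P i j\<close>, so convolution with it carries the class of component
  \<open>j\<close> to that of component \<open>i\<close>. The entries with \<open>P\<close> are
  where \<open>P\<close> and \<open>q\<close> must agree mod 3.\<close>

lemma dilation_cong:
  assumes "[P = q] (mod 3)" "amplitude \<alpha> i j \<noteq> 0"
  shows "[- dilation p P i j = shift p q r i - shift p q r j] (mod 3)"
proof -
  have "\<forall>i j :: 3. amplitude \<alpha> i j \<noteq> 0 \<longrightarrow> [- dilation p P i j = shift p q r i - shift p q r j] (mod 3)"
    unfolding forall_3 using assms(1)
    by (simp add: amplitude_def dilation_def shift_def cong_minus_minus_iff)
  then show ?thesis using assms(2) by blast
qed

lemma diag3_mult_vec: "diag3 x y z *v v = (\<chi> i. (if i = 1 then x else if i = 2 then y else z) * v $ i)"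
  unfolding vec_eq_iff forall_3 by (simp add: diag3_def matrix_vector_mult_def sum_3)

lemma bij_map_snd: "bij g \<Longrightarrow> bij (\<lambda>x. (fst x, g (snd x)))"
  by (rule bij_betw_byWitness[of _ "\<lambda>x. (fst x, inv g (snd x))"]) (auto simp: bij_def surj_f_inv_f)

text \<open>The abstract count \<open>invariant_kernel_dimension\<close> on pairs (component,
  frequency) with \<open>\<tau> = cnj om\<close>: rotation multiplies the coefficients of the
  potentials and the frequency by this same factor.\<close>

lemma fourier_solutions:
  assumes U: "is_potential U" and P: "[P = q] (mod 3)"
    and n: "n \<le> card {i. [shift p q r i = 0] (mod 3)}"
    and vc_def: "vc = (\<lambda>i j. coef (\<lambda>z. amplitude \<alpha> i j * U (of_int (dilation p P i j) * z)))"
  shows "\<exists>u :: nat \<Rightarrow> 3 \<times> int \<times> int \<Rightarrow> complex.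
      (\<forall>m<n. (\<exists>M. \<forall>\<kappa>. norm (u m \<kappa>) * weight (snd \<kappa>) \<le> M) \<and> (\<forall>\<kappa>. u m (fst \<kappa>, rot (snd \<kappa>)) = u m \<kappa>) \<and>
        (\<forall>\<kappa>. \<not> ([fst (snd \<kappa>) = shift p q r (fst \<kappa>)] (mod 3) \<and> [snd (snd \<kappa>) = shift p q r (fst \<kappa>)] (mod 3)) \<longrightarrow> u m \<kappa> = 0) \<and>
        (\<forall>\<kappa>. (\<lambda>\<kappa>'. vc (fst \<kappa>) (fst \<kappa>') (snd \<kappa> - snd \<kappa>') * u m \<kappa>') summable_on UNIV) \<and>
        (\<forall>\<kappa>. freq (snd \<kappa>) * u m \<kappa> + (\<Sum>\<^sub>\<infinity>\<kappa>'. vc (fst \<kappa>) (fst \<kappa>') (snd \<kappa> - snd \<kappa>') * u m \<kappa>') = 0)) \<and>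
      (\<forall>c. (\<forall>\<kappa>. (\<Sum>m<n. c m * u m \<kappa>) = 0) \<longrightarrow> (\<forall>m<n. c m = 0))"
proof -
  define V where "V = (\<lambda>\<kappa> \<kappa>' :: 3 \<times> int \<times> int. vc (fst \<kappa>) (fst \<kappa>') (snd \<kappa> - snd \<kappa>'))"
  define S where "S = {\<kappa> :: 3 \<times> int \<times> int. [fst (snd \<kappa>) = shift p q r (fst \<kappa>)] (mod 3) \<and> [snd (snd \<kappa>) = shift p q r (fst \<kappa>)] (mod 3)}"
  \<comment> \<open>Weighted summation norms of the entries; their total bounds every row sum,
    uniformly in the frequency.\<close>
  define h where "h = (\<lambda>i j. \<Sum>\<^sub>\<infinity>m. norm (vc i j m) * weight m)"
  define \<rho> where "\<rho> = (\<lambda>\<kappa> :: 3 \<times> int \<times> int. (fst \<kappa>, rot (snd \<kappa>)))"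
  have vc_sm: "(\<lambda>m. norm (vc i j m) * weight m) summable_on UNIV" for i j
    unfolding vc_def by (rule scaled_potential_weight[OF U refl])
  have vc_rot: "vc i j (rot k) = cnj om * vc i j k" for i j k
    unfolding vc_def by (rule scaled_potential_coef_rot[OF U refl])
  have vc_cong: "[fst m = shift p q r i - shift p q r j] (mod 3) \<and> [snd m = shift p q r i - shift p q r j] (mod 3)"
    if "vc i j m \<noteq> 0" for i j m
  proof -
    have "amplitude \<alpha> i j \<noteq> 0"
      using that by (auto simp: vc_def coef_def)
    then show ?thesis
      using that scaled_potential_coef_cong[OF U refl, of "amplitude \<alpha> i j" "dilation p P i j" m] dilation_cong[OF P, of \<alpha> i j p r]
      unfolding vc_def by (metis cong_trans)
  qed
  have w0: "0 \<le> norm (vc i j m) * weight m" for i j m by (simp add: weight_pos less_imp_le)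
  have shifted: "((\<lambda>\<kappa>'. norm (V \<kappa> \<kappa>') * weight (snd \<kappa> - snd \<kappa>')) has_sum (\<Sum>j\<in>UNIV. h (fst \<kappa>) j)) UNIV" for \<kappa>
  proof -
    have bij: "bij (\<lambda>l. snd \<kappa> - l)"
      by (rule bij_betw_byWitness[of _ "\<lambda>l. snd \<kappa> - l"]) auto
    have inner: "((\<lambda>l. norm (V \<kappa> (j, l)) * weight (snd \<kappa> - snd (j, l))) has_sum h (fst \<kappa>) j) UNIV" for j
      using has_sum_reindex_bij_betw[OF bij, of "\<lambda>m. norm (vc (fst \<kappa>) j m) * weight m" "h (fst \<kappa>) j"]
        has_sum_infsum[OF vc_sm[of "fst \<kappa>" j]]
      by (simp add: V_def h_def)
    have outer: "((\<lambda>j. h (fst \<kappa>) j) has_sum (\<Sum>j\<in>UNIV. h (fst \<kappa>) j)) UNIV"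
      by (rule has_sum_finite) simp
    have "((\<lambda>\<kappa>'. norm (V \<kappa> \<kappa>') * weight (snd \<kappa> - snd \<kappa>')) has_sum (\<Sum>j\<in>UNIV. h (fst \<kappa>) j)) (Sigma UNIV (\<lambda>_. UNIV))"
    proof (rule has_sum_SigmaI[OF inner outer], rule summable_on_SigmaI[OF inner])
      show "(\<lambda>j. h (fst \<kappa>) j) summable_on UNIV" using outer by (rule has_sum_imp_summable)
    qed (simp add: V_def w0)
    then show ?thesis by simp
  qed
  \<comment> \<open>Submultiplicativity replaces the quotient of weights by the weight of the
    difference, whose row sum no longer depends on the frequency.\<close>
  have le_shifted: "norm (V \<kappa> \<kappa>') * (weight (snd \<kappa>) / weight (snd \<kappa>')) \<le> norm (V \<kappa> \<kappa>') * weight (snd \<kappa> - snd \<kappa>')" for \<kappa> \<kappa>'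
    using weight_submult[of "snd \<kappa>" "snd \<kappa>'"] weight_pos[of "snd \<kappa>'"]
    by (intro mult_left_mono) (auto simp: field_simps)
  have sm: "(\<lambda>\<kappa>'. norm (V \<kappa> \<kappa>') * (weight (snd \<kappa>) / weight (snd \<kappa>'))) summable_on UNIV" for \<kappa>
    by (rule summable_on_comparison_test[OF has_sum_imp_summable[OF shifted[of \<kappa>]] le_shifted])
       (simp add: weight_pos less_imp_le)
  have h0: "0 \<le> h i j" for i j unfolding h_def by (intro infsum_nonneg w0)
  have le: "(\<Sum>\<^sub>\<infinity>\<kappa>'. norm (V \<kappa> \<kappa>') * (weight (snd \<kappa>) / weight (snd \<kappa>'))) \<le> (\<Sum>i\<in>UNIV. \<Sum>j\<in>UNIV. h i j)" for \<kappa>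
  proof -
    have "(\<Sum>\<^sub>\<infinity>\<kappa>'. norm (V \<kappa> \<kappa>') * (weight (snd \<kappa>) / weight (snd \<kappa>'))) \<le> (\<Sum>\<^sub>\<infinity>\<kappa>'. norm (V \<kappa> \<kappa>') * weight (snd \<kappa> - snd \<kappa>'))"
      by (rule infsum_mono[OF sm has_sum_imp_summable[OF shifted] le_shifted])
    also have "\<dots> = (\<Sum>j\<in>UNIV. h (fst \<kappa>) j)" by (rule infsumI[OF shifted])
    also have "\<dots> \<le> (\<Sum>i\<in>UNIV. \<Sum>j\<in>UNIV. h i j)"
      by (rule member_le_sum) (auto intro: sum_nonneg h0)
    finally show ?thesis .
  qed
  have "\<exists>u :: nat \<Rightarrow> 3 \<times> int \<times> int \<Rightarrow> complex.
           (\<forall>m<n. (\<exists>M. \<forall>\<kappa>. norm (u m \<kappa>) * weight (snd \<kappa>) \<le> M) \<and> (\<forall>\<kappa>. u m (\<rho> \<kappa>) = u m \<kappa>) \<and>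
              (\<forall>\<kappa>. \<kappa> \<notin> S \<longrightarrow> u m \<kappa> = 0) \<and>
              (\<forall>\<kappa>. (\<lambda>\<kappa>'. V \<kappa> \<kappa>' * u m \<kappa>') summable_on UNIV) \<and>
              (\<forall>\<kappa>. freq (snd \<kappa>) * u m \<kappa> + (\<Sum>\<^sub>\<infinity>\<kappa>'. V \<kappa> \<kappa>' * u m \<kappa>') = 0)) \<and>
           (\<forall>c. (\<forall>\<kappa>. (\<Sum>m<n. c m * u m \<kappa>) = 0) \<longrightarrow> (\<forall>m<n. c m = 0))"
  proof (rule invariant_kernel_dimension[OF _ _ sm le, where \<tau> = "cnj om"])
    show "0 < weight (snd \<kappa>)" "weight (snd (\<rho> \<kappa>)) = weight (snd \<kappa>)" for \<kappa> :: "3 \<times> int \<times> int"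
      by (rule weight_pos) (simp add: \<rho>_def weight_def freq_rot norm_mult norm_om)
    show "finite {\<kappa> :: 3 \<times> int \<times> int. norm (freq (snd \<kappa>)) \<le> R}" for R
      by (rule finite_subset[of _ "UNIV \<times> {k. norm (freq k) \<le> R}"]) (auto intro: finite_freq_le)
    show "bij \<rho>" unfolding \<rho>_def by (rule bij_map_snd[OF bij_rot])
    have rot_diff: "rot k - rot l = rot (k - l)" for k l by (simp add: rot_def)
    show "V (\<rho> \<kappa>) (\<rho> \<kappa>') = cnj om * V \<kappa> \<kappa>'" for \<kappa> \<kappa>'
      by (simp add: V_def \<rho>_def rot_diff vc_rot)
    show "freq (snd (\<rho> \<kappa>)) = cnj om * freq (snd \<kappa>)" for \<kappa> by (simp add: \<rho>_def freq_rot)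
    show "norm (cnj om) = 1" by (simp add: norm_om)
    show "cnj om \<noteq> 1" by (simp add: complex_eq_iff Re_om)
    show "\<rho> \<kappa> = \<kappa>" if "freq (snd \<kappa>) = 0" for \<kappa>
      using that by (auto simp: freq_eq_0_iff \<rho>_def rot_def prod_eq_iff)
    show "\<kappa> \<in> S \<longleftrightarrow> \<kappa>' \<in> S" if "V \<kappa> \<kappa>' \<noteq> 0" for \<kappa> \<kappa>'
    proof -
      have *: "3 dvd (a - s) \<longleftrightarrow> 3 dvd (b - t)" if "3 dvd (a - b - (s - t))" for a b s t :: int
        using that by presburger
      have "[fst (snd \<kappa> - snd \<kappa>') = shift p q r (fst \<kappa>) - shift p q r (fst \<kappa>')] (mod 3)"
        "[snd (snd \<kappa> - snd \<kappa>') = shift p q r (fst \<kappa>) - shift p q r (fst \<kappa>')] (mod 3)"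
        using vc_cong[of "fst \<kappa>" "fst \<kappa>'" "snd \<kappa> - snd \<kappa>'"] that by (simp_all add: V_def)
      then show ?thesis
        unfolding S_def cong_iff_dvd_diff fst_diff snd_diff mem_Collect_eq by (simp only: *)
    qed
    \<comment> \<open>The unknowns without an equation: frequency 0 in those components whose
      constant vector lies in the sector.\<close>
    have "{\<kappa> \<in> S. freq (snd \<kappa>) = 0} = (\<lambda>i. (i, 0)) ` {i. [shift p q r i = 0] (mod 3)}"
      by (auto simp: S_def freq_eq_0_iff image_iff cong_sym_eq[of 0] prod_eq_iff)
    moreover have "inj (\<lambda>i :: 3. (i, 0 :: int \<times> int))" by (simp add: inj_def)
    ultimately show "n \<le> card {\<kappa> \<in> S. freq (snd \<kappa>) = 0}"
      using n by (simp add: card_image inj_on_def)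
  qed
  then show ?thesis
    unfolding V_def S_def \<rho>_def mem_Collect_eq .
qed


text \<open>The coefficient families are summed to functions \<open>b m\<close>. Absolute
  summability of \<open>u\<close> and \<open>freq k * u\<close> makes \<open>b m\<close> and its
  weak derivative continuous, hence elements of \<open>L2loc\<close>, and lets the sector conditions
  and the equation be read off from the coefficients at every point.\<close>

lemma kernel_independent:
  assumes U: "is_potential U" and P: "[P = q] (mod 3)"
    and n: "n \<le> card {i. [shift p q r i = 0] (mod 3)}"
  shows "\<exists>b. (\<forall>m<n. b m \<in> ker_D U p q (of_int P) \<alpha> r 0) \<and> ae_independent n b"
proof -
  define W where "W = (\<lambda>i j z. amplitude \<alpha> i j * U (of_int (dilation p P i j) * z))"
  define vc where "vc = (\<lambda>i j. coef (W i j))"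
  have W_exp: "W i j z = fseries (vc i j) z" for i j z
    using scaled_potential_expansion[OF U refl] unfolding vc_def W_def by blast
  have vc_sm: "(\<lambda>k. norm (vc i j k)) summable_on UNIV" for i j
    using scaled_potential_summable[OF U refl] unfolding vc_def W_def by blast
  have vc_eq: "vc = (\<lambda>i j. coef (\<lambda>z. amplitude \<alpha> i j * U (of_int (dilation p P i j) * z)))"
    by (simp add: vc_def W_def)
  obtain u :: "nat \<Rightarrow> 3 \<times> int \<times> int \<Rightarrow> complex" where
    sol: "\<forall>m<n. (\<exists>M. \<forall>\<kappa>. norm (u m \<kappa>) * weight (snd \<kappa>) \<le> M) \<and> (\<forall>\<kappa>. u m (fst \<kappa>, rot (snd \<kappa>)) = u m \<kappa>) \<and>
        (\<forall>\<kappa>. \<not> ([fst (snd \<kappa>) = shift p q r (fst \<kappa>)] (mod 3) \<and> [snd (snd \<kappa>) = shift p q r (fst \<kappa>)] (mod 3)) \<longrightarrow> u m \<kappa> = 0) \<and>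
        (\<forall>\<kappa>. (\<lambda>\<kappa>'. vc (fst \<kappa>) (fst \<kappa>') (snd \<kappa> - snd \<kappa>') * u m \<kappa>') summable_on UNIV) \<and>
        (\<forall>\<kappa>. freq (snd \<kappa>) * u m \<kappa> + (\<Sum>\<^sub>\<infinity>\<kappa>'. vc (fst \<kappa>) (fst \<kappa>') (snd \<kappa> - snd \<kappa>') * u m \<kappa>') = 0)"
    and ind: "\<forall>c. (\<forall>\<kappa>. (\<Sum>m<n. c m * u m \<kappa>) = 0) \<longrightarrow> (\<forall>m<n. c m = 0)"
    using fourier_solutions[OF U P n vc_eq] by (elim exE conjE) (rule that)
  have u: "\<exists>M. \<forall>i k. norm (u m (i, k)) * weight k \<le> M"
      "u m (i, rot k) = u m (i, k)"
      "u m (i, k) \<noteq> 0 \<Longrightarrow> [fst k = shift p q r i] (mod 3) \<and> [snd k = shift p q r i] (mod 3)"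
      "(\<lambda>(j, l). vc i j (k - l) * u m (j, l)) summable_on UNIV"
      "freq k * u m (i, k) + (\<Sum>\<^sub>\<infinity>(j, l). vc i j (k - l) * u m (j, l)) = 0"
    if "m < n" for m i k
  proof -
    note sol' = sol[rule_format, OF that]
    show "\<exists>M. \<forall>i k. norm (u m (i, k)) * weight k \<le> M" using sol' by (metis snd_conv)
    show "u m (i, rot k) = u m (i, k)" using sol'[THEN conjunct2, THEN conjunct1, rule_format, of "(i, k)"] by simp
    show "u m (i, k) \<noteq> 0 \<Longrightarrow> [fst k = shift p q r i] (mod 3) \<and> [snd k = shift p q r i] (mod 3)"
      using sol'[THEN conjunct2, THEN conjunct2, THEN conjunct1, rule_format, of "(i, k)"] by auto
    show "(\<lambda>(j, l). vc i j (k - l) * u m (j, l)) summable_on UNIV"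
      using sol'[THEN conjunct2, THEN conjunct2, THEN conjunct2, THEN conjunct1, rule_format, of "(i, k)"]
      by (simp add: case_prod_beta')
    show "freq k * u m (i, k) + (\<Sum>\<^sub>\<infinity>(j, l). vc i j (k - l) * u m (j, l)) = 0"
      using sol'[THEN conjunct2, THEN conjunct2, THEN conjunct2, THEN conjunct2, rule_format, of "(i, k)"]
      by (simp add: case_prod_beta')
  qed
  define b where "b = (\<lambda>m z. \<chi> i. fseries (\<lambda>k. u m (i, k)) z)"
  have u_sm: "(\<lambda>k. norm (u m (i, k))) summable_on UNIV" "(\<lambda>k. norm (freq k * u m (i, k))) summable_on UNIV"
    if m: "m < n" for m i
  proof -
    obtain M where M: "\<And>i k. norm (u m (i, k)) * weight k \<le> M" using u(1)[OF m] by blast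
    show "(\<lambda>k. norm (u m (i, k))) summable_on UNIV" "(\<lambda>k. norm (freq k * u m (i, k))) summable_on UNIV"
      by (rule weight_bound_summable[where M = M], rule M)+
  qed
  have b_cont: "continuous_on UNIV (b m)" if m: "m < n" for m
    unfolding b_def by (intro continuous_on_vec_lambda continuous_on_fseries u_sm m)
  have "b m \<in> ker_D U p q (of_int P) \<alpha> r 0" if m: "m < n" for m
  proof -
    have tr: "fseries (\<lambda>k. u m (i, k)) (z + lattice_pt x y) = om powi (shift p q r i * (x + y)) * fseries (\<lambda>k. u m (i, k)) z" for i x y z
    proof -
      have "om powi (fst k * x + snd k * y) * u m (i, k) = om powi (shift p q r i * (x + y)) * u m (i, k)" for k
      proof (cases "u m (i, k) = 0")
        case False
        then have "[fst k * x + snd k * y = shift p q r i * x + shift p q r i * y] (mod 3)"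
          using u(3)[OF m False] by (intro cong_add cong_mult cong_refl) auto
        then have "om powi (fst k * x + snd k * y) = om powi (shift p q r i * (x + y))"
          by (simp add: om_powi_eq_iff distrib_left)
        then show ?thesis by simp
      qed simp
      then show ?thesis by (simp only: fseries_translate fseries_cmult)
    qed
    have sector: "b m \<in> L2_sector p q r 0"
    proof -
      have "diag3 (om powi (p * (x + y))) 1 (cnj om powi (q * (x + y))) *v b m (z + lattice_pt x y)
          = om powi (r * (x + y)) *s b m z" for x y z
        unfolding vec_eq_iff forall_3 diag3_mult_vec b_def
        by (simp add: tr shift_def cnj_om_powi mult.assoc[symmetric] power_int_add[OF disjI1[OF om_nonzero], symmetric])
           (simp add: algebra_simps)
      moreover have "b m (om * z) = b m z" for z
      proof -
        have "(\<lambda>k. u m (i, k)) \<circ> rot = (\<lambda>k. u m (i, k))" for i using u(2)[OF m] by auto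
        then have "fseries (\<lambda>k. u m (i, k)) (om * z) = fseries (\<lambda>k. u m (i, k)) z" for i
          using fseries_rotate[of "\<lambda>k. u m (i, k)" z] by simp
        then show ?thesis by (simp add: b_def)
      qed
      ultimately show ?thesis
        using continuous_L2loc[OF b_cont[OF m]] by (simp add: L2_sector_def)
    qed
    have eqn: "fseries (\<lambda>k. freq k * u m (i, k)) z + (\<Sum>j\<in>UNIV. W i j z * fseries (\<lambda>k. u m (j, k)) z) = 0" for i z
    proof -
      let ?c = "\<lambda>j k. \<Sum>\<^sub>\<infinity>l. vc i j (k - l) * u m (j, l)"
      have "((\<lambda>k. \<Sum>j\<in>UNIV. ?c j k * character k z) has_sum (\<Sum>j\<in>UNIV. W i j z * fseries (\<lambda>k. u m (j, k)) z)) UNIV"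
        unfolding W_exp by (intro has_sum_finite_sum finite fseries_mult(1) vc_sm u_sm m)
      from has_sum_add[OF fseries_has_sum[OF u_sm(2)[OF m]] this]
      have "((\<lambda>k. freq k * u m (i, k) * character k z + (\<Sum>j\<in>UNIV. ?c j k * character k z)) has_sum
        (fseries (\<lambda>k. freq k * u m (i, k)) z + (\<Sum>j\<in>UNIV. W i j z * fseries (\<lambda>k. u m (j, k)) z))) UNIV" .
      moreover have "freq k * u m (i, k) * character k z + (\<Sum>j\<in>UNIV. ?c j k * character k z) = 0" for k
      proof -
        \<comment> \<open>The sum over pairs (component, frequency) is split so that the finite sum
          over components required by the matrix product appears outside.\<close>
        have "(\<Sum>\<^sub>\<infinity>(j, l)\<in>Sigma UNIV (\<lambda>_. UNIV). vc i j (k - l) * u m (j, l)) = (\<Sum>\<^sub>\<infinity>j. ?c j k)"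
          using infsum_Sigma_banach[of "\<lambda>(j, l). vc i j (k - l) * u m (j, l)" UNIV "\<lambda>_. UNIV"] u(4)[OF m, of i k]
          by simp
        then have "freq k * u m (i, k) + (\<Sum>j\<in>UNIV. ?c j k) = 0"
          using u(5)[OF m, of k i] by simp
        then have "(freq k * u m (i, k) + (\<Sum>j\<in>UNIV. ?c j k)) * character k z = 0" by simp
        then show ?thesis by (simp add: distrib_right sum_distrib_right)
      qed
      ultimately show ?thesis by (simp add: has_sum_unique[OF _ has_sum_0_simp])
    qed
    \<comment> \<open>The distributional \<open>Dzbar\<close> of \<open>b m\<close>; half of
      \<open>freq k\<close> appears because \<open>freq k\<close> is the symbol of
      \<open>2 * Dzbar\<close>.\<close>
    define w where "w = (\<lambda>z. \<chi> i. fseries (\<lambda>k. freq k * u m (i, k)) z / 2)"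
    have "continuous_on UNIV w"
      unfolding w_def by (intro continuous_on_vec_lambda continuous_intros continuous_on_fseries u_sm m) simp
    then have "w \<in> L2loc" by (rule continuous_L2loc)
    moreover have "weak_Dzbar (\<lambda>z. b m z $ i) (\<lambda>z. w z $ i)" for i
      using weak_Dzbar_fseries[OF u_sm[OF m]] by (simp add: b_def w_def)
    moreover have "0 = 2 *s w z + potential_matrix U p (of_int P) \<alpha> z *v b m z" for z
      using eqn
      by (simp add: vec_eq_iff w_def matrix_vector_mult_def potential_matrix_entry b_def W_def)
    ultimately have "D_graph U p (of_int P) \<alpha> (b m) (\<lambda>_. 0)"
      using continuous_L2loc[OF b_cont[OF m]] unfolding D_graph_def by blast
    then show ?thesis using sector by (simp add: ker_D_def)
  qed
  moreover have "ae_independent n b"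
    unfolding ae_independent_def
  proof (intro allI impI)
    fix c m assume "m < n" and ae: "AE z in lebesgue. (\<Sum>i<n. c i *s b i z) = 0"
    \<comment> \<open>Continuity extends the relation to every point, and uniqueness of coefficients
      then carries it to the families \<open>u\<close>, where independence is known.\<close>
    have "continuous_on UNIV (\<lambda>z. (\<Sum>i<n. c i *s b i z) $ l)" for l
      using b_cont by (auto simp: sum_component intro!: continuous_intros)
    moreover have "AE z in lebesgue. (\<Sum>i<n. c i *s b i z) $ l = 0" for l
      using ae by eventually_elim simp
    ultimately have z: "(\<Sum>i<n. c i *s b i z) $ l = 0" for z l
      by (rule AE_continuous_eq_0)
    have "(\<Sum>i<n. c i * u i (l, k)) = 0" for l k
    proof -
    let ?s = "\<lambda>k. \<Sum>i<n. c i * u i (l, k)"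
    have s: "((\<lambda>k. ?s k * character k z) has_sum 0) UNIV" for z
    proof -
      have "((\<lambda>k. \<Sum>i<n. c i * (u i (l, k) * character k z)) has_sum (\<Sum>i<n. c i * fseries (\<lambda>k. u i (l, k)) z)) UNIV"
        by (intro has_sum_finite_sum has_sum_cmult_right fseries_has_sum u_sm) auto
      moreover have "(\<Sum>i<n. c i * fseries (\<lambda>k. u i (l, k)) z) = 0"
        using z[of z l] by (simp add: sum_component b_def)
      ultimately show ?thesis by (simp add: sum_distrib_right mult.assoc)
    qed
    have "?s = (\<lambda>k. 0)"
    proof (rule fseries_inject)
      have "(\<lambda>k. \<Sum>i<n. norm (c i) * norm (u i (l, k))) summable_on UNIV"
        by (intro infsum_finite_sum(1) summable_on_cmult_right u_sm) auto
      then show "(\<lambda>k. norm (?s k)) summable_on UNIV"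
        by (rule summable_on_comparison_test) (auto intro!: sum_norm_le simp: norm_mult)
      show "fseries ?s z = fseries (\<lambda>k. 0) z" for z
        using infsumI[OF s[of z]] by (simp add: fseries_def)
    qed simp
    from fun_cong[OF this, of k] show ?thesis .
    qed
    then show "c m = 0" using ind[rule_format, of c m] \<open>m < n\<close> by auto
  qed
  ultimately show ?thesis by blast
qed

section \<open>Dimension bounds and the two cases\<close>

lemma ae_dim_ge:
  assumes "\<forall>m<n. b m \<in> V" "ae_independent n b"
  shows "enat n \<le> ae_dim V"
  unfolding ae_dim_def by (rule Sup_upper) (use assms in blast)

lemma not_ae_trivial:
  assumes "b 0 \<in> V" "ae_independent 1 b"
  shows "\<not> ae_trivial V"
proof
  assume "ae_trivial V"
  then have "AE z in lebesgue. b 0 z = 0" using assms(1) by (simp add: ae_trivial_def)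
  then have "AE z in lebesgue. (\<Sum>i<1. 1 *s b i z) = 0" by simp
  with assms(2)[unfolded ae_independent_def, rule_format, of "\<lambda>_. 1" 0] show False by simp
qed

theorem proposition3p2:
  fixes \<zeta>1 \<zeta>2 pt :: real and j r1 p q :: int and r2 :: nat
    and U :: "complex \<Rightarrow> complex" and \<alpha> :: "complex \<times> complex"
  assumes "\<zeta>1 \<noteq> 0" and "\<zeta>2 \<noteq> 0"
    and "\<zeta>2 / \<zeta>1 = 3 powi j * of_int r1 / of_nat r2"
    and "\<not> [r1 = 0] (mod 3)" and "\<not> [int r2 = 0] (mod 3)"
    and "p = (if j > 0 then int r2 else 3 ^ nat (- j) * int r2)"
    and "q = (if j > 0 then 0 else r1)"
    and "pt = of_int p * \<zeta>2 / \<zeta>1"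
    and "is_potential U"
    and "\<not> [p = 0] (mod 3)"
  shows "(\<not> distinct [(- q) mod 3, p mod 3, 0 mod 3] \<longrightarrow>
           (\<exists>m\<in>{p, 0}. \<exists>n\<in>{p, 0}. \<not> [n = m] (mod 3) \<and>
              ae_dim (ker_D U p q pt \<alpha> m 0) \<ge> 2 \<and> \<not> ae_trivial (ker_D U p q pt \<alpha> n 0)))
       \<and> (distinct [(- q) mod 3, p mod 3, 0 mod 3] \<longrightarrow>
           \<not> ae_trivial (ker_D U p q pt \<alpha> p 0) \<and>
           \<not> ae_trivial (ker_D U p q pt \<alpha> 0 0) \<and>
           \<not> ae_trivial (ker_D U p q pt \<alpha> (- q) 0))"
proof -
  have r2: "r2 \<noteq> 0"
    by (rule notI) (use assms(5) in simp)
  have ptr: "pt = of_int p * (3 powi j * of_int r1 / of_nat r2)"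
    unfolding assms(3)[symmetric] assms(8) by simp
  \<comment> \<open>The factor \<open>p\<close> clears the denominator: for \<open>0 < j\<close> one
    gets \<open>pt = 3 ^ j * r1\<close>, divisible by 3 like \<open>q = 0\<close>, and otherwise
    \<open>pt = r1 = q\<close>.\<close>
  have "\<exists>P. pt = of_int P \<and> [P = q] (mod 3)"
  proof (cases "j > 0")
    case True
    have "pt = of_int (3 ^ nat j * r1)"
      using True r2 by (simp add: ptr assms(6) power_int_def)
    moreover have "[3 ^ nat j * r1 = q] (mod 3)"
      using True assms(7) by (simp add: cong_0_iff dvd_power)
    ultimately show ?thesis by blast
  next
    case False
    have "(3::real) ^ nat (- j) * 3 powi j = 1"
      using False by (cases "j = 0") (simp_all add: power_int_def flip: power_mult_distrib)
    then have "pt = of_int r1"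
      using False r2 by (simp add: ptr assms(6) mult_ac)
    then show ?thesis using False assms(7) by auto
  qed
  then obtain P where P: "pt = of_int P" "[P = q] (mod 3)" by blast
  note K = kernel_independent[OF assms(9) P(2), of _ p, folded P(1)]
  have dim: "2 \<le> ae_dim (ker_D U p q pt \<alpha> r 0)" if "2 \<le> card {i. [shift p q r i = 0] (mod 3)}" for r
    using K[OF that] ae_dim_ge by (metis numeral_eq_enat)
  have nontriv: "\<not> ae_trivial (ker_D U p q pt \<alpha> r 0)" if "[shift p q r i = 0] (mod 3)" for r i
  proof -
    have "card {i. [shift p q r i = 0] (mod 3)} \<noteq> 0" using that by auto
    then have "1 \<le> card {i. [shift p q r i = 0] (mod 3)}" by linarith
    from K[OF this] show ?thesis using not_ae_trivial by (metis zero_less_one)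
  qed
  have two: "2 \<le> card {i. [shift p q r i = 0] (mod 3)}"
    if "[shift p q r i = 0] (mod 3)" "[shift p q r i' = 0] (mod 3)" "i \<noteq> i'" for r i i'
    using card_mono[of "{i. [shift p q r i = 0] (mod 3)}" "{i, i'}"] that by simp
  have nt_p: "\<not> ae_trivial (ker_D U p q pt \<alpha> p 0)" using nontriv[of p 1] by (simp add: shift_def)
  have nt_0: "\<not> ae_trivial (ker_D U p q pt \<alpha> 0 0)" using nontriv[of 0 2] by (simp add: shift_def)
  have nt_q: "\<not> ae_trivial (ker_D U p q pt \<alpha> (- q) 0)" using nontriv[of "- q" 3] by (simp add: shift_def)
  show ?thesis
  proof (intro conjI impI)
    assume "\<not> distinct [(- q) mod 3, p mod 3, 0 mod 3]"
    \<comment> \<open>As \<open>p\<close> is not 0 mod 3, a coincidence must involve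
      \<open>- q\<close>.\<close>
    then have "- q mod 3 = p mod 3 \<or> - q mod 3 = 0"
      using assms(10) by (auto simp: cong_def)
    then have "(p + q) mod 3 = 0 \<or> q mod 3 = 0" by presburger
    then consider "[p + q = 0] (mod 3)" | "[q = 0] (mod 3)"
      by (auto simp: cong_def)
    then show "\<exists>m\<in>{p, 0}. \<exists>n\<in>{p, 0}. \<not> [n = m] (mod 3) \<and>
        2 \<le> ae_dim (ker_D U p q pt \<alpha> m 0) \<and> \<not> ae_trivial (ker_D U p q pt \<alpha> n 0)"
    proof cases
      case 1
      \<comment> \<open>The constant vectors of components 1 and 3 now share the sector
        \<open>p\<close>, and that of component 2 is left for the sector 0.\<close>
      then have "2 \<le> ae_dim (ker_D U p q pt \<alpha> p 0)"
        by (intro dim two[of p 1 3]) (simp_all add: shift_def)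
      then show ?thesis using nt_0 assms(10) by (auto simp: cong_sym_eq)
    next
      case 2
      \<comment> \<open>Here components 2 and 3 share the sector 0, and component 1 accounts for the
        sector \<open>p\<close>.\<close>
      then have "2 \<le> ae_dim (ker_D U p q pt \<alpha> 0 0)"
        by (intro dim two[of 0 2 3]) (simp_all add: shift_def)
      then show ?thesis using nt_p assms(10) by auto
    qed
  qed (rule nt_p nt_0 nt_q)+
qed

end
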